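(* Let either the sign be $+$ and $n\ge2$ even, or the sign be $-$ and $n\ge3$ odd; put $\eta=\pm1$ accordingly, and write $A=A_2^{\pm}(n,q)$, $B=B_2^{\pm}(n,q)$, $N=N_2^{\pm}(n,q)=|DC_2^{\pm}(n,q)|$. Then $N=AB$ and for every integer $h\ge1$, $$\eta^h\,SK^{2h}=-\sum_{l=0}^{h-1}\eta^l\binom hl B^{\,h-l}SK^{2l}+qA^{-h}\sum_{j=0}^{\min\{N,h\}}(-1)^jC_j\sum_{t=j}^h t!\,S(h,t)\,3^{h-t}2^{t-h-j-1}\binom{N-j}{N-t},$$ where $\{C_j\}_{j=0}^N$ is the weight distribution of the ternary code $C(DC_2^{\pm}(n,q))$.
   Context: Let $q=3^s$, $\mathrm{tr}:\mathbb F_q\to\mathbb F_3$ the absolute trace, $\lambda(x)=e^{2\pi i\,\mathrm{tr}(x)/3}$. $K(\psi;a)=\sum_{\alpha\in\mathbb F_q^*}\psi(\alpha+a\alpha^{-1})$. For $h\ge0$, $SK^h=\sum_{a\in\mathbb F_q^*,\,a\text{ square}}K(\lambda;a)^h$. $S(h,t)=\frac1{t!}\sum_{j=0}^t(-1)^{t-j}\binom tj j^h$. Fix a nonsquare $\epsilon\in\mathbb F_q^*$, $\delta_\epsilon=\mathrm{diag}(1,-\epsilon)$, $J=\begin{bmatrix}0&1_{n-1}&0\\1_{n-1}&0&0\\0&0&\delta_\epsilon\end{bmatrix}$, $O^-(2n,q)=\{w\in GL(2n,q):{}^twJw=J\}$, $SO^-(2n,q)$ its determinant-one subgroup. $Q=Q(2n,q)$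 is the set of products $\begin{bmatrix}A&0&0\\0&{}^tA^{-1}&0\\0&0&i\end{bmatrix}\begin{bmatrix}1_{n-1}&B&-{}^th\delta_\epsilon\\0&1_{n-1}&0\\0&h&1_2\end{bmatrix}$ with $A\in GL(n-1,q)$, $i\in SO^-(2,q)$, ${}^tB+B+{}^th\delta_\epsilon h=0$ ($B$ of size $(n-1)\times(n-1)$, $h$ of size $2\times(n-1)$). For $0\le r\le n-1$, $\sigma_r=\begin{bmatrix}0&0&1_r&0&0\\0&1_{n-1-r}&0&0&0\\1_r&0&0&0&0\\0&0&0&1_{n-1-r}&0\\0&0&0&0&1_2\end{bmatrix}$. $DC_2^{\pm}(n,q)=Q\sigma_{n-2}Q=\{x\sigma_{n-2}y:x,y\in Q\}$ (sign $+$ for $n$ even, $-$ for $n$ odd). Constants (empty products $=1$, $\left[{m\atop 1}\right]_q=\frac{q^m-1}{q-1}$): $A_2^+(n,q)=q^{(5n^2-2n-8)/4}\left[{n-1\atop1}\right]_q\prod_{j=1}^{(n-2)/2}(q^{2j-1}-1)$, $B_2^+(n,q)=(q+1)q^{(n-2)^2/4}(q^{n-1}-1)\prod_{j=1}^{(n-2)/2}(q^{2j}-1)$; $A_2^-(n,q)=q^{(5n^2-4n-5)/4}\left[{n-1\atop1}\right]_q\prod_{j=1}^{(n-1)/2}(q^{2j-1}-1)$, $B_2^-(n,q)=(q+1)q^{(n-1)^2/4}\prod_{j=1}^{(n-1)/2}(q^{2j}-1)$. Code: fix an ordering $g_1,\dots,g_N$ of $D=DC_2^{\pm}(n,q)$;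 $C(D)=\{u\in\mathbb F_3^N:\sum_j u_j\mathrm{Tr}(g_j)=0\text{ in }\mathbb F_q\}$ ($\mathrm{Tr}$ = matrix trace); $C_j$ = number of codewords of Hamming weight $j$. *)

theory Defs
  imports Complex_Main "HOL-Library.FuncSet" "Jordan_Normal_Form.Determinant"
begin

(* absolute trace tr : F_q -> F_3 (F_3 = prime subfield of 'a) *)
definition ftr :: "nat \<Rightarrow> 'a::field \<Rightarrow> 'a" where
  "ftr s x = (\<Sum>i<s. x ^ (3 ^ i))"

definition ftr_nat :: "nat \<Rightarrow> 'a::field \<Rightarrow> nat" where
  "ftr_nat s x = (THE k. k < 3 \<and> of_nat k = ftr s x)"

definition lam :: "nat \<Rightarrow> 'a::field \<Rightarrow> complex" where
  "lam s x = cis (2 * pi * real (ftr_nat s x) / 3)"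

definition kloos :: "nat \<Rightarrow> 'a::{finite,field} \<Rightarrow> complex" where
  "kloos s a = (\<Sum>\<alpha>\<in>UNIV - {0}. lam s (\<alpha> + a * inverse \<alpha>))"

definition SK :: "'a::{finite,field} itself \<Rightarrow> nat \<Rightarrow> nat \<Rightarrow> complex" where
  "SK T s h = (\<Sum>a\<in>{a::'a. a \<noteq> 0 \<and> (\<exists>b. a = b ^ 2)}. (kloos s a) ^ h)"

definition stirS :: "nat \<Rightarrow> nat \<Rightarrow> complex" where
  "stirS h t = (1 / of_nat (fact t)) *
     (\<Sum>j=0..t. (-1) ^ (t - j) * of_nat (t choose j) * of_nat j ^ h)"

definition mat_tr :: "'a::comm_ring_1 mat \<Rightarrow> 'a" where
  "mat_tr A = (\<Sum>i<dim_row A. A $$ (i, i))"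

definition mat_inv :: "nat \<Rightarrow> 'a::comm_ring_1 mat \<Rightarrow> 'a mat" where
  "mat_inv m A = (THE B. B \<in> carrier_mat m m \<and> A * B = 1\<^sub>m m)"

definition bidx :: "nat \<Rightarrow> nat \<Rightarrow> nat \<Rightarrow> nat \<times> nat" where
  "bidx a b i = (if i < a then (0, i) else if i < a + b then (1, i - a) else (2, i - a - b))"

definition blk3 :: "nat \<Rightarrow> nat \<Rightarrow> nat \<Rightarrow> (nat \<Rightarrow> nat \<Rightarrow> 'a mat) \<Rightarrow> 'a mat" where
  "blk3 a b c M = mat (a + b + c) (a + b + c)
     (\<lambda>(i, j). case bidx a b i of (p, i') \<Rightarrow> case bidx a b j of (r, j') \<Rightarrow> M p r $$ (i', j'))"

definition blocks3 :: "nat \<Rightarrow> nat \<Rightarrow> nat \<Rightarrow> 'a mat list list \<Rightarrow> 'a mat" where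
  "blocks3 a b c L = blk3 a b c (\<lambda>p r. L ! p ! r)"

definition delta_eps :: "'a::comm_ring_1 \<Rightarrow> 'a mat" where
  "delta_eps \<epsilon> = mat 2 2 (\<lambda>(i, j). if i = j then (if i = 0 then 1 else - \<epsilon>) else 0)"

definition Jmat :: "nat \<Rightarrow> 'a::comm_ring_1 \<Rightarrow> 'a mat" where
  "Jmat n \<epsilon> = (let m = n - 1 in blocks3 m m 2
     [[0\<^sub>m m m, 1\<^sub>m m, 0\<^sub>m m 2],
      [1\<^sub>m m, 0\<^sub>m m m, 0\<^sub>m m 2],
      [0\<^sub>m 2 m, 0\<^sub>m 2 m, delta_eps \<epsilon>]])"

definition Ominus :: "nat \<Rightarrow> 'a::comm_ring_1 \<Rightarrow> 'a mat set" where
  "Ominus n \<epsilon> = {w \<in> carrier_mat (2 * n) (2 * n). invertible_mat w \<and>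
                    transpose_mat w * Jmat n \<epsilon> * w = Jmat n \<epsilon>}"

definition SOminus :: "nat \<Rightarrow> 'a::comm_ring_1 \<Rightarrow> 'a mat set" where
  "SOminus n \<epsilon> = {w \<in> Ominus n \<epsilon>. det w = 1}"

(* the parabolic subgroup Q(2n,q) *)
definition Qgrp :: "nat \<Rightarrow> 'a::field \<Rightarrow> 'a mat set" where
  "Qgrp n \<epsilon> = (let m = n - 1 in
     {blocks3 m m 2
        [[A, 0\<^sub>m m m, 0\<^sub>m m 2],
         [0\<^sub>m m m, transpose_mat (mat_inv m A), 0\<^sub>m m 2],
         [0\<^sub>m 2 m, 0\<^sub>m 2 m, i]]
      * blocks3 m m 2
        [[1\<^sub>m m, B, - (transpose_mat h * delta_eps \<epsilon>)],
         [0\<^sub>m m m, 1\<^sub>m m, 0\<^sub>m m 2],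
         [0\<^sub>m 2 m, h, 1\<^sub>m 2]]
      | A B h i. A \<in> carrier_mat m m \<and> invertible_mat A \<and> i \<in> SOminus 1 \<epsilon> \<and>
          B \<in> carrier_mat m m \<and> h \<in> carrier_mat 2 m \<and>
          transpose_mat B + B + transpose_mat h * delta_eps \<epsilon> * h = 0\<^sub>m m m})"

(* sigma_r: 5x5 block matrix with block sizes r, n-1-r, r, n-1-r, 2 (a permutation matrix) *)
definition sigma_perm :: "nat \<Rightarrow> nat \<Rightarrow> nat \<Rightarrow> nat" where
  "sigma_perm n r i = (let m = n - 1 in
     if i < r then m + i else if m \<le> i \<and> i < m + r then i - m else i)"

definition sigma_mat :: "nat \<Rightarrow> nat \<Rightarrow> 'a::comm_ring_1 mat" where
  "sigma_mat n r = mat (2 * n) (2 * n) (\<lambda>(i, j). if j = sigma_perm n r i then 1 else 0)"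

definition DC2 :: "nat \<Rightarrow> 'a::field \<Rightarrow> 'a mat set" where
  "DC2 n \<epsilon> = {x * sigma_mat n (n - 2) * y | x y. x \<in> Qgrp n \<epsilon> \<and> y \<in> Qgrp n \<epsilon>}"

(* codewords: vectors u in F_3^D (F_3 = {0,1,2}), indexed by the elements of D *)
definition code :: "'a::field mat set \<Rightarrow> ('a mat \<Rightarrow> nat) set" where
  "code D = {u \<in> D \<rightarrow>\<^sub>E {0, 1, 2}. (\<Sum>g\<in>D. of_nat (u g) * mat_tr g) = (0::'a)}"

definition wt :: "'a mat set \<Rightarrow> ('a mat \<Rightarrow> nat) \<Rightarrow> nat" where
  "wt D u = card {g \<in> D. u g \<noteq> 0}"

definition wdist :: "'a::field mat set \<Rightarrow> nat \<Rightarrow> nat" where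
  "wdist D j = card {u \<in> code D. wt D u = j}"

definition qbin1 :: "nat \<Rightarrow> nat \<Rightarrow> nat" where
  "qbin1 q m = (q ^ m - 1) div (q - 1)"

definition A2plus :: "nat \<Rightarrow> nat \<Rightarrow> nat" where
  "A2plus n q = q ^ ((5 * n^2 - 2 * n - 8) div 4) * qbin1 q (n - 1) *
     (\<Prod>j=1..(n - 2) div 2. q ^ (2 * j - 1) - 1)"

definition B2plus :: "nat \<Rightarrow> nat \<Rightarrow> nat" where
  "B2plus n q = (q + 1) * q ^ ((n - 2)^2 div 4) * (q ^ (n - 1) - 1) *
     (\<Prod>j=1..(n - 2) div 2. q ^ (2 * j) - 1)"

definition A2minus :: "nat \<Rightarrow> nat \<Rightarrow> nat" where
  "A2minus n q = q ^ ((5 * n^2 - 4 * n - 5) div 4) * qbin1 q (n - 1) *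
     (\<Prod>j=1..(n - 1) div 2. q ^ (2 * j - 1) - 1)"

definition B2minus :: "nat \<Rightarrow> nat \<Rightarrow> nat" where
  "B2minus n q = (q + 1) * q ^ ((n - 1)^2 div 4) *
     (\<Prod>j=1..(n - 1) div 2. q ^ (2 * j) - 1)"

end

theory Submission
  imports Defs "HOL-Computational_Algebra.Polynomial"
begin

text \<open>
  For \<open>a \<noteq> 0\<close> the codeword \<open>c(a) = (tr (a Tr g))\<^sub>g\<close>, with \<open>g\<close> running through \<open>D = Q\<sigma>Q\<close>, has weight
  \<open>(2A/3)(B + \<eta> K(a\<^sup>2)\<^sup>2)\<close>. The identity then follows by computing the sum over \<open>a\<close> of the \<open>h\<close>-th powers of
  these weights in a second way: expand \<open>w\<^sup>h\<close> into binomial coefficients \<open>w choose t\<close> and detect nonzero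
  coordinates by the additive character \<open>\<lambda>\<close>, which leaves exactly the words of the code \<open>C(D)\<close>.

  The weight is an exponential sum over \<open>D\<close>, which is a multiple of the sum of \<open>\<lambda>(a Tr (w\<sigma>))\<close> over \<open>w \<in> Q\<close>.
  In the coordinates \<open>(A, i, h, C)\<close> of \<open>Q\<close>, with \<open>C\<close> skew, the sum over \<open>C\<close> forces \<open>A\<close> to be block lower
  triangular with a symmetric block \<open>S\<close> and a scalar \<open>x\<close> on the diagonal. The sum over \<open>h\<close> is then a product
  of the quadratic Gauss sums of \<open>S\<close> and \<open>-\<epsilon>S\<close>, whose value \<open>(-q)\<^sup>r\<close> does not depend on \<open>S\<close>; the sum over
  \<open>x\<close> is \<open>K(a\<^sup>2)\<close> and the sum over \<open>i\<close> is \<open>-K(a\<^sup>2)\<close>.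
\<close>

subsection \<open>The canonical additive character\<close>

text \<open>Both constants are counts. With \<open>r = n - 2\<close>, \<open>A\<close> is the index
  of \<open>Q \<inter> \<sigma>Q\<sigma>\<close> in \<open>Q\<close> times the modulus of the sum
  over \<open>Q\<close> without its Kloosterman factors: the number of skew matrices of size
  \<open>r + 1\<close>, \<open>q ^ (2 * r + 2)\<close>, and the number of invertible symmetric
  matrices of size \<open>r\<close>. \<open>B\<close> is what remains of the order of the double
  coset, the quotient of \<open>card (GL (r + 1)) * (q + 1)\<close> by that last number. Its product
  formula is why invertible symmetric matrices must be counted exactly; their recursion goes back
  two sizes, hence the two parities. The sign \<eta> is \<open>(-1) ^ r\<close>, left by
  \<open>(-q) ^ r\<close>. The Gauss product does not see \<open>S\<close> because \<epsilon> is a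
  nonsquare: each diagonal entry contributes a multiple of the anisotropic form
  \<open>x\<^sup>2 - \<epsilon> y\<^sup>2\<close>, whose sum is \<open>-q\<close> for every nonzero
  factor. Since \<open>K\<close> depends on \<open>a\<^sup>2\<close> only, the sums for
  \<open>a\<close> and \<open>2 a = -a\<close>, which both occur in a weight, agree, and every
  nonzero square is met twice; the resulting factor 1/2 is the \<open>-1\<close> in the exponent of
  2.\<close>

locale ternary =
  fixes s :: nat and TY :: "'a::{finite,field} itself"
  assumes card_UNIV: "card (UNIV :: 'a set) = 3 ^ s"
begin

abbreviation "q \<equiv> (3::nat) ^ s"
abbreviation \<chi> :: "'a \<Rightarrow> complex" where "\<chi> \<equiv> lam s"

text \<open>Translation by 1 permutes the field, so adding up all elements gives
  \<open>card UNIV\<close> times 1 equal to 0; in a field a vanishing power of 3 means 3 =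
  0.\<close>

lemma three_eq_0: "(3::'a) = 0"
proof -
  have "(\<Sum>x\<in>(UNIV::'a set). x + 1) = (\<Sum>x\<in>UNIV. x)"
    by (rule sum.reindex_bij_witness[of _ "\<lambda>x. x - 1" "\<lambda>x. x + 1"]) auto
  hence "of_nat (card (UNIV::'a set)) = (0::'a)"
    by (simp add: sum.distrib)
  hence "(3::'a) ^ s = 0" by (simp add: card_UNIV)
  thus ?thesis by simp
qed

lemma two_eq: "(2::'a) = -1"
proof -
  have "(2::'a) + 1 = 3" by simp
  thus ?thesis unfolding three_eq_0 by (simp add: eq_neg_iff_add_eq_0)
qed

lemma two_nz: "(2::'a) \<noteq> 0" by (simp add: two_eq)

lemma neg_eq_iff: "- x = x \<longleftrightarrow> x = (0::'a)"
proof
  assume "- x = x"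
  hence "2 * x = 0" by (simp add: two_eq)
  thus "x = 0" using two_nz by simp
qed simp

lemma s_pos: "s > 0"
proof (rule ccontr)
  assume "\<not> s > 0"
  hence "card (UNIV::'a set) = 1" by (simp add: card_UNIV)
  then obtain x :: 'a where "UNIV = {x}" by (auto simp: card_1_singleton_iff)
  hence "(0::'a) = x" "(1::'a) = x" by blast+
  thus False by auto
qed

lemma q_gt_1: "q > 1" using one_less_power[of "3::nat" s] s_pos by simp

lemma card_nonzero: "card (UNIV - {0::'a}) = q - 1"
  by (simp add: card_UNIV)

text \<open>Multiplication by a nonzero \<open>x\<close> permutes the nonzero elements; comparing
  the two products gives \<open>x ^ (q - 1) = 1\<close>.\<close>

lemma pow_card: "(x::'a) ^ q = x"
proof (cases "x = 0")
  case False
  have "(\<Prod>y\<in>UNIV - {0}. x * y) = (\<Prod>y\<in>UNIV - {0::'a}. y)"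
    by (rule prod.reindex_bij_witness[of _ "\<lambda>y. y / x" "\<lambda>y. x * y"]) (use False in auto)
  moreover have "(\<Prod>y\<in>UNIV - {0::'a}. y) \<noteq> 0" by simp
  ultimately have "x ^ (q - 1) = 1"
    by (simp only: prod.distrib prod_constant card_nonzero) simp
  hence "x * x ^ (q - 1) = x" by simp
  moreover have "q = Suc (q - 1)" using q_gt_1 by linarith
  ultimately show ?thesis by (metis power_Suc)
qed (use s_pos in auto)

lemma cube_add: "((x::'a) + y) ^ 3 = x ^ 3 + y ^ 3"
proof -
  have "z + (z + z) = 0" for z :: 'a
    using three_eq_0 by simp
  thus ?thesis unfolding power3_eq_cube
    by (simp add: ring_distribs mult_ac add_ac three_eq_0)
qed

lemma pow3_add: "((x::'a) + y) ^ 3 ^ i = x ^ 3 ^ i + y ^ 3 ^ i"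
proof (induction i arbitrary: x y)
  case (Suc i)
  have "z ^ 3 ^ Suc i = (z ^ 3) ^ 3 ^ i" for z :: 'a
    by (simp add: power_mult)
  thus ?case by (simp only: cube_add Suc.IH)
qed simp

lemma cube_sum: "(\<Sum>i\<in>I. f i :: 'a) ^ 3 = (\<Sum>i\<in>I. f i ^ 3)"
  by (induction I rule: infinite_finite_induct) (simp_all add: cube_add)

lemma ftr_add: "ftr s (x + y) = ftr s x + ftr s (y::'a)"
  by (simp add: ftr_def pow3_add sum.distrib)

lemma ftr_0 [simp]: "ftr s (0::'a) = 0"
  by (simp add: ftr_def zero_power)

text \<open>Frobenius moves the summands of the trace by one place, and \<open>x ^ q = x\<close>
  closes the cycle. Being fixed by cubing puts the trace into the prime field.\<close>

lemma ftr_cube: "ftr s (x::'a) ^ 3 = ftr s x"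
proof -
  have "x + ftr s x ^ 3 = (\<Sum>i<Suc s. x ^ 3 ^ i)"
    by (subst sum.lessThan_Suc_shift) (simp add: ftr_def cube_sum mult.commute flip: power_mult)
  also have "\<dots> = ftr s x + x" by (simp add: ftr_def pow_card)
  finally show ?thesis by simp
qed

lemma ftr_cases: "ftr s (x::'a) \<in> {0, 1, 2}"
proof -
  have "ftr s x * (ftr s x - 1) * (ftr s x + 1) = ftr s x ^ 3 - ftr s x"
    by (simp add: algebra_simps power3_eq_cube)
  also have "\<dots> = 0" by (simp add: ftr_cube)
  finally show ?thesis by (auto simp: two_eq eq_neg_iff_add_eq_0)
qed

lemma of_nat_inj3: "j < 3 \<Longrightarrow> k < 3 \<Longrightarrow> (of_nat j :: 'a) = of_nat k \<Longrightarrow> j = k"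
proof -
  have l: "j < 3 \<Longrightarrow> j = 0 \<or> j = 1 \<or> j = 2" for j :: nat by linarith
  assume "j < 3" "k < 3" "(of_nat j :: 'a) = of_nat k"
  thus "j = k"
    using l[of j] l[of k] neg_eq_iff[of 1] by (auto simp: two_eq)
qed

text \<open>Justifies the definite description in \<open>ftr_nat\<close>: existence is
  \<open>ftr_cases\<close>, uniqueness is injectivity of \<open>of_nat\<close> below 3.\<close>

lemma ftr_nat: "ftr_nat s (x::'a) < 3" "of_nat (ftr_nat s x) = ftr s x"
proof -
  obtain k where k: "k < (3::nat)" "of_nat k = ftr s x"
  proof -
    have "ftr s x = of_nat 0 \<or> ftr s x = of_nat 1 \<or> ftr s x = of_nat 2"
      using ftr_cases[of x] by simp
    thus ?thesis using that[of 0] that[of 1] that[of 2] by auto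
  qed
  have "ftr_nat s x < 3 \<and> of_nat (ftr_nat s x) = ftr s x"
    unfolding ftr_nat_def by (rule theI[of _ k]) (use k of_nat_inj3 in auto)
  thus "ftr_nat s (x::'a) < 3" "of_nat (ftr_nat s x) = ftr s x" by auto
qed

lemma ftr_nat_eqI: "k < 3 \<Longrightarrow> of_nat k = ftr s (x::'a) \<Longrightarrow> ftr_nat s x = k"
  by (rule of_nat_inj3) (simp_all add: ftr_nat)

definition \<omega> :: complex where "\<omega> = cis (2 * pi / 3)"

lemma omega_cube: "\<omega> ^ 3 = 1"
  by (simp add: \<omega>_def Complex.DeMoivre)

lemma omega_eq: "\<omega> = Complex (- 1 / 2) (sqrt 3 / 2)"
  unfolding \<omega>_def by (simp add: complex_eq_iff cos_120 sin_120)

lemma omega_sum: "1 + \<omega> + \<omega>\<^sup>2 = 0"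
  by (simp add: omega_eq complex_eq_iff power2_eq_square)

lemma omega_pow_mod: "\<omega> ^ (k mod 3) = \<omega> ^ k"
proof -
  have "\<omega> ^ k = \<omega> ^ (3 * (k div 3) + k mod 3)" by simp
  also have "\<dots> = \<omega> ^ (k mod 3)" by (simp only: power_add power_mult omega_cube) simp
  finally show ?thesis by simp
qed

lemma lam_eq: "\<chi> x = \<omega> ^ ftr_nat s x"
  by (simp add: lam_def \<omega>_def Complex.DeMoivre mult.commute)

lemma of_nat_mod3: "(of_nat (k mod 3) :: 'a) = of_nat k"
proof -
  have "(of_nat k :: 'a) = of_nat (3 * (k div 3) + k mod 3)" by simp
  also have "\<dots> = of_nat (k mod 3)" by (simp only: of_nat_add of_nat_mult) (simp add: three_eq_0)
  finally show ?thesis by simp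
qed

text \<open>The exponents add only modulo 3, which a cube root of unity does not see.\<close>

lemma lam_add: "\<chi> (x + y) = \<chi> x * \<chi> y"
proof -
  have "ftr_nat s (x + y) = (ftr_nat s x + ftr_nat s y) mod 3"
    by (rule ftr_nat_eqI) (simp_all only: of_nat_mod3, simp_all add: ftr_add ftr_nat)
  thus ?thesis by (simp add: lam_eq omega_pow_mod power_add)
qed

lemma lam_0 [simp]: "\<chi> 0 = 1"
  using ftr_nat_eqI[of 0 0] by (simp add: lam_eq)

lemma lam_uminus: "\<chi> (- x) * \<chi> x = 1"
  using lam_add[of "- x" x] by simp

lemma lam_nz [simp]: "\<chi> x \<noteq> 0"
  using lam_uminus[of x] by auto

lemma lam_sum: "\<chi> (\<Sum>i\<in>I. f i) = (\<Prod>i\<in>I. \<chi> (f i))"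
  by (induction I rule: infinite_finite_induct) (simp_all add: lam_add)

text \<open>The trace is a polynomial function of degree at most \<open>3 ^ (s - 1) < q\<close>, so
  it cannot vanish on the whole field.\<close>

lemma ftr_nontrivial: "\<exists>x::'a. ftr s x \<noteq> 0"
proof (rule ccontr)
  assume "\<nexists>x::'a. ftr s x \<noteq> 0"
  hence all: "ftr s x = 0" for x :: 'a by blast
  define p :: "'a poly" where "p = (\<Sum>i<s. monom 1 (3 ^ i))"
  \<comment> \<open>Only \<open>i = 0\<close> produces the exponent 1, so the linear coefficient
    shows that \<open>p\<close> is not the zero polynomial.\<close>
  have "coeff p 1 = (\<Sum>i<s. if i = 0 then 1 else 0)"
    unfolding p_def coeff_sum by (rule sum.cong) (auto simp: power_eq_1_iff)
  also have "\<dots> = 1" using s_pos by simp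
  finally have "p \<noteq> 0" by auto
  have "poly p x = 0" for x using all[of x] by (simp add: p_def poly_sum ftr_def poly_monom)
  hence "{x. poly p x = 0} = UNIV" by auto
  with card_poly_roots_bound[OF \<open>p \<noteq> 0\<close>] have "q \<le> degree p" by (simp add: card_UNIV)
  moreover have "degree p \<le> 3 ^ (s - 1)" unfolding p_def
    by (rule degree_sum_le) (auto intro!: order.trans[OF degree_monom_le] power_increasing)
  ultimately have "(3::nat) ^ s \<le> 3 ^ (s - 1)" by linarith
  thus False using s_pos power_le_imp_le_exp[of "3::nat" s "s - 1"] by simp
qed

text \<open>The summands are \<open>1, z, z\<^sup>2\<close> for a cube root of unity
  \<open>z\<close>, which equals 1 exactly when the trace vanishes. This detects nonzero coordinates
  of codewords and also shows that the character is nontrivial.\<close>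

lemma lam_sum_of_nat: "(\<Sum>b\<in>{0,1,2::nat}. \<chi> (of_nat b * x)) = (if ftr s x = 0 then 3 else 0)"
proof -
  have m: "\<chi> (of_nat b * x) = \<chi> x ^ b" for b
    by (induction b) (simp_all add: lam_add distrib_right)
  have o: "1 + (\<omega> + \<omega>\<^sup>2) = 0" using omega_sum by (simp add: add_ac)
  have e: "(\<Sum>b\<in>{0,1,2::nat}. \<chi> (of_nat b * x)) = 1 + (\<chi> x + (\<chi> x)\<^sup>2)"
    unfolding m by simp
  have "ftr_nat s x = 0 \<or> ftr_nat s x = 1 \<or> ftr_nat s x = 2" using ftr_nat(1)[of x] by linarith
  moreover have "(\<omega>\<^sup>2)\<^sup>2 = \<omega>" using omega_pow_mod[of 4] by (simp flip: power_mult)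
  ultimately show ?thesis unfolding e unfolding lam_eq ftr_nat(2)[of x, symmetric]
    using o two_nz by (elim disjE) (simp_all add: add.commute[of "\<omega>\<^sup>2"])
qed

lemma lam_nontrivial: "\<exists>x::'a. \<chi> x \<noteq> 1"
proof (rule ccontr)
  assume "\<nexists>x::'a. \<chi> x \<noteq> 1"
  hence all: "\<chi> x = 1" for x by blast
  obtain x :: 'a where "ftr s x \<noteq> 0" using ftr_nontrivial by blast
  with lam_sum_of_nat[of x] show False by (simp add: all)
qed

lemma sum_lam: "(\<Sum>x\<in>UNIV. \<chi> (a * x)) = (if a = 0 then of_nat q else 0)"
proof (cases "a = 0")
  case False
  obtain y :: 'a where y: "\<chi> y \<noteq> 1" using lam_nontrivial by blast
  \<comment> \<open>Shifting \<open>x\<close> by \<open>y / a\<close> multiplies the sum by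
    \<open>\<chi> y\<close>, which is not 1.\<close>
  have "(\<Sum>x\<in>UNIV. \<chi> (a * x)) = (\<Sum>x\<in>UNIV. \<chi> (a * (x + y / a)))"
    by (rule sum.reindex_bij_witness[of _ "\<lambda>x. x + y / a" "\<lambda>x. x - y / a"]) auto
  also have "\<dots> = \<chi> y * (\<Sum>x\<in>UNIV. \<chi> (a * x))"
    using False by (simp add: ring_distribs lam_add sum_distrib_left mult.commute)
  finally show ?thesis using y False by auto
qed (simp add: card_UNIV)

end


subsection \<open>Moments of weights\<close>

text \<open>The number of surjections from an \<open>h\<close>-set onto a \<open>t\<close>-set in
  inclusion-exclusion form, that is \<open>t!\<close> times the Stirling number; without the
  division its recurrence is direct.\<close>

definition surj_count :: "nat \<Rightarrow> nat \<Rightarrow> complex" where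
  "surj_count h t = (\<Sum>j=0..t. (-1) ^ (t - j) * of_nat (t choose j) * of_nat j ^ h)"

lemma fact_stirS: "of_nat (fact t) * stirS h t = surj_count h t"
  by (simp add: stirS_def surj_count_def)

lemma surj_count_0: "surj_count 0 t = (if t = 0 then 1 else 0)"
proof -
  have "surj_count 0 t = (\<Sum>j\<le>t. of_nat (t choose j) * 1 ^ j * (-1) ^ (t - j))"
    by (simp add: surj_count_def atMost_atLeast0 mult.commute)
  also have "\<dots> = (1 + - 1) ^ t" by (subst binomial_ring) simp
  finally show ?thesis by (simp add: power_0_left)
qed

lemma surj_count_Suc_0: "surj_count (Suc h) 0 = 0"
  by (simp add: surj_count_def)

text \<open>Absorption trades one factor \<open>j\<close> against \<open>Suc t\<close> times a
  difference of two neighbouring binomials, which splits the sum into the two terms of the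
  recurrence.\<close>

lemma surj_count_Suc_Suc:
  "surj_count (Suc h) (Suc t) = of_nat (Suc t) * (surj_count h (Suc t) + surj_count h t)"
proof -
  have b: "of_nat (Suc t choose j) * of_nat j
      = (of_nat (Suc t) * (of_nat (Suc t choose j) - of_nat (t choose j)) :: complex)" for j
  proof (cases j)
    case (Suc i)
    have "Suc i * (Suc t choose Suc i) = Suc t * (t choose i)" by (rule Suc_times_binomial)
    hence "(of_nat (Suc i) * of_nat (Suc t choose Suc i) :: complex) = of_nat (Suc t) * of_nat (t choose i)"
      by (metis of_nat_mult)
    thus ?thesis by (simp add: Suc mult.commute del: of_nat_Suc)
  qed simp
  have "surj_count (Suc h) (Suc t)
    = (\<Sum>j=0..Suc t. (-1) ^ (Suc t - j) * (of_nat (Suc t choose j) * of_nat j) * of_nat j ^ h)"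
    by (simp add: surj_count_def mult_ac)
  also have "\<dots> = of_nat (Suc t) * (surj_count h (Suc t)
      - (\<Sum>j=0..Suc t. (-1) ^ (Suc t - j) * of_nat (t choose j) * of_nat j ^ h))"
    unfolding b surj_count_def
    by (simp only: sum_distrib_left sum_subtractf[symmetric] algebra_simps)
  \<comment> \<open>The term \<open>j = Suc t\<close> vanishes, and every other sign differs from
    the one in \<open>surj_count h t\<close> by a factor -1.\<close>
  also have "(\<Sum>j=0..Suc t. (-1) ^ (Suc t - j) * of_nat (t choose j) * of_nat j ^ h) = - surj_count h t"
    by (simp add: surj_count_def Suc_diff_le sum_negf)
  finally show ?thesis by simp
qed

lemma surj_count_eq_0: "h < t \<Longrightarrow> surj_count h t = 0"
proof (induction h arbitrary: t)
  case (Suc h)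
  then obtain t' where "t = Suc t'" by (cases t) auto
  with Suc show ?case by (simp add: surj_count_Suc_Suc)
qed (simp add: surj_count_0)

text \<open>Maps from an \<open>h\<close>-set to an \<open>x\<close>-set, sorted by their image. The
  induction multiplies by \<open>x\<close>, uses \<open>c\<close> to return to binomials and
  collects them with the recurrence.\<close>

lemma power_eq_sum_choose: "of_nat x ^ h = (\<Sum>t\<le>h. surj_count h t * of_nat (x choose t))"
proof (induction h)
  case (Suc h)
  have c: "(of_nat x * of_nat (x choose t) :: complex)
      = of_nat t * of_nat (x choose t) + of_nat (Suc t) * of_nat (x choose Suc t)" for t
  proof -
    have "x * (x choose t) = t * (x choose t) + Suc t * (x choose Suc t)"
    proof (cases x)
      case (Suc y)
      note S = Suc
      show ?thesis
      proof (cases t)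
        case (Suc k)
        have "t * (x choose t) + Suc t * (x choose Suc t) = Suc y * (y choose k) + Suc y * (y choose t)"
          unfolding S Suc Suc_times_binomial ..
        also have "\<dots> = Suc y * (Suc y choose Suc k)" by (simp add: Suc distrib_left)
        finally show ?thesis by (simp add: S Suc)
      qed (simp add: S)
    qed (cases t; simp)
    thus ?thesis by (metis of_nat_mult of_nat_add)
  qed
  have "of_nat x ^ Suc h = (\<Sum>t\<le>h. surj_count h t * (of_nat x * of_nat (x choose t)))"
    by (simp add: Suc.IH sum_distrib_left mult_ac)
  also have "\<dots> = (\<Sum>t\<le>h. of_nat t * surj_count h t * of_nat (x choose t))
      + (\<Sum>t\<le>h. of_nat (Suc t) * surj_count h t * of_nat (x choose Suc t))"
    unfolding c by (simp only: sum.distrib[symmetric] algebra_simps)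
  also have "(\<Sum>t\<le>h. of_nat t * surj_count h t * of_nat (x choose t))
    = (\<Sum>t\<le>Suc h. of_nat t * surj_count h t * of_nat (x choose t))"
    by (simp add: surj_count_eq_0)
  also have "\<dots> = (\<Sum>t\<le>h. of_nat (Suc t) * surj_count h (Suc t) * of_nat (x choose Suc t))"
    by (subst sum.atMost_Suc_shift) simp
  finally have "of_nat x ^ Suc h
      = (\<Sum>t\<le>h. surj_count (Suc h) (Suc t) * of_nat (x choose Suc t))"
    by (simp only: sum.distrib[symmetric] surj_count_Suc_Suc algebra_simps)
  also have "\<dots> = (\<Sum>t\<le>Suc h. surj_count (Suc h) t * of_nat (x choose t))"
    by (subst sum.atMost_Suc_shift) (simp add: surj_count_Suc_0)
  finally show ?case .
qed (simp add: surj_count_0)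

text \<open>Removing \<open>S\<close> leaves an arbitrary subset of \<open>D - S\<close> of size
  \<open>t - card S\<close>. The complementary lower index is chosen to match the binomial of the
  final identity.\<close>

lemma card_supersets:
  assumes "finite D" "S \<subseteq> D" "card S \<le> t" "t \<le> card D"
  shows "card {T. S \<subseteq> T \<and> T \<subseteq> D \<and> card T = t} = (card D - card S) choose (card D - t)"
proof -
  have fS: "finite S" using assms finite_subset by blast
  have "bij_betw (\<lambda>T. T - S) {T. S \<subseteq> T \<and> T \<subseteq> D \<and> card T = t} {U. U \<subseteq> D - S \<and> card U = t - card S}"
  proof (rule bij_betw_byWitness[where f' = "\<lambda>U. U \<union> S"])
    show "(\<lambda>T. T - S) ` {T. S \<subseteq> T \<and> T \<subseteq> D \<and> card T = t} \<subseteq> {U. U \<subseteq> D - S \<and> card U = t - card S}"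
      using fS by (auto simp: card_Diff_subset)
    have "card (U \<union> S) = t" if "U \<subseteq> D - S" "card U = t - card S" for U
    proof -
      have "finite U" using that assms finite_subset by blast
      thus ?thesis using that fS assms by (subst card_Un_disjoint) auto
    qed
    thus "(\<lambda>U. U \<union> S) ` {U. U \<subseteq> D - S \<and> card U = t - card S} \<subseteq> {T. S \<subseteq> T \<and> T \<subseteq> D \<and> card T = t}"
      using assms by auto
  qed auto
  hence "card {T. S \<subseteq> T \<and> T \<subseteq> D \<and> card T = t} = card {U. U \<subseteq> D - S \<and> card U = t - card S}"
    by (rule bij_betw_same_card)
  also have "\<dots> = (card D - card S) choose (t - card S)"
    using assms fS by (simp add: n_subsets card_Diff_subset)
  also have "\<dots> = (card D - card S) choose (card D - card S - (t - card S))"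
    by (rule binomial_symmetric) (use assms in auto)
  also have "card D - card S - (t - card S) = card D - t" using assms by auto
  finally show ?thesis .
qed

section \<open>Codes, supports and weights\<close>

lemma finite_code: "finite D \<Longrightarrow> finite (code D)"
  unfolding code_def by (rule finite_subset[of _ "D \<rightarrow>\<^sub>E {0, 1, 2}"]) (auto intro: finite_PiE)

lemma wt_le: "finite D \<Longrightarrow> wt D u \<le> card D"
  unfolding wt_def by (rule card_mono) auto

text \<open>Extension by zero and restriction identify the code of \<open>T\<close> with the words
  of the code of \<open>D\<close> supported in \<open>T\<close>, preserving weights; the outer
  \<open>restrict\<close> keeps the extended words extensional.\<close>

lemma sum_code_subset:
  assumes "finite D" "T \<subseteq> D"
  shows "(\<Sum>u\<in>code T. f (wt T u)) = (\<Sum>u | u \<in> code D \<and> {g\<in>D. u g \<noteq> 0} \<subseteq> T. f (wt D u))"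
proof (rule sum.reindex_bij_witness[of _ "\<lambda>u. restrict u T" "\<lambda>u. restrict (\<lambda>g. if g \<in> T then u g else 0) D"])
  have fT: "finite T" using assms finite_subset by blast
  {
    fix u assume u: "u \<in> code T"
    show "restrict (restrict (\<lambda>g. if g \<in> T then u g else 0) D) T = u"
      using u assms by (auto simp: code_def PiE_def extensional_def restrict_def fun_eq_iff)
    let ?v = "restrict (\<lambda>g. if g \<in> T then u g else 0) D"
    have "(\<Sum>g\<in>D. of_nat (?v g) * mat_tr g) = (\<Sum>g\<in>T. of_nat (u g) * mat_tr g)"
      by (rule sum.mono_neutral_cong_right) (use assms in auto)
    thus "?v \<in> {u. u \<in> code D \<and> {g\<in>D. u g \<noteq> 0} \<subseteq> T}"
      using u assms by (auto simp: code_def PiE_iff split: if_splits)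
    have "{g\<in>D. ?v g \<noteq> 0} = {g\<in>T. u g \<noteq> 0}" using assms by auto
    thus "f (wt D ?v) = f (wt T u)" by (simp add: wt_def)
  }
  {
    fix u assume "u \<in> {u. u \<in> code D \<and> {g\<in>D. u g \<noteq> 0} \<subseteq> T}"
    hence u: "u \<in> code D" "{g\<in>D. u g \<noteq> 0} \<subseteq> T" by auto
    hence u0: "u g = 0" if "g \<in> D" "g \<notin> T" for g using that by blast
    show "restrict (\<lambda>g. if g \<in> T then restrict u T g else 0) D = u"
      using u assms by (auto simp: code_def PiE_def extensional_def restrict_def fun_eq_iff)
    have "(\<Sum>g\<in>T. of_nat (restrict u T g) * mat_tr g) = (\<Sum>g\<in>D. of_nat (u g) * mat_tr g)"
      by (rule sum.mono_neutral_cong_left) (use assms u0 in auto)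
    thus "restrict u T \<in> code T"
      using u assms by (auto simp: code_def PiE_iff subset_iff)
  }
qed

lemma sum_code_by_weight:
  assumes "finite D"
  shows "(\<Sum>u\<in>code D. f (wt D u)) = (\<Sum>j\<le>card D. of_nat (wdist D j) * (f j :: 'b::comm_semiring_1))"
proof -
  have "(\<Sum>u\<in>code D. f (wt D u)) = (\<Sum>j\<le>card D. \<Sum>u | u \<in> code D \<and> wt D u = j. f (wt D u))"
    by (rule sum.group[symmetric]) (use assms wt_le finite_code in auto)
  also have "\<dots> = (\<Sum>j\<le>card D. of_nat (wdist D j) * f j)"
    by (rule sum.cong) (auto simp: wdist_def)
  finally show ?thesis .
qed

context ternary
begin

text \<open>Fourier coefficients of the indicator of the nonzero elements of the prime field: 1
  minus the average of the three characters.\<close>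

definition weight3 :: "nat \<Rightarrow> complex" where
  "weight3 b = (if b = 0 then 2 / 3 else - 1 / 3)"

lemma indicator_ftr:
  "(\<Sum>b\<in>{0,1,2}. weight3 b * \<chi> (of_nat b * x)) = (if ftr s x \<noteq> 0 then 1 else 0)"
proof -
  have "(\<Sum>b\<in>{0,1,2::nat}. weight3 b * \<chi> (of_nat b * x))
      = 1 - (\<Sum>b\<in>{0,1,2::nat}. \<chi> (of_nat b * x)) / 3"
    by (simp add: weight3_def field_simps)
  thus ?thesis unfolding lam_sum_of_nat by simp
qed

lemma prod_weight3:
  assumes "finite T" "u \<in> T \<rightarrow>\<^sub>E {0, 1, 2}"
  shows "(\<Prod>g\<in>T. weight3 (u g)) = (-1) ^ wt T u * 2 ^ (card T - wt T u) / 3 ^ card T"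
proof -
  have T: "T = {g\<in>T. u g \<noteq> 0} \<union> {g\<in>T. u g = 0}" by auto
  have c: "card {g\<in>T. u g = 0} = card T - wt T u"
  proof -
    have "card T = wt T u + card {g\<in>T. u g = 0}" unfolding wt_def
      by (subst T, rule card_Un_disjoint) (use assms in auto)
    thus ?thesis by simp
  qed
  have le: "wt T u \<le> card T" by (rule wt_le[OF assms(1)])
  have "(\<Prod>g\<in>T. weight3 (u g)) = (\<Prod>g\<in>{g\<in>T. u g \<noteq> 0}. weight3 (u g)) * (\<Prod>g\<in>{g\<in>T. u g = 0}. weight3 (u g))"
    by (subst T, rule prod.union_disjoint) (use assms in auto)
  also have "\<dots> = (- 1 / 3) ^ wt T u * (2 / 3) ^ (card T - wt T u)"
    by (simp add: weight3_def c wt_def)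
  also have "\<dots> = (-1) ^ wt T u * 2 ^ (card T - wt T u) / (3 ^ wt T u * 3 ^ (card T - wt T u))"
    by (simp add: power_divide power_minus[of "1/3"])
  also have "(3 ^ wt T u * 3 ^ (card T - wt T u) :: complex) = 3 ^ card T"
    using le by (simp flip: power_add)
  finally show ?thesis .
qed

text \<open>A MacWilliams-type duality: expanding every indicator into characters indexes the terms
  by vectors \<open>u\<close>, and the sum over \<open>a\<close> is \<open>q\<close> or 0 according
  to whether \<open>u\<close> is a codeword.\<close>

lemma sum_prod_nonzero:
  fixes T :: "'a mat set"
  assumes "finite T"
  shows "(\<Sum>a\<in>UNIV. \<Prod>g\<in>T. if ftr s (a * mat_tr g) \<noteq> 0 then 1 else 0)
    = of_nat q * (\<Sum>u\<in>code T. (-1) ^ wt T u * 2 ^ (card T - wt T u) / 3 ^ card T :: complex)"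
proof -
  let ?P = "T \<rightarrow>\<^sub>E {0, 1, 2::nat}"
  have fP: "finite ?P" using assms by (auto intro: finite_PiE)
  have "(\<Sum>a\<in>UNIV. \<Prod>g\<in>T. if ftr s (a * mat_tr g) \<noteq> 0 then 1 else (0::complex))
     = (\<Sum>a\<in>UNIV. \<Prod>g\<in>T. \<Sum>b\<in>{0,1,2}. weight3 b * \<chi> (of_nat b * (a * mat_tr g)))"
    by (simp only: indicator_ftr)
  also have "\<dots> = (\<Sum>a\<in>UNIV. \<Sum>u\<in>?P. \<Prod>g\<in>T. weight3 (u g) * \<chi> (of_nat (u g) * (a * mat_tr g)))"
    using assms by (subst prod_sum_PiE) simp_all
  also have "\<dots> = (\<Sum>u\<in>?P. (\<Prod>g\<in>T. weight3 (u g)) * (\<Sum>a\<in>UNIV. \<chi> ((\<Sum>g\<in>T. of_nat (u g) * mat_tr g) * a)))"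
    by (subst sum.swap) (simp add: prod.distrib lam_sum[symmetric] sum_distrib_left sum_distrib_right mult_ac)
  also have "\<dots> = (\<Sum>u\<in>?P. if (\<Sum>g\<in>T. of_nat (u g) * mat_tr g) = 0 then of_nat q * (\<Prod>g\<in>T. weight3 (u g)) else 0)"
    by (rule sum.cong) (auto simp: sum_lam)
  also have "\<dots> = (\<Sum>u\<in>code T. of_nat q * (\<Prod>g\<in>T. weight3 (u g)))"
    unfolding code_def by (subst sum.inter_filter[symmetric]) (use fP in auto)
  also have "\<dots> = of_nat q * (\<Sum>u\<in>code T. (-1) ^ wt T u * 2 ^ (card T - wt T u) / 3 ^ card T)"
    unfolding sum_distrib_left by (rule sum.cong) (auto simp: code_def prod_weight3 assms)
  finally show ?thesis .
qed

text \<open>A binomial of a weight counts the \<open>t\<close>-subsets \<open>T\<close> of the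
  support. Each \<open>T\<close> is handled by the duality above; exchanging sums leaves, for every
  codeword, the number of \<open>T\<close> containing its support.\<close>

lemma sum_choose_weight:
  fixes D :: "'a mat set"
  assumes "finite D"
  shows "(\<Sum>a\<in>UNIV. of_nat (card {g\<in>D. ftr s (a * mat_tr g) \<noteq> 0} choose t))
    = of_nat q * (\<Sum>j\<le>card D. of_nat (wdist D j) * (if j \<le> t \<and> t \<le> card D then
        (-1) ^ j * 2 ^ (t - j) / 3 ^ t * of_nat ((card D - j) choose (card D - t)) else (0::complex)))"
proof -
  define \<T> where "\<T> = {T. T \<subseteq> D \<and> card T = t}"
  have f\<T>: "finite \<T>" using assms by (auto simp: \<T>_def)
  have fT: "finite T" if "T \<in> \<T>" for T using that assms finite_subset by (auto simp: \<T>_def)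
  have ch: "(of_nat (card {g\<in>D. P g} choose t) :: complex) = (\<Sum>T\<in>\<T>. \<Prod>g\<in>T. if P g then 1 else 0)" for P
  proof -
    have "(\<Sum>T\<in>\<T>. \<Prod>g\<in>T. if P g then 1 else (0::complex)) = (\<Sum>T\<in>\<T>. if T \<subseteq> {g\<in>D. P g} then 1 else 0)"
    proof (rule sum.cong)
      fix T assume T: "T \<in> \<T>"
      show "(\<Prod>g\<in>T. if P g then 1 else (0::complex)) = (if T \<subseteq> {g\<in>D. P g} then 1 else 0)"
      proof (cases "T \<subseteq> {g\<in>D. P g}")
        case True
        have "(\<Prod>g\<in>T. if P g then 1 else (0::complex)) = (\<Prod>g\<in>T. 1)"
          using True by (intro prod.cong) auto
        with True show ?thesis by simp
      next
        case False
        then obtain g where "g \<in> T" "\<not> P g" using T by (auto simp: \<T>_def)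
        hence "(\<Prod>g\<in>T. if P g then 1 else (0::complex)) = 0" using fT[OF T] by auto
        with False show ?thesis by simp
      qed
    qed simp
    also have "\<dots> = of_nat (card {T\<in>\<T>. T \<subseteq> {g\<in>D. P g}})"
      using f\<T> by (simp flip: sum.inter_filter)
    also have "{T\<in>\<T>. T \<subseteq> {g\<in>D. P g}} = {T. T \<subseteq> {g\<in>D. P g} \<and> card T = t}"
      by (auto simp: \<T>_def)
    finally show ?thesis using assms by (simp add: n_subsets)
  qed
  have "(\<Sum>a\<in>UNIV. of_nat (card {g\<in>D. ftr s (a * mat_tr g) \<noteq> 0} choose t) :: complex)
    = (\<Sum>T\<in>\<T>. \<Sum>a\<in>UNIV. \<Prod>g\<in>T. if ftr s (a * mat_tr g) \<noteq> 0 then 1 else 0)"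
    unfolding ch by (rule sum.swap)
  also have "\<dots> = (\<Sum>T\<in>\<T>. of_nat q * (\<Sum>u\<in>code T. (-1) ^ wt T u * 2 ^ (t - wt T u) / 3 ^ t))"
  proof (rule sum.cong)
    fix T assume T: "T \<in> \<T>"
    thus "(\<Sum>a\<in>UNIV. \<Prod>g\<in>T. if ftr s (a * mat_tr g) \<noteq> 0 then 1 else 0) =
        of_nat q * (\<Sum>u\<in>code T. (-1) ^ wt T u * 2 ^ (t - wt T u) / 3 ^ t :: complex)"
      using sum_prod_nonzero[OF fT[OF T]] by (simp add: \<T>_def)
  qed simp
  also have "\<dots> = of_nat q * (\<Sum>T\<in>\<T>. \<Sum>u\<in>code D. if {g\<in>D. u g \<noteq> 0} \<subseteq> T
      then (-1) ^ wt D u * 2 ^ (t - wt D u) / 3 ^ t else 0)"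
    unfolding sum_distrib_left
  proof (rule sum.cong[OF refl], unfold sum_distrib_left[symmetric])
    fix T assume "T \<in> \<T>"
    hence "T \<subseteq> D" by (auto simp: \<T>_def)
    have "(\<Sum>u\<in>code T. (-1) ^ wt T u * 2 ^ (t - wt T u) / 3 ^ t)
      = (\<Sum>u\<in>code D. if {g\<in>D. u g \<noteq> 0} \<subseteq> T then (-1) ^ wt D u * 2 ^ (t - wt D u) / 3 ^ t else (0::complex))"
      unfolding sum_code_subset[OF assms \<open>T \<subseteq> D\<close>, of "\<lambda>j. (-1) ^ j * 2 ^ (t - j) / 3 ^ t"]
      by (rule sum.inter_filter) (rule finite_code[OF assms])
    thus "of_nat q * (\<Sum>u\<in>code T. (-1) ^ wt T u * 2 ^ (t - wt T u) / 3 ^ t) = of_nat q *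
       (\<Sum>u\<in>code D. if {g\<in>D. u g \<noteq> 0} \<subseteq> T then (-1) ^ wt D u * 2 ^ (t - wt D u) / 3 ^ t else (0::complex))"
      by simp
  qed
  also have "(\<Sum>T\<in>\<T>. \<Sum>u\<in>code D. if {g\<in>D. u g \<noteq> 0} \<subseteq> T
      then (-1) ^ wt D u * 2 ^ (t - wt D u) / 3 ^ t else (0::complex))
    = (\<Sum>u\<in>code D. of_nat (card {T\<in>\<T>. {g\<in>D. u g \<noteq> 0} \<subseteq> T}) * ((-1) ^ wt D u * 2 ^ (t - wt D u) / 3 ^ t))"
    by (subst sum.swap) (simp add: f\<T> flip: sum.inter_filter)
  \<comment> \<open>The condition \<open>t \<le> card D\<close> is needed: beyond it no
    \<open>T\<close> exists, but truncated subtraction would make the binomial equal to 1.\<close>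
  also have "\<dots> = (\<Sum>u\<in>code D. if wt D u \<le> t \<and> t \<le> card D then
        (-1) ^ wt D u * 2 ^ (t - wt D u) / 3 ^ t * of_nat ((card D - wt D u) choose (card D - t)) else 0)"
  proof (rule sum.cong)
    fix u assume "u \<in> code D"
    let ?S = "{g\<in>D. u g \<noteq> 0}"
    have eq: "{T\<in>\<T>. ?S \<subseteq> T} = {T. ?S \<subseteq> T \<and> T \<subseteq> D \<and> card T = t}" by (auto simp: \<T>_def)
    show "of_nat (card {T\<in>\<T>. ?S \<subseteq> T}) * ((-1) ^ wt D u * 2 ^ (t - wt D u) / 3 ^ t)
      = (if wt D u \<le> t \<and> t \<le> card D then
        (-1) ^ wt D u * 2 ^ (t - wt D u) / 3 ^ t * of_nat ((card D - wt D u) choose (card D - t)) else (0::complex))"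
    proof (cases "wt D u \<le> t \<and> t \<le> card D")
      case True
      thus ?thesis unfolding eq wt_def using card_supersets[OF assms, of ?S t] by auto
    next
      case False
      have "\<not> (?S \<subseteq> T \<and> T \<subseteq> D \<and> card T = t)" for T
      proof
        assume T: "?S \<subseteq> T \<and> T \<subseteq> D \<and> card T = t"
        hence "finite T" using assms finite_subset by blast
        with T have "wt D u \<le> t" unfolding wt_def using card_mono[of T ?S] by auto
        moreover have "t \<le> card D" using T card_mono[OF assms, of T] by auto
        ultimately show False using False by simp
      qed
      hence "{T. ?S \<subseteq> T \<and> T \<subseteq> D \<and> card T = t} = {}" by blast
      with False show ?thesis unfolding eq by (simp only: card.empty of_nat_0 mult_zero_left if_False)
    qed
  qed simp
  also have "\<dots> = (\<Sum>j\<le>card D. of_nat (wdist D j) * (if j \<le> t \<and> t \<le> card D then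
        (-1) ^ j * 2 ^ (t - j) / 3 ^ t * of_nat ((card D - j) choose (card D - t)) else 0))"
    by (rule sum_code_by_weight[OF assms, of "\<lambda>j. if j \<le> t \<and> t \<le> card D then
        (-1) ^ j * 2 ^ (t - j) / 3 ^ t * of_nat ((card D - j) choose (card D - t)) else 0"])
  finally show ?thesis .
qed

text \<open>Summing over all \<open>a\<close> rather than over the dual code makes it irrelevant whether distinct \<open>a\<close>
  give distinct codewords \<open>(tr (a Tr g))\<^sub>g\<close>.\<close>

lemma moment_identity:
  fixes D :: "'a mat set"
  assumes "finite D"
  shows "(\<Sum>a\<in>UNIV. of_nat (card {g\<in>D. ftr s (a * mat_tr g) \<noteq> 0}) ^ h)
    = of_nat q * (\<Sum>j=0..min (card D) h. (-1) ^ j * of_nat (wdist D j) *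
        (\<Sum>t=j..h. of_nat (fact t) * stirS h t * (2 ^ (t - j) / 3 ^ t) *
          (if t \<le> card D then of_nat ((card D - j) choose (card D - t)) else (0::complex))))"
proof -
  let ?F = "\<lambda>j t. 2 ^ (t - j) / 3 ^ t * (if t \<le> card D then of_nat ((card D - j) choose (card D - t)) else (0::complex))"
  have "(\<Sum>a\<in>UNIV. of_nat (card {g\<in>D. ftr s (a * mat_tr g) \<noteq> 0}) ^ h)
    = (\<Sum>t\<le>h. surj_count h t * (\<Sum>a\<in>UNIV. of_nat (card {g\<in>D. ftr s (a * mat_tr g) \<noteq> 0} choose t)))"
    unfolding power_eq_sum_choose by (subst sum.swap) (simp add: sum_distrib_left)
  also have "\<dots> = of_nat q * (\<Sum>t\<le>h. \<Sum>j\<le>card D. if j \<le> t then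
      (-1) ^ j * of_nat (wdist D j) * (surj_count h t * ?F j t) else 0)"
    unfolding sum_choose_weight[OF assms] sum_distrib_left
    by (intro sum.cong refl) auto
  also have "(\<Sum>t\<le>h. \<Sum>j\<le>card D. if j \<le> t then (-1) ^ j * of_nat (wdist D j) * (surj_count h t * ?F j t) else 0)
    = (\<Sum>j\<le>card D. \<Sum>t\<le>h. if j \<le> t then (-1) ^ j * of_nat (wdist D j) * (surj_count h t * ?F j t) else 0)"
    by (rule sum.swap)
  also have "\<dots> = (\<Sum>j\<le>card D. (-1) ^ j * of_nat (wdist D j) * (\<Sum>t=j..h. surj_count h t * ?F j t))"
  proof (intro sum.cong refl)
    fix j
    have "(\<Sum>t\<le>h. if j \<le> t then (-1) ^ j * of_nat (wdist D j) * (surj_count h t * ?F j t) else 0)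
      = (\<Sum>t\<in>{t\<in>{..h}. j \<le> t}. (-1) ^ j * of_nat (wdist D j) * (surj_count h t * ?F j t))"
      by (rule sum.inter_filter[symmetric]) simp
    also have "{t\<in>{..h}. j \<le> t} = {j..h}" by auto
    finally show "(\<Sum>t\<le>h. if j \<le> t then (-1) ^ j * of_nat (wdist D j) * (surj_count h t * ?F j t) else 0)
      = (-1) ^ j * of_nat (wdist D j) * (\<Sum>t=j..h. surj_count h t * ?F j t)"
      by (simp add: sum_distrib_left)
  qed
  \<comment> \<open>For \<open>j > h\<close> the inner range is empty.\<close>
  also have "\<dots> = (\<Sum>j=0..min (card D) h. (-1) ^ j * of_nat (wdist D j) * (\<Sum>t=j..h. surj_count h t * ?F j t))"
    by (rule sum.mono_neutral_right) auto
  finally show ?thesis by (simp only: fact_stirS mult.assoc)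
qed

end


subsection \<open>Counting invertible, symmetric and skew matrices\<close>

text \<open>Scalars as 1 by 1 blocks, so that bordering a matrix by one row and one column is an
  instance of \<open>four_block_mat\<close>.\<close>

definition sc :: "'a \<Rightarrow> 'a mat" where "sc x = mat 1 1 (\<lambda>_. x)"

lemma sc_carrier [simp]: "sc x \<in> carrier_mat 1 1" "sc x \<in> carrier_mat (Suc 0) (Suc 0)"
  and sc_index [simp]: "sc x $$ (0, 0) = x"
  and sc_dim [simp]: "dim_row (sc x) = 1" "dim_col (sc x) = 1"
  by (auto simp: sc_def)

lemma sc_inj [simp]: "sc x = sc y \<longleftrightarrow> x = y"
  by (metis sc_index)

lemma carrier_mat_1_1: "X \<in> carrier_mat 1 1 \<Longrightarrow> X = sc (X $$ (0, 0))"
  by (rule eq_matI) (auto simp: sc_def)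

lemma det_sc [simp]: "det (sc x) = x"
  by (simp add: det_single)

lemma sc_mult: "sc x * sc y = sc (x * (y::'a::comm_ring_1))"
  by (rule eq_matI) (auto simp: sc_def scalar_prod_def)

lemma transpose_sc [simp]: "(sc x)\<^sup>T = sc x"
  by (rule eq_matI) (auto simp: sc_def)

lemma col_mult_sc: "(u::'a::comm_ring_1 mat) \<in> carrier_mat r 1 \<Longrightarrow> u * sc x = x \<cdot>\<^sub>m u"
  by (rule eq_matI) (auto simp: sc_def scalar_prod_def)

lemma sc_mult_row: "(u::'a::comm_ring_1 mat) \<in> carrier_mat 1 r \<Longrightarrow> sc x * u = x \<cdot>\<^sub>m u"
  by (rule eq_matI) (auto simp: sc_def scalar_prod_def)

lemma four_block_mat_inj:
  assumes "A \<in> carrier_mat a c" "B \<in> carrier_mat a d" "C \<in> carrier_mat b c" "D \<in> carrier_mat b d"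
    "A' \<in> carrier_mat a c" "B' \<in> carrier_mat a d" "C' \<in> carrier_mat b c" "D' \<in> carrier_mat b d"
  shows "four_block_mat A B C D = four_block_mat A' B' C' D' \<longleftrightarrow> A = A' \<and> B = B' \<and> C = C' \<and> D = D'"
proof
  assume eq: "four_block_mat A B C D = four_block_mat A' B' C' D'"
  have *: "four_block_mat A B C D $$ (i, j) = four_block_mat A' B' C' D' $$ (i, j)" for i j
    by (simp add: eq)
  have "A = A'"
  proof (rule eq_matI)
    fix i j assume "i < dim_row A'" "j < dim_col A'"
    thus "A $$ (i, j) = A' $$ (i, j)" using *[of i j] assms by auto
  qed (use assms in auto)
  moreover have "B = B'"
  proof (rule eq_matI)
    fix i j assume "i < dim_row B'" "j < dim_col B'"
    thus "B $$ (i, j) = B' $$ (i, j)" using *[of i "c + j"] assms by auto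
  qed (use assms in auto)
  moreover have "C = C'"
  proof (rule eq_matI)
    fix i j assume "i < dim_row C'" "j < dim_col C'"
    thus "C $$ (i, j) = C' $$ (i, j)" using *[of "a + i" j] assms by auto
  qed (use assms in auto)
  moreover have "D = D'"
  proof (rule eq_matI)
    fix i j assume "i < dim_row D'" "j < dim_col D'"
    thus "D $$ (i, j) = D' $$ (i, j)" using *[of "a + i" "c + j"] assms by auto
  qed (use assms in auto)
  ultimately show "A = A' \<and> B = B' \<and> C = C' \<and> D = D'" by blast
qed auto

lemma four_block_mat_cases:
  assumes "M \<in> carrier_mat (a + b) (c + d)"
  obtains A B C D where "A \<in> carrier_mat a c" "B \<in> carrier_mat a d" "C \<in> carrier_mat b c"
    "D \<in> carrier_mat b d" "M = four_block_mat A B C D"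
proof -
  obtain A B C D where s: "split_block M a c = (A, B, C, D)" by (metis prod_cases4)
  have "dim_row M = a + b" "dim_col M = c + d" using assms by auto
  from split_block[OF s this] that show ?thesis by blast
qed

lemma border_cases:
  assumes "M \<in> carrier_mat (Suc r) (Suc r)"
  obtains A u v x where "A \<in> carrier_mat r r" "u \<in> carrier_mat r 1" "v \<in> carrier_mat 1 r"
    "M = four_block_mat A u v (sc x)"
proof -
  have "M \<in> carrier_mat (r + 1) (r + 1)" using assms by simp
  then obtain A u v D where "A \<in> carrier_mat r r" "u \<in> carrier_mat r 1" "v \<in> carrier_mat 1 r"
    "D \<in> carrier_mat 1 1" "M = four_block_mat A u v D" by (rule four_block_mat_cases)
  thus ?thesis using that[of A u v "D $$ (0, 0)"] carrier_mat_1_1[of D] by simp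
qed

lemma transpose_uminus: "(- A)\<^sup>T = - (A\<^sup>T :: 'a::ab_group_add mat)"
  by (rule eq_matI) auto

text \<open>Stated through the determinant, so that membership of bordered matrices follows from
  block determinant formulas.\<close>

definition GL :: "nat \<Rightarrow> 'a::field mat set" where
  "GL k = {A \<in> carrier_mat k k. det A \<noteq> 0}"

definition SymGL :: "nat \<Rightarrow> 'a::field mat set" where
  "SymGL k = {A \<in> GL k. A\<^sup>T = A}"

definition Skew :: "nat \<Rightarrow> 'a::field mat set" where
  "Skew k = {A \<in> carrier_mat k k. A\<^sup>T = - A}"

lemma GL_carrier: "A \<in> GL k \<Longrightarrow> A \<in> carrier_mat k k" by (simp add: GL_def)

lemma GL_mult: "A \<in> GL k \<Longrightarrow> B \<in> GL k \<Longrightarrow> A * B \<in> GL k"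
  by (auto simp: GL_def det_mult)

lemma GL_I: "A \<in> carrier_mat k k \<Longrightarrow> B \<in> carrier_mat k k \<Longrightarrow> A * B = 1\<^sub>m k \<Longrightarrow> A \<in> GL k"
  using det_mult[of A k B] by (auto simp: GL_def)

lemma GL_inverse:
  assumes "A \<in> GL k"
  obtains B where "B \<in> GL k" "A * B = 1\<^sub>m k" "B * A = 1\<^sub>m k"
proof -
  have "A \<in> Units (ring_mat TYPE('a) k b)" for b :: unit
    using assms by (intro det_non_zero_imp_unit) (auto simp: GL_def)
  then obtain B where B: "B \<in> carrier_mat k k" "A * B = 1\<^sub>m k" "B * A = 1\<^sub>m k"
    unfolding Units_def ring_mat_def by auto
  thus ?thesis using GL_I[OF B(1) GL_carrier[OF assms]] that by blast
qed

lemma invertible_mat_iff_GL: "A \<in> carrier_mat k k \<Longrightarrow> invertible_mat A \<longleftrightarrow> A \<in> GL k"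
proof
  assume A: "A \<in> carrier_mat k k" and "invertible_mat A"
  then obtain B where "A * B = 1\<^sub>m k" "B * A = 1\<^sub>m (dim_row B)"
    unfolding invertible_mat_def inverts_mat_def by auto
  moreover from this have "B \<in> carrier_mat k k"
    by (metis A carrier_matD(1,2) carrier_matI index_mult_mat(2,3) index_one_mat(2,3))
  ultimately show "A \<in> GL k" using A GL_I by blast
next
  assume "A \<in> carrier_mat k k" "A \<in> GL k"
  from GL_inverse[OF this(2)] obtain B where "B \<in> GL k" "A * B = 1\<^sub>m k" "B * A = 1\<^sub>m k" .
  thus "invertible_mat A" using \<open>A \<in> carrier_mat k k\<close>
    unfolding invertible_mat_def inverts_mat_def by (auto dest!: GL_carrier)
qed

lemma GL_left_cancel:
  assumes "P \<in> GL k" "A \<in> carrier_mat k l" "B \<in> carrier_mat k l" "P * A = P * B"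
  shows "A = B"
proof -
  from assms(1) obtain R where R: "R \<in> GL k" "R * P = 1\<^sub>m k" by (metis GL_inverse)
  have c: "R \<in> carrier_mat k k" "P \<in> carrier_mat k k" using R assms GL_carrier by auto
  have "A = R * (P * A)"
    using assms(2) R by (simp add: assoc_mult_mat[OF c assms(2), symmetric])
  also have "\<dots> = R * (P * B)" using assms by simp
  also have "\<dots> = B"
    using assms(3) R by (simp add: assoc_mult_mat[OF c assms(3), symmetric])
  finally show ?thesis .
qed

lemma det_zero_last_col:
  assumes "A \<in> carrier_mat (Suc r) (Suc r)" "\<And>i. i \<le> r \<Longrightarrow> A $$ (i, r) = 0"
  shows "det A = 0"
  by (subst laplace_expansion_column[OF assms(1), of r]) (use assms in \<open>auto intro: sum.neutral\<close>)

text \<open>A nonzero vector extends to a basis. This makes \<open>GL\<close> transitive on nonzero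
  vectors and reduces counts with a prescribed column or border to a unit vector.\<close>

lemma GL_with_last_col:
  fixes v :: "nat \<Rightarrow> 'a::field"
  assumes "k \<le> r" "v k \<noteq> 0"
  obtains P where "P \<in> GL (Suc r)" "\<And>i. i \<le> r \<Longrightarrow> P $$ (i, r) = v i"
proof -
  have *: "\<exists>P\<in>GL (Suc r). \<forall>i\<le>r. P $$ (i, r) = w i" if "w r \<noteq> 0" for w :: "nat \<Rightarrow> 'a"
  proof -
    \<comment> \<open>The identity with its last column replaced is upper triangular with
      determinant \<open>w r\<close>.\<close>
    define P where "P = mat (Suc r) (Suc r) (\<lambda>(i, j). if j = r then w i else if i = j then 1 else 0)"
    have P: "P \<in> carrier_mat (Suc r) (Suc r)" by (simp add: P_def)
    have "det P = prod_list (diag_mat P)"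
      by (rule det_upper_triangular[OF _ P]) (auto simp: P_def upper_triangular_def)
    also have "\<dots> \<noteq> 0" using that by (auto simp: prod_list_zero_iff diag_mat_def P_def)
    finally show ?thesis using P by (intro bexI[of _ P]) (auto simp: GL_def P_def)
  qed
  show ?thesis
  proof (cases "v r = 0")
    case False
    thus ?thesis using * that by blast
  next
    case True
    with assms have kr: "k < r" by (cases "k = r") auto
    \<comment> \<open>Exchanging the entries \<open>k\<close> and \<open>r\<close> reaches the case
      of a nonzero last entry; swapping the rows afterwards undoes it.\<close>
    define w where "w = (\<lambda>i. if i = k then v r else if i = r then v k else v i)"
    have "w r \<noteq> 0" using assms kr by (simp add: w_def)
    from *[of w, OF this] obtain P where P: "P \<in> GL (Suc r)" "\<forall>i\<le>r. P $$ (i, r) = w i" by auto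
    have "det (swaprows k r P) = - det P"
      using P kr by (intro det_swaprows[of _ "Suc r"]) (auto simp: GL_def)
    hence "swaprows k r P \<in> GL (Suc r)" using P by (auto simp: GL_def)
    moreover have "swaprows k r P $$ (i, r) = v i" if "i \<le> r" for i
      using that P kr GL_carrier[OF P(1)] by (auto simp: w_def)
    ultimately show ?thesis using that by blast
  qed
qed

lemma bij_betw_carrier_mat:
  "bij_betw (\<lambda>A. restrict (\<lambda>ij. A $$ ij) ({..<a} \<times> {..<b})) (carrier_mat a b) (({..<a} \<times> {..<b}) \<rightarrow>\<^sub>E UNIV)"
proof (rule bij_betw_byWitness[where f' = "\<lambda>f. mat a b f"])
  show "\<forall>A\<in>carrier_mat a b. mat a b (restrict (\<lambda>ij. A $$ ij) ({..<a} \<times> {..<b})) = A"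
    by (auto intro!: eq_matI)
  show "\<forall>f\<in>({..<a} \<times> {..<b}) \<rightarrow>\<^sub>E UNIV. restrict (\<lambda>ij. mat a b f $$ ij) ({..<a} \<times> {..<b}) = f"
    by (auto simp: fun_eq_iff restrict_def PiE_def extensional_def)
qed (auto intro!: restrict_PiE_iff[THEN iffD2])

lemma finite_carrier_mat [simp]: "finite (carrier_mat a b :: 'a::finite mat set)"
  using bij_betw_finite[OF bij_betw_carrier_mat[of a b]] by (auto intro: finite_PiE)

lemma card_carrier_mat: "card (carrier_mat a b :: 'a::finite mat set) = card (UNIV :: 'a set) ^ (a * b)"
  using bij_betw_same_card[OF bij_betw_carrier_mat[of a b]] by (simp add: card_PiE)

lemma finite_GL [simp]: "finite (GL k :: 'a::{finite,field} mat set)"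
  by (rule finite_subset[of _ "carrier_mat k k"]) (auto simp: GL_def)

lemma finite_SymGL [simp]: "finite (SymGL k :: 'a::{finite,field} mat set)"
  by (rule finite_subset[of _ "carrier_mat k k"]) (auto simp: SymGL_def GL_def)

lemma finite_Skew [simp]: "finite (Skew k :: 'a::{finite,field} mat set)"
  by (rule finite_subset[of _ "carrier_mat k k"]) (auto simp: Skew_def)

text \<open>A block triangular matrix is invertible exactly when its diagonal blocks are. These
  matrices, having the last unit vector as eigenvector, return in
  \<open>Q \<inter> \<sigma>Q\<sigma>\<close> and in the support of the character sum.\<close>

lemma bij_betw_GL_corner:
  "bij_betw (\<lambda>(A, v, x). four_block_mat A (0\<^sub>m r 1) v (sc x))
    (GL r \<times> carrier_mat 1 r \<times> (UNIV - {0})) {A \<in> GL (Suc r). \<forall>i<r. A $$ (i, r) = 0}"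
  (is "bij_betw ?f ?X ?Y")
proof (rule bij_betwI')
  fix p p' assume "p \<in> ?X" "p' \<in> ?X"
  thus "?f p = ?f p' \<longleftrightarrow> p = p'"
    by (auto simp: GL_def four_block_mat_inj[where a = r and c = r and b = 1 and d = 1])
next
  fix p assume "p \<in> ?X"
  then obtain A v x where p: "p = (A, v, x)" "A \<in> carrier_mat r r" "det A \<noteq> 0" "v \<in> carrier_mat 1 r" "x \<noteq> 0"
    by (auto simp: GL_def)
  have "det (?f p) = det A * x"
    using p by (simp add: det_four_block_mat_upper_right_zero[where n = r and m = 1])
  moreover have "?f p \<in> carrier_mat (Suc r) (Suc r)"
    using four_block_carrier_mat[OF p(2) sc_carrier(1), of "0\<^sub>m r 1" v x] p by simp
  ultimately show "?f p \<in> ?Y" using p by (auto simp: GL_def)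
next
  fix M assume M: "M \<in> ?Y"
  hence "M \<in> carrier_mat (Suc r) (Suc r)" by (auto simp: GL_def)
  then obtain A u v x where b: "A \<in> carrier_mat r r" "u \<in> carrier_mat r 1" "v \<in> carrier_mat 1 r"
    "M = four_block_mat A u v (sc x)" by (rule border_cases)
  have "u = 0\<^sub>m r 1"
  proof (rule eq_matI)
    fix i j assume "i < dim_row (0\<^sub>m r 1 :: 'a mat)" "j < dim_col (0\<^sub>m r 1 :: 'a mat)"
    hence "i < r" "j = 0" by auto
    thus "u $$ (i, j) = 0\<^sub>m r 1 $$ (i, j)" using M b by auto
  qed (use b in auto)
  moreover from this have "det M = det A * x"
    using b by (simp add: det_four_block_mat_upper_right_zero[where n = r and m = 1])
  ultimately show "\<exists>p\<in>?X. M = ?f p"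
    using M b by (intro bexI[of _ "(A, v, x)"]) (auto simp: GL_def)
qed

lemma card_GL_corner:
  "card {A \<in> GL (Suc r). \<forall>i<r. A $$ (i, r) = (0::'a::{finite,field})}
    = (card (UNIV :: 'a set) - 1) * card (UNIV :: 'a set) ^ r * card (GL r :: 'a mat set)"
  using bij_betw_same_card[OF bij_betw_GL_corner[of r, where ?'a = 'a]]
  by (simp add: card_cartesian_product card_carrier_mat mult_ac)

lemma card_GL_last_col:
  fixes v :: "nat \<Rightarrow> 'a::{finite,field}"
  assumes "k \<le> r" "v k \<noteq> 0"
  shows "card {A \<in> GL (Suc r). \<forall>i\<le>r. A $$ (i, r) = v i} = card (UNIV :: 'a set) ^ r * card (GL r :: 'a mat set)"
proof -
  \<comment> \<open>Left multiplication by an invertible \<open>P\<close> with last column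
    \<open>v\<close> turns a last column equal to the unit vector into \<open>v\<close>.\<close>
  have gen: "card {A \<in> GL (Suc r). \<forall>i\<le>r. A $$ (i, r) = v i}
      = card {A \<in> GL (Suc r). \<forall>i\<le>r. A $$ (i, r) = (if i = r then 1 else (0::'a))}"
    (is "card ?V = card ?E")
  proof -
    obtain P where P: "P \<in> GL (Suc r)" "\<And>i. i \<le> r \<Longrightarrow> P $$ (i, r) = v i"
      using GL_with_last_col[of k r v] assms by blast
    obtain R where R: "R \<in> GL (Suc r)" "P * R = 1\<^sub>m (Suc r)" "R * P = 1\<^sub>m (Suc r)"
      using GL_inverse[OF P(1)] by blast
    have c: "P \<in> carrier_mat (Suc r) (Suc r)" "R \<in> carrier_mat (Suc r) (Suc r)"
      using P R GL_carrier by auto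
    have m: "(X * A) $$ (i, r) = (\<Sum>j\<le>r. X $$ (i, j) * A $$ (j, r))"
      if "X \<in> carrier_mat (Suc r) (Suc r)" "A \<in> GL (Suc r)" "i \<le> r" for X A :: "'a mat" and i
      using that GL_carrier[OF that(2)]
      by (auto simp: scalar_prod_def atLeast0LessThan lessThan_Suc_atMost)
    have "bij_betw (\<lambda>A. P * A) ?E ?V"
    proof (rule bij_betw_byWitness[where f' = "\<lambda>A. R * A"])
      show "\<forall>A\<in>?E. R * (P * A) = A" "\<forall>A\<in>?V. P * (R * A) = A"
        using R c by (auto dest!: GL_carrier simp flip: assoc_mult_mat)
      show "(\<lambda>A. P * A) ` ?E \<subseteq> ?V"
      proof safe
        fix A :: "'a mat" and i
        assume A: "A \<in> GL (Suc r)" "\<forall>i\<le>r. A $$ (i, r) = (if i = r then 1 else 0)" and i: "i \<le> r"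
        have "(P * A) $$ (i, r) = (\<Sum>j\<le>r. if j = r then P $$ (i, j) else 0)"
          unfolding m[OF c(1) A(1) i] by (rule sum.cong) (use A in auto)
        thus "(P * A) $$ (i, r) = v i" using P i by simp
      qed (use P GL_mult in auto)
      show "(\<lambda>A. R * A) ` ?V \<subseteq> ?E"
      proof safe
        fix A :: "'a mat" and i
        assume A: "A \<in> GL (Suc r)" "\<forall>i\<le>r. A $$ (i, r) = v i" and i: "i \<le> r"
        have "(R * A) $$ (i, r) = (R * P) $$ (i, r)"
          unfolding m[OF c(2) A(1) i] m[OF c(2) P(1) i] using A P by simp
        thus "(R * A) $$ (i, r) = (if i = r then 1 else 0)" using R i by simp
      qed (use R GL_mult in auto)
    qed
    thus ?thesis by (rule bij_betw_same_card[symmetric])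
  qed
  \<comment> \<open>The unit column is the corner description with \<open>x = 1\<close>.\<close>
  have "bij_betw (\<lambda>(A, v, x). four_block_mat A (0\<^sub>m r 1) v (sc x)) (GL r \<times> carrier_mat 1 r \<times> {1::'a})
    {A \<in> GL (Suc r). \<forall>i\<le>r. A $$ (i, r) = (if i = r then 1 else 0)}" (is "bij_betw ?f ?X ?Y")
  proof (rule bij_betw_subset[OF bij_betw_GL_corner])
    show "?f ` ?X = ?Y"
    proof (intro equalityI subsetI)
      fix M assume "M \<in> ?f ` ?X"
      then obtain A v where M: "A \<in> GL r" "v \<in> carrier_mat 1 r" "M = ?f (A, v, 1)" by auto
      hence "M \<in> {A \<in> GL (Suc r). \<forall>i<r. A $$ (i, r) = 0}"
        using bij_betw_apply[OF bij_betw_GL_corner, of "(A, v, 1)" r] by auto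
      moreover have "M $$ (r, r) = 1" using M GL_carrier[OF M(1)] by simp
      ultimately show "M \<in> ?Y" by auto
    next
      fix M assume M: "M \<in> ?Y"
      hence "M \<in> {A \<in> GL (Suc r). \<forall>i<r. A $$ (i, r) = 0}" by auto
      then obtain A v x where b: "A \<in> GL r" "v \<in> carrier_mat 1 r" "M = ?f (A, v, x)"
        unfolding bij_betw_imp_surj_on[OF bij_betw_GL_corner, symmetric] by auto
      have "M $$ (r, r) = x" using b GL_carrier[OF b(1)] by simp
      with M have "x = 1" by auto
      with b show "M \<in> ?f ` ?X" by (intro image_eqI[of _ _ "(A, v, 1)"]) auto
    qed
  qed auto
  from bij_betw_same_card[OF this] show ?thesis unfolding gen
    by (simp add: card_cartesian_product card_carrier_mat mult_ac)
qed

text \<open>Sorting by the last column, all \<open>q ^ Suc r - 1\<close> nonzero columns have fibres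
  of the same size, where \<open>q\<close> is the order of the field.\<close>

lemma card_GL_Suc:
  "card (GL (Suc r) :: 'a::{finite,field} mat set)
    = (card (UNIV :: 'a set) ^ Suc r - 1) * card (UNIV :: 'a set) ^ r * card (GL r :: 'a mat set)"
proof -
  let ?F = "{..r} \<rightarrow>\<^sub>E (UNIV :: 'a set)" and ?c = "\<lambda>A. restrict (\<lambda>i. A $$ (i, r)) {..r}"
  let ?z = "\<lambda>i\<in>{..r}. 0::'a"
  have fF: "finite ?F" by (auto intro: finite_PiE)
  have "card (GL (Suc r) :: 'a mat set) = (\<Sum>v\<in>?F. card {A \<in> GL (Suc r). ?c A = v})"
  proof -
    have "(\<Sum>v\<in>?F. \<Sum>A | A \<in> GL (Suc r) \<and> ?c A = v. 1) = (\<Sum>A\<in>(GL (Suc r) :: 'a mat set). 1::nat)"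
      by (rule sum.group) (use fF in \<open>auto intro!: restrict_PiE_iff[THEN iffD2]\<close>)
    thus ?thesis by simp
  qed
  \<comment> \<open>A zero column forces determinant 0, so its fibre is empty.\<close>
  also have "\<dots> = (\<Sum>v\<in>?F - {?z}. card {A \<in> GL (Suc r). ?c A = v})"
  proof (rule sum.mono_neutral_right)
    have "{A \<in> GL (Suc r). ?c A = ?z} = {}"
    proof safe
      fix A :: "'a mat" assume A: "A \<in> GL (Suc r)" "?c A = ?z"
      have "A $$ (i, r) = 0" if "i \<le> r" for i using fun_cong[OF A(2), of i] that by simp
      with det_zero_last_col[of A r] A(1) show "A \<in> {}" by (simp add: GL_def)
    qed
    thus "\<forall>v\<in>?F - (?F - {?z}). card {A \<in> GL (Suc r). ?c A = v} = 0" by auto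
  qed (use fF in auto)
  also have "\<dots> = (\<Sum>v\<in>?F - {?z}. card (UNIV :: 'a set) ^ r * card (GL r :: 'a mat set))"
  proof (rule sum.cong)
    fix v assume v: "v \<in> ?F - {?z}"
    then obtain k where k: "k \<le> r" "v k \<noteq> 0"
      by (auto simp: PiE_def extensional_def fun_eq_iff restrict_def split: if_splits)
    have "{A \<in> GL (Suc r). ?c A = v} = {A \<in> GL (Suc r). \<forall>i\<le>r. A $$ (i, r) = v i}"
      using v by (auto simp: fun_eq_iff PiE_def extensional_def restrict_def)
    thus "card {A \<in> GL (Suc r). ?c A = v} = card (UNIV :: 'a set) ^ r * card (GL r :: 'a mat set)"
      using card_GL_last_col[of k r v] k by simp
  qed simp
  also have "\<dots> = (card ?F - 1) * card (UNIV :: 'a set) ^ r * card (GL r :: 'a mat set)"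
    using fF by (simp add: card_Diff_singleton)
  finally show ?thesis by (simp add: card_PiE)
qed

lemma card_GL_0: "card (GL 0 :: 'a::{finite,field} mat set) = 1"
proof -
  have "GL 0 = {0\<^sub>m 0 0 :: 'a mat}" by (auto simp: GL_def)
  thus ?thesis by simp
qed


context ternary
begin

text \<open>The corner entry equals its own negative, hence is 0 in characteristic 3; the last
  column is free and determines the last row.\<close>

lemma bij_betw_Skew_Suc:
  "bij_betw (\<lambda>(C, u). four_block_mat C u (- u\<^sup>T) (sc 0)) (Skew r \<times> carrier_mat r 1) (Skew (Suc r) :: 'a mat set)"
  (is "bij_betw ?f ?X ?Y")
proof (rule bij_betwI')
  fix p p' assume "p \<in> ?X" "p' \<in> ?X"
  thus "?f p = ?f p' \<longleftrightarrow> p = p'"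
    by (auto simp: Skew_def four_block_mat_inj[where a = r and c = r and b = 1 and d = 1])
next
  fix p assume "p \<in> ?X"
  then obtain C u where p: "p = (C, u)" "C \<in> carrier_mat r r" "C\<^sup>T = - C" "u \<in> carrier_mat r 1"
    by (auto simp: Skew_def)
  have "?f p \<in> carrier_mat (Suc r) (Suc r)"
    using four_block_carrier_mat[OF p(2) sc_carrier(1), of u "- u\<^sup>T" 0] p by simp
  moreover have "(?f p)\<^sup>T = - ?f p"
  proof -
    have "(?f p)\<^sup>T = four_block_mat (- C) (- u) (u\<^sup>T) (sc 0)"
      using p by (simp add: transpose_four_block_mat[where ?nr1.0 = r and ?nc1.0 = r and ?nr2.0 = 1 and ?nc2.0 = 1] transpose_uminus)
    also have "\<dots> = - ?f p" using p by (intro eq_matI) auto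
    finally show ?thesis .
  qed
  ultimately show "?f p \<in> ?Y" by (simp add: Skew_def)
next
  fix M :: "'a mat" assume M: "M \<in> ?Y"
  hence "M \<in> carrier_mat (Suc r) (Suc r)" by (auto simp: Skew_def)
  then obtain C u v x where b: "C \<in> carrier_mat r r" "u \<in> carrier_mat r 1" "v \<in> carrier_mat 1 r"
    "M = four_block_mat C u v (sc x)" by (rule border_cases)
  have "M\<^sup>T = four_block_mat (C\<^sup>T) (v\<^sup>T) (u\<^sup>T) (sc x)"
    using b by (simp add: transpose_four_block_mat[where ?nr1.0 = r and ?nc1.0 = r and ?nr2.0 = 1 and ?nc2.0 = 1])
  moreover have "- M = four_block_mat (- C) (- u) (- v) (sc (- x))"
    using b by (intro eq_matI) (auto simp: sc_def)
  ultimately have "C\<^sup>T = - C \<and> v\<^sup>T = - u \<and> u\<^sup>T = - v \<and> sc x = sc (- x)"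
    using M b unfolding Skew_def
    by (subst four_block_mat_inj[where a = r and c = r and b = 1 and d = 1, symmetric]) auto
  moreover from this have "x = 0" using neg_eq_iff[of x] by auto
  moreover from calculation have "v = - u\<^sup>T" using b by (auto intro!: eq_matI)
  ultimately show "\<exists>p\<in>?X. M = ?f p"
    using b by (intro bexI[of _ "(C, u)"]) (auto simp: Skew_def)
qed

lemma card_Skew_Suc: "card (Skew (Suc r) :: 'a mat set) = q ^ r * card (Skew r :: 'a mat set)"
  using bij_betw_same_card[OF bij_betw_Skew_Suc[of r]]
  by (simp add: card_cartesian_product card_carrier_mat card_UNIV mult.commute)

lemma card_Skew_0: "card (Skew 0 :: 'a mat set) = 1"
proof -
  have "Skew 0 = {0\<^sub>m 0 0 :: 'a mat}" by (auto simp: Skew_def)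
  thus ?thesis by simp
qed

end

section \<open>Invertible symmetric matrices\<close>

lemma card_SymGL_0: "card (SymGL 0 :: 'a::{finite,field} mat set) = 1"
proof -
  have "SymGL 0 = {0\<^sub>m 0 0 :: 'a mat}" by (auto simp: SymGL_def GL_def)
  thus ?thesis by simp
qed

text \<open>Completing the square in the last variable: the bordered matrix is congruent to
  \<open>diag(S, x)\<close> by a unipotent matrix, and \<open>S\<close> is its Schur
  complement.\<close>

lemma schur_decomposition:
  fixes u :: "'a::field mat"
  assumes "S \<in> carrier_mat r r" "u \<in> carrier_mat r 1" "x \<noteq> 0"
  shows "four_block_mat (S + (1 / x) \<cdot>\<^sub>m (u * u\<^sup>T)) u (u\<^sup>T) (sc x)
    = four_block_mat (1\<^sub>m r) ((1 / x) \<cdot>\<^sub>m u) (0\<^sub>m 1 r) (sc 1)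
      * (four_block_mat S (0\<^sub>m r 1) (0\<^sub>m 1 r) (sc x)
      * four_block_mat (1\<^sub>m r) (0\<^sub>m r 1) ((1 / x) \<cdot>\<^sub>m u\<^sup>T) (sc 1))"
proof -
  have c: "sc x * ((1 / x) \<cdot>\<^sub>m u\<^sup>T) = u\<^sup>T" "((1 / x) \<cdot>\<^sub>m u) * sc x = u" "sc x * sc 1 = sc x"
    using assms by (auto simp: sc_mult_row[where r = r] col_mult_sc[where r = r] sc_mult intro!: eq_matI)
  have d: "1 / x \<cdot>\<^sub>m u * u\<^sup>T = (1 / x) \<cdot>\<^sub>m (u * u\<^sup>T)" using assms by auto
  have e: "sc 1 * u\<^sup>T = u\<^sup>T" "sc 1 * sc x = sc x" "0\<^sub>m (Suc 0) (Suc 0) + sc x = sc x"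
    using assms by (auto simp: sc_mult_row[where r = r] sc_mult intro!: eq_matI)
  show ?thesis
    using assms c d e
    by (subst mult_four_block_mat[where ?nr1.0 = r and ?n1.0 = r and ?n2.0 = 1 and ?nr2.0 = 1 and ?nc1.0 = r and ?nc2.0 = 1])
       (auto simp: mult_four_block_mat[where ?nr1.0 = r and ?n1.0 = r and ?n2.0 = 1 and ?nr2.0 = 1 and ?nc1.0 = r and ?nc2.0 = 1])
qed

lemma det_schur:
  fixes u :: "'a::field mat"
  assumes "S \<in> carrier_mat r r" "u \<in> carrier_mat r 1" "x \<noteq> 0"
  shows "det (four_block_mat (S + (1 / x) \<cdot>\<^sub>m (u * u\<^sup>T)) u (u\<^sup>T) (sc x)) = det S * x"
proof -
  let ?L = "four_block_mat (1\<^sub>m r) ((1 / x) \<cdot>\<^sub>m u) (0\<^sub>m 1 r) (sc 1)"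
  let ?D = "four_block_mat S (0\<^sub>m r 1) (0\<^sub>m 1 r) (sc x)"
  let ?R = "four_block_mat (1\<^sub>m r) (0\<^sub>m r 1) ((1 / x) \<cdot>\<^sub>m u\<^sup>T) (sc 1)"
  have c: "?L \<in> carrier_mat (r + 1) (r + 1)" "?D \<in> carrier_mat (r + 1) (r + 1)" "?R \<in> carrier_mat (r + 1) (r + 1)"
    using assms by (intro four_block_carrier_mat; simp)+
  have "det ?L = 1" using assms
    by (subst det_four_block_mat_lower_left_zero[where n = r and m = 1]) auto
  moreover have "det ?D = det S * x" using assms
    by (subst det_four_block_mat_upper_right_zero[where n = r and m = 1]) auto
  moreover have "det ?R = 1" using assms
    by (subst det_four_block_mat_upper_right_zero[where n = r and m = 1]) auto
  ultimately show ?thesis unfolding schur_decomposition[OF assms]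
    using c by (simp add: det_mult[of _ "r + 1"] del: four_block_carrier_mat)
qed

lemma transpose_smult_mat: "(a \<cdot>\<^sub>m A)\<^sup>T = a \<cdot>\<^sub>m A\<^sup>T"
  by (rule eq_matI) auto

lemma transpose_mult_self: "u \<in> carrier_mat r 1 \<Longrightarrow> (u * u\<^sup>T)\<^sup>T = u * (u\<^sup>T :: 'a::comm_ring_1 mat)"
  by (subst transpose_mult[of _ r 1 _ r]) auto

lemma transpose_border:
  assumes "S \<in> carrier_mat r r" "u \<in> carrier_mat r 1" "v \<in> carrier_mat 1 r"
  shows "(four_block_mat S u v (sc x))\<^sup>T = four_block_mat (S\<^sup>T) (v\<^sup>T) (u\<^sup>T) (sc x)"
  using assms by (subst transpose_four_block_mat[where ?nr1.0 = r and ?nc1.0 = r and ?nr2.0 = 1 and ?nc2.0 = 1]) auto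

lemma sym_border_cases:
  assumes "M \<in> carrier_mat (Suc r) (Suc r)" "M\<^sup>T = M"
  obtains S u x where "S \<in> carrier_mat r r" "S\<^sup>T = S" "u \<in> carrier_mat r 1"
    "M = four_block_mat S u (u\<^sup>T) (sc x)"
proof -
  obtain S u v x where b: "S \<in> carrier_mat r r" "u \<in> carrier_mat r 1" "v \<in> carrier_mat 1 r"
    "M = four_block_mat S u v (sc x)" using border_cases[OF assms(1)] by blast
  have "S\<^sup>T = S \<and> v\<^sup>T = u \<and> u\<^sup>T = v \<and> sc x = sc x"
    using assms(2) b transpose_border[OF b(1-3), of x]
    by (subst four_block_mat_inj[where a = r and c = r and b = 1 and d = 1, symmetric]) auto
  with that[of S u x] b show ?thesis by auto
qed

text \<open>The inverse map sends a matrix with corner \<open>x\<close> to its Schur complement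
  together with border and corner; \<open>det_schur\<close> transfers invertibility both
  ways.\<close>

lemma bij_betw_SymGL_schur:
  "bij_betw (\<lambda>(S, u, x). four_block_mat (S + (1 / x) \<cdot>\<^sub>m (u * u\<^sup>T)) u (u\<^sup>T) (sc x))
    (SymGL r \<times> carrier_mat r 1 \<times> (UNIV - {0})) {M \<in> SymGL (Suc r). M $$ (r, r) \<noteq> (0::'a::field)}"
  (is "bij_betw ?f ?X ?Y")
proof (rule bij_betwI')
  fix p p' assume X: "p \<in> ?X" "p' \<in> ?X"
  obtain S u x where p1: "p = (S, u, x)" by (rule prod_cases3)
  obtain S' u' x' where p2: "p' = (S', u', x')" by (rule prod_cases3)
  have p: "S \<in> carrier_mat r r" "S' \<in> carrier_mat r r" "u \<in> carrier_mat r 1" "u' \<in> carrier_mat r 1"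
    using X unfolding p1 p2 SymGL_def GL_def by blast+
  have "S = S'" if "S + A = S' + A" "A \<in> carrier_mat r r" for A
  proof (rule eq_matI)
    fix i j assume ij: "i < dim_row S'" "j < dim_col S'"
    have "(S + A) $$ (i, j) = (S' + A) $$ (i, j)" using that by simp
    thus "S $$ (i, j) = S' $$ (i, j)" using ij p that(2) by (subst (asm) (1 2) index_add_mat) auto
  qed (use p in auto)
  moreover have "?f p = ?f p' \<longleftrightarrow> S + (1 / x) \<cdot>\<^sub>m (u * u\<^sup>T) = S' + (1 / x') \<cdot>\<^sub>m (u' * u'\<^sup>T)
      \<and> u = u' \<and> u\<^sup>T = u'\<^sup>T \<and> sc x = sc x'"
    unfolding p1 p2 prod.case using p by (intro four_block_mat_inj[where a = r and c = r and b = 1 and d = 1]) auto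
  moreover have "(1 / x') \<cdot>\<^sub>m (u' * u'\<^sup>T) \<in> carrier_mat r r" using p by auto
  ultimately show "?f p = ?f p' \<longleftrightarrow> p = p'"
    unfolding p1 p2 by auto
next
  fix p assume "p \<in> ?X"
  then obtain S u x where p: "p = (S, u, x)" "S \<in> carrier_mat r r" "S\<^sup>T = S" "det S \<noteq> 0" "u \<in> carrier_mat r 1" "x \<noteq> 0"
    by (auto simp: SymGL_def GL_def)
  have "S + (1 / x) \<cdot>\<^sub>m (u * u\<^sup>T) \<in> carrier_mat r r" using p by auto
  moreover have "(S + (1 / x) \<cdot>\<^sub>m (u * u\<^sup>T))\<^sup>T = S + (1 / x) \<cdot>\<^sub>m (u * u\<^sup>T)"
    using p by (simp add: transpose_add[of _ r r] transpose_smult_mat transpose_mult_self[of _ r])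
  ultimately have "(?f p)\<^sup>T = ?f p" "?f p \<in> carrier_mat (Suc r) (Suc r)"
    using p transpose_border[of "S + (1 / x) \<cdot>\<^sub>m (u * u\<^sup>T)" r u "u\<^sup>T" x]
      four_block_carrier_mat[of "S + (1 / x) \<cdot>\<^sub>m (u * u\<^sup>T)" r r "sc x" 1 1 u "u\<^sup>T"] by auto
  moreover have "det (?f p) = det S * x" using det_schur[OF p(2,5,6)] p by simp
  moreover have "?f p $$ (r, r) = x" using p by simp
  ultimately show "?f p \<in> ?Y" using p by (simp add: SymGL_def GL_def)
next
  fix M :: "'a mat" assume M: "M \<in> ?Y"
  hence "M \<in> carrier_mat (Suc r) (Suc r)" "M\<^sup>T = M" by (auto simp: SymGL_def GL_def)
  then obtain S u x where b: "S \<in> carrier_mat r r" "S\<^sup>T = S" "u \<in> carrier_mat r 1"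
    "M = four_block_mat S u (u\<^sup>T) (sc x)" by (rule sym_border_cases)
  have x: "x \<noteq> 0" using M b by auto
  let ?S = "S + (- 1 / x) \<cdot>\<^sub>m (u * u\<^sup>T)"
  have S: "?S \<in> carrier_mat r r" "?S\<^sup>T = ?S"
    using b by (auto simp: transpose_add[of _ r r] transpose_smult_mat transpose_mult_self[of _ r])
  have "?S + (1 / x) \<cdot>\<^sub>m (u * u\<^sup>T) = S"
    using b by (intro eq_matI) auto
  hence f: "M = ?f (?S, u, x)" using b by simp
  moreover from this have "det M = det ?S * x"
    using det_schur[OF S(1) b(3) x] by simp
  ultimately show "\<exists>p\<in>?X. M = ?f p"
    using M S b x by (intro bexI[of _ "(?S, u, x)"]) (auto simp: SymGL_def GL_def)
qed

text \<open>Invertible symmetric matrices are counted by their last diagonal entry. If it is nonzero, split off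
  its Schur complement; if it vanishes, a congruence moves the rest of the last column to a unit vector.\<close>

definition null_border :: "nat \<Rightarrow> 'a::field mat \<Rightarrow> 'a mat set" where
  "null_border r u = {S \<in> carrier_mat r r. S\<^sup>T = S \<and> det (four_block_mat S u (u\<^sup>T) (sc 0)) \<noteq> 0}"

text \<open>With a unit vector as border the determinant depends on the upper left block alone,
  which leaves \<open>w\<close> and \<open>x\<close> free in the count.\<close>

lemma det_null_border:
  fixes S :: "'a::field mat"
  assumes "S \<in> carrier_mat k k" "w \<in> carrier_mat k 1"
  shows "det (four_block_mat (four_block_mat S w (w\<^sup>T) (sc x)) (mat (Suc k) 1 (\<lambda>(i, _). if i = k then 1 else 0))
     ((mat (Suc k) 1 (\<lambda>(i, _). if i = k then 1 else 0))\<^sup>T) (sc 0)) = - det S"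
proof -
  let ?e = "mat (Suc k) 1 (\<lambda>(i, _). if i = k then 1 else 0) :: 'a mat"
  let ?M = "four_block_mat (four_block_mat S w (w\<^sup>T) (sc x)) ?e (?e\<^sup>T) (sc 0)"
  have M: "?M \<in> carrier_mat (Suc (Suc k)) (Suc (Suc k))"
    using assms by (intro carrier_matI) auto
  have "det ?M = (\<Sum>j<Suc (Suc k). if j = k then cofactor ?M (Suc k) j else 0)"
    unfolding laplace_expansion_row[OF M lessI] using assms by (intro sum.cong) auto
  also have "\<dots> = cofactor ?M (Suc k) k" by (simp add: lessThan_Suc)
  also have "\<dots> = - det (mat_delete ?M (Suc k) k)" by (simp add: cofactor_def)
  \<comment> \<open>Deleting the column through \<open>w\<close> and \<open>x\<close> moves the unit
    vector into its place.\<close>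
  also have "mat_delete ?M (Suc k) k = four_block_mat S (0\<^sub>m k 1) (w\<^sup>T) (sc 1)"
    using assms by (intro eq_matI) (auto simp: mat_delete_def)
  also have "det \<dots> = det S"
    using assms by (subst det_four_block_mat_upper_right_zero[where n = k and m = 1]) auto
  finally show ?thesis .
qed

text \<open>The factor \<open>card UNIV ^ Suc k\<close> counts the free column \<open>w\<close> and
  the free corner \<open>x\<close>.\<close>

lemma card_null_border_unit:
  "card (null_border (Suc k) (mat (Suc k) 1 (\<lambda>(i, _). if i = k then 1 else (0::'a::{finite,field}))))
    = card (UNIV :: 'a set) ^ Suc k * card (SymGL k :: 'a mat set)"
proof -
  let ?e = "mat (Suc k) 1 (\<lambda>(i, _). if i = k then 1 else 0) :: 'a mat"
  have "bij_betw (\<lambda>(S, w, x). four_block_mat S w (w\<^sup>T) (sc x)) (SymGL k \<times> carrier_mat k 1 \<times> UNIV) (null_border (Suc k) ?e)"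
    (is "bij_betw ?f ?X ?Y")
  proof (rule bij_betwI')
    fix p p' assume "p \<in> ?X" "p' \<in> ?X"
    thus "?f p = ?f p' \<longleftrightarrow> p = p'"
      by (auto simp: SymGL_def GL_def four_block_mat_inj[where a = k and c = k and b = 1 and d = 1])
  next
    fix p assume "p \<in> ?X"
    then obtain S u x where p: "p = (S, u, x)" "S \<in> carrier_mat k k" "S\<^sup>T = S" "det S \<noteq> 0" "u \<in> carrier_mat k 1"
      by (auto simp: SymGL_def GL_def)
    have "(?f p)\<^sup>T = ?f p" "?f p \<in> carrier_mat (Suc k) (Suc k)"
      using p transpose_border[of S k u "u\<^sup>T" x] four_block_carrier_mat[of S k k "sc x" 1 1 u "u\<^sup>T"] by auto
    thus "?f p \<in> ?Y" using p det_null_border[OF p(2,5), of x] by (simp add: null_border_def)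
  next
    fix M assume M: "M \<in> ?Y"
    hence "M \<in> carrier_mat (Suc k) (Suc k)" "M\<^sup>T = M" by (auto simp: null_border_def)
    then obtain S u x where b: "S \<in> carrier_mat k k" "S\<^sup>T = S" "u \<in> carrier_mat k 1"
      "M = four_block_mat S u (u\<^sup>T) (sc x)" by (rule sym_border_cases)
    with M have "det S \<noteq> 0" using det_null_border[OF b(1,3), of x] by (simp add: null_border_def)
    with b show "\<exists>p\<in>?X. M = ?f p"
      by (intro bexI[of _ "(S, u, x)"]) (auto simp: SymGL_def GL_def)
  qed
  from bij_betw_same_card[OF this, symmetric] show ?thesis
    by (simp add: card_cartesian_product card_carrier_mat mult_ac)
qed

lemma congruence_carrier_sym:
  fixes S :: "'a::comm_ring_1 mat"
  assumes "S \<in> carrier_mat r r" "S\<^sup>T = S" "P \<in> carrier_mat r r"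
  shows "P * S * P\<^sup>T \<in> carrier_mat r r" "(P * S * P\<^sup>T)\<^sup>T = P * S * P\<^sup>T"
  using assms by (auto simp: transpose_mult[of _ r r _ r] assoc_mult_mat[of _ r r _ r _ r])

text \<open>This is congruence of the bordered matrix by \<open>diag(P, 1)\<close>, which transforms
  \<open>S\<close> and multiplies the border by \<open>P\<close>.\<close>

lemma congruence_null_border:
  fixes S :: "'a::field mat"
  assumes "P \<in> GL r" "u \<in> carrier_mat r 1" "S \<in> null_border r u"
  shows "P * S * P\<^sup>T \<in> null_border r (P * u)"
proof -
  have P: "P \<in> carrier_mat r r" "det P \<noteq> 0" using assms by (auto simp: GL_def)
  have S: "S \<in> carrier_mat r r" "S\<^sup>T = S" "det (four_block_mat S u (u\<^sup>T) (sc 0)) \<noteq> 0"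
    using assms by (auto simp: null_border_def)
  let ?P = "four_block_mat P (0\<^sub>m r 1) (0\<^sub>m 1 r) (sc 1)"
  let ?PT = "four_block_mat (P\<^sup>T) (0\<^sub>m r 1) (0\<^sub>m 1 r) (sc 1)"
  let ?M = "four_block_mat S u (u\<^sup>T) (sc 0)"
  have c: "?P \<in> carrier_mat (r + 1) (r + 1)" "?PT \<in> carrier_mat (r + 1) (r + 1)" "?M \<in> carrier_mat (r + 1) (r + 1)"
    using P S by (intro four_block_carrier_mat; simp)+
  have s1: "X * sc 1 = X" if "X \<in> carrier_mat r 1" for X :: "'a mat"
    using that by (auto simp: col_mult_sc[where r = r] intro!: eq_matI)
  have s2: "sc 1 * X = X" if "X \<in> carrier_mat 1 r" for X :: "'a mat"
    using that by (auto simp: sc_mult_row[where r = r] intro!: eq_matI)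
  have "four_block_mat (P * S * P\<^sup>T) (P * u) ((P * u)\<^sup>T) (sc 0) = ?P * ?M * ?PT"
    using P S assms(2) s1 s2
    by (simp add: mult_four_block_mat[where ?nr1.0 = r and ?n1.0 = r and ?n2.0 = 1 and ?nr2.0 = 1 and ?nc1.0 = r and ?nc2.0 = 1]
        sc_mult transpose_mult[of _ r r _ 1])
  hence "det (four_block_mat (P * S * P\<^sup>T) (P * u) ((P * u)\<^sup>T) (sc 0)) = det ?P * det ?M * det ?PT"
    using c by (simp add: det_mult[of _ "r + 1"] del: four_block_carrier_mat)
  moreover have "det ?P = det P" "det ?PT = det P"
    using P by (simp_all add: det_four_block_mat_upper_right_zero[where n = r and m = 1] det_transpose)
  ultimately show ?thesis using P S congruence_carrier_sym[OF S(1,2) P(1)]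
    by (simp add: null_border_def)
qed

text \<open>An invertible matrix with last column \<open>u\<close> carries the unit border to
  \<open>u\<close>, so congruence by it and by its inverse are mutually inverse bijections.\<close>

lemma card_null_border:
  fixes u :: "'a::{finite,field} mat"
  assumes "u \<in> carrier_mat (Suc k) 1" "u \<noteq> 0\<^sub>m (Suc k) 1"
  shows "card (null_border (Suc k) u) = card (UNIV :: 'a set) ^ Suc k * card (SymGL k :: 'a mat set)"
proof -
  let ?e = "mat (Suc k) 1 (\<lambda>(i, _). if i = k then 1 else 0) :: 'a mat"
  obtain l where l: "l \<le> k" "u $$ (l, 0) \<noteq> 0"
  proof -
    have "\<exists>l\<le>k. u $$ (l, 0) \<noteq> 0"
    proof (rule ccontr)
      assume "\<not> ?thesis"
      hence "u = 0\<^sub>m (Suc k) 1" using assms(1) by (intro eq_matI) auto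
      with assms(2) show False by simp
    qed
    thus ?thesis using that by blast
  qed
  obtain P where P: "P \<in> GL (Suc k)" "\<And>i. i \<le> k \<Longrightarrow> P $$ (i, k) = u $$ (i, 0)"
    using GL_with_last_col[OF l(1), of "\<lambda>i. u $$ (i, 0)"] l by blast
  obtain R where R: "R \<in> GL (Suc k)" "P * R = 1\<^sub>m (Suc k)" "R * P = 1\<^sub>m (Suc k)"
    using GL_inverse[OF P(1)] by blast
  have c: "P \<in> carrier_mat (Suc k) (Suc k)" "R \<in> carrier_mat (Suc k) (Suc k)" using P R GL_carrier by auto
  have Pe: "P * ?e = u"
  proof (rule eq_matI)
    fix i j assume "i < dim_row u" "j < dim_col u"
    hence i: "i < Suc k" "j = 0" using assms by auto
    have "(P * ?e) $$ (i, j) = (\<Sum>l = 0..<Suc k. if l = k then P $$ (i, l) else 0)"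
      using i c by (auto simp: scalar_prod_def intro!: sum.cong)
    thus "(P * ?e) $$ (i, j) = u $$ (i, j)" using P(2)[of i] i by simp
  qed (use c assms in auto)
  have Ru: "R * u = ?e"
    unfolding Pe[symmetric] using R c by (subst assoc_mult_mat[symmetric]) auto
  have inv: "B * (A * S * A\<^sup>T) * B\<^sup>T = S"
    if "A \<in> carrier_mat (Suc k) (Suc k)" "B \<in> carrier_mat (Suc k) (Suc k)" "S \<in> carrier_mat (Suc k) (Suc k)"
      "B * A = 1\<^sub>m (Suc k)" for A B S :: "'a mat"
  proof -
    let ?n = "Suc k"
    have "B * (A * S * A\<^sup>T) * B\<^sup>T = (B * A) * S * (A\<^sup>T * B\<^sup>T)"
    proof -
      note a = assoc_mult_mat[of _ ?n ?n _ ?n _ ?n]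
      have AT: "A\<^sup>T \<in> carrier_mat ?n ?n" "B\<^sup>T \<in> carrier_mat ?n ?n" using that by auto
      have "B * (A * S * A\<^sup>T) = (B * A * S) * A\<^sup>T"
        using that AT by (metis a mult_carrier_mat)
      thus ?thesis using that AT by (metis a mult_carrier_mat)
    qed
    also have "A\<^sup>T * B\<^sup>T = (B * A)\<^sup>T" using that(1,2) by (simp add: transpose_mult[of _ ?n ?n _ ?n])
    finally show ?thesis using that by simp
  qed
  have "bij_betw (\<lambda>S. P * S * P\<^sup>T) (null_border (Suc k) ?e) (null_border (Suc k) u)"
  proof (rule bij_betw_byWitness[where f' = "\<lambda>S. R * S * R\<^sup>T"])
    show "\<forall>S\<in>null_border (Suc k) ?e. R * (P * S * P\<^sup>T) * R\<^sup>T = S"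
      using inv[OF c _ R(3)] by (auto simp: null_border_def)
    show "\<forall>S\<in>null_border (Suc k) u. P * (R * S * R\<^sup>T) * P\<^sup>T = S"
      using inv[OF c(2,1) _ R(2)] by (auto simp: null_border_def)
    show "(\<lambda>S. P * S * P\<^sup>T) ` null_border (Suc k) ?e \<subseteq> null_border (Suc k) u"
      using congruence_null_border[OF P(1), of ?e] Pe by auto
    show "(\<lambda>S. R * S * R\<^sup>T) ` null_border (Suc k) u \<subseteq> null_border (Suc k) ?e"
      using congruence_null_border[OF R(1), of u] Ru assms by auto
  qed
  from bij_betw_same_card[OF this] show ?thesis by (simp only: card_null_border_unit)
qed

text \<open>A zero border would give a zero last column, so the border is one of the nonzero
  vectors, and all of them admit equally many \<open>S\<close>.\<close>

lemma card_SymGL_null: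
  "card {M \<in> SymGL (Suc (Suc k)). M $$ (Suc k, Suc k) = (0::'a::{finite,field})}
    = (card (UNIV :: 'a set) ^ Suc k - 1) * card (UNIV :: 'a set) ^ Suc k * card (SymGL k :: 'a mat set)"
proof -
  let ?z = "0\<^sub>m (Suc k) 1 :: 'a mat"
  let ?U = "carrier_mat (Suc k) 1 - {?z}"
  have "bij_betw (\<lambda>(u, S). four_block_mat S u (u\<^sup>T) (sc 0)) (SIGMA u:?U. null_border (Suc k) u)
    {M \<in> SymGL (Suc (Suc k)). M $$ (Suc k, Suc k) = 0}" (is "bij_betw ?f ?X ?Y")
  proof (rule bij_betwI')
    fix p p' assume "p \<in> ?X" "p' \<in> ?X"
    thus "?f p = ?f p' \<longleftrightarrow> p = p'"
      by (auto simp: null_border_def four_block_mat_inj[where a = "Suc k" and c = "Suc k" and b = 1 and d = 1])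
  next
    fix p assume "p \<in> ?X"
    then obtain S u where p: "p = (u, S)" "u \<in> carrier_mat (Suc k) 1" "S \<in> null_border (Suc k) u" by auto
    hence S: "S \<in> carrier_mat (Suc k) (Suc k)" "S\<^sup>T = S" by (auto simp: null_border_def)
    have "(?f p)\<^sup>T = ?f p" "?f p \<in> carrier_mat (Suc (Suc k)) (Suc (Suc k))"
      using p S transpose_border[of S "Suc k" u "u\<^sup>T" 0]
        four_block_carrier_mat[of S "Suc k" "Suc k" "sc 0" 1 1 u "u\<^sup>T"] by auto
    thus "?f p \<in> ?Y" using p S by (simp add: SymGL_def GL_def null_border_def)
  next
    fix M assume M: "M \<in> ?Y"
    hence "M \<in> carrier_mat (Suc (Suc k)) (Suc (Suc k))" "M\<^sup>T = M" by (auto simp: SymGL_def GL_def)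
    then obtain S u x where b: "S \<in> carrier_mat (Suc k) (Suc k)" "S\<^sup>T = S" "u \<in> carrier_mat (Suc k) 1"
      "M = four_block_mat S u (u\<^sup>T) (sc x)" by (rule sym_border_cases)
    have x: "x = 0" using M b by auto
    have "u \<noteq> ?z"
    proof
      assume u: "u = ?z"
      have "det M = 0"
        by (rule det_zero_last_col[of _ "Suc k"]) (use b x u in \<open>auto intro!: carrier_matI\<close>)
      with M show False by (simp add: SymGL_def GL_def)
    qed
    with b x M show "\<exists>p\<in>?X. M = ?f p"
      by (intro bexI[of _ "(u, S)"]) (auto simp: SymGL_def GL_def null_border_def)
  qed
  hence "card ?Y = card ?X" by (rule bij_betw_same_card[symmetric])
  also have "\<dots> = (\<Sum>u\<in>?U. card (null_border (Suc k) u))"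
  proof (rule card_SigmaI)
    show "\<forall>u\<in>?U. finite (null_border (Suc k) u)"
      by (intro ballI finite_subset[OF _ finite_carrier_mat[of "Suc k" "Suc k"]]) (auto simp: null_border_def)
  qed simp
  also have "\<dots> = (\<Sum>u\<in>?U. card (UNIV :: 'a set) ^ Suc k * card (SymGL k :: 'a mat set))"
    by (rule sum.cong) (auto simp: card_null_border)
  also have "\<dots> = (card (UNIV :: 'a set) ^ Suc k - 1) * card (UNIV :: 'a set) ^ Suc k * card (SymGL k :: 'a mat set)"
    by (simp add: card_Diff_singleton card_carrier_mat)
  finally show ?thesis .
qed

lemma card_SymGL_nonnull:
  "card {M \<in> SymGL (Suc r). M $$ (r, r) \<noteq> (0::'a::{finite,field})}
    = (card (UNIV :: 'a set) - 1) * card (UNIV :: 'a set) ^ r * card (SymGL r :: 'a mat set)"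
  using bij_betw_same_card[OF bij_betw_SymGL_schur[of r, where ?'a = 'a], symmetric]
  by (simp add: card_cartesian_product card_carrier_mat mult_ac)

lemma card_SymGL_split:
  "card (SymGL (Suc r) :: 'a::{finite,field} mat set) =
     card {M \<in> SymGL (Suc r). M $$ (r, r) \<noteq> (0::'a)} + card {M \<in> SymGL (Suc r). M $$ (r, r) = (0::'a)}"
proof -
  have "SymGL (Suc r) = {M \<in> SymGL (Suc r). M $$ (r, r) \<noteq> (0::'a)} \<union> {M \<in> SymGL (Suc r). M $$ (r, r) = (0::'a)}"
    by auto
  thus ?thesis by (subst card_Un_disjoint[symmetric]) auto
qed

lemma card_SymGL_1: "card (SymGL (Suc 0) :: 'a::{finite,field} mat set) = card (UNIV :: 'a set) - 1"
proof -
  have "{M \<in> SymGL (Suc 0). M $$ (0, 0) = (0::'a)} = {}"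
    using det_zero_last_col[of _ 0] by (auto simp: SymGL_def GL_def)
  thus ?thesis unfolding card_SymGL_split card_SymGL_nonnull by (simp add: card_SymGL_0)
qed

lemma card_SymGL_Suc_Suc:
  "card (SymGL (Suc (Suc k)) :: 'a::{finite,field} mat set) =
     (card (UNIV :: 'a set) - 1) * card (UNIV :: 'a set) ^ Suc k * card (SymGL (Suc k) :: 'a mat set)
   + (card (UNIV :: 'a set) ^ Suc k - 1) * card (UNIV :: 'a set) ^ Suc k * card (SymGL k :: 'a mat set)"
  unfolding card_SymGL_split[of "Suc k"] card_SymGL_nonnull card_SymGL_null ..


subsection \<open>Gauss sums and the binary special orthogonal group\<close>

context ternary
begin

abbreviation "nonzero_squares \<equiv> {a::'a. a \<noteq> 0 \<and> (\<exists>b. a = b ^ 2)}"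

lemma card_sqrts:
  assumes "c \<in> nonzero_squares"
  shows "card {x \<in> UNIV - {0}. x ^ 2 = c} = 2"
proof -
  from assms obtain b where b: "c = b ^ 2" "b \<noteq> 0" by auto
  have "x ^ 2 = b ^ 2 \<longleftrightarrow> x = b \<or> x = - b" for x :: 'a by (rule power2_eq_iff)
  hence "{x \<in> UNIV - {0}. x ^ 2 = c} = {b, - b}" using b by auto
  moreover have "b \<noteq> - b" using neg_eq_iff[of b] b by auto
  ultimately show ?thesis by simp
qed

lemma sum_over_squares:
  "(\<Sum>x\<in>UNIV - {0::'a}. f (x ^ 2)) = 2 * (\<Sum>c\<in>nonzero_squares. f c :: 'b::comm_semiring_1)"
proof -
  have "(\<Sum>x\<in>UNIV - {0::'a}. f (x ^ 2)) = (\<Sum>c\<in>nonzero_squares. \<Sum>x | x \<in> UNIV - {0} \<and> x ^ 2 = c. f (x ^ 2))"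
    by (rule sum.group[symmetric]) auto
  also have "\<dots> = (\<Sum>c\<in>nonzero_squares. of_nat (card {x \<in> UNIV - {0}. x ^ 2 = c}) * f c)"
    by (rule sum.cong) auto
  also have "\<dots> = (\<Sum>c\<in>nonzero_squares. 2 * f c)" by (rule sum.cong) (simp_all only: card_sqrts, simp)
  finally show ?thesis by (simp add: sum_distrib_left)
qed

text \<open>The nonzero squares and their \<epsilon>-multiples are disjoint because \<epsilon> is a
  nonsquare, and each is hit twice by \<open>x\<close>. The point 0 is hit once by each sum, so it
  too has multiplicity 2.\<close>

lemma sum_squares_nonsquares:
  fixes \<epsilon> :: 'a
  assumes "\<epsilon> \<noteq> 0" "\<nexists>b. \<epsilon> = b ^ 2"
  shows "(\<Sum>x\<in>UNIV. f (x ^ 2)) + (\<Sum>x\<in>UNIV. f (\<epsilon> * x ^ 2)) = 2 * (\<Sum>c\<in>UNIV. f c :: 'b::comm_semiring_1)"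
proof -
  let ?S = nonzero_squares and ?T = "(\<lambda>c. \<epsilon> * c) ` nonzero_squares"
  have inj: "inj_on (\<lambda>c. \<epsilon> * c) ?S" using assms by (auto simp: inj_on_def)
  have disj: "?S \<inter> ?T = {}"
  proof safe
    fix b c :: 'a assume "\<epsilon> * c ^ 2 = b ^ 2" "\<epsilon> * c ^ 2 \<noteq> 0"
    hence "c \<noteq> 0" by auto
    with \<open>\<epsilon> * c ^ 2 = b ^ 2\<close> have "\<epsilon> = (b / c) ^ 2" by (simp add: power_divide field_simps)
    with assms show "\<epsilon> * c ^ 2 \<in> {}" by blast
  qed
  \<comment> \<open>The two disjoint sets are shown to exhaust the nonzero elements by
    counting.\<close>
  have "2 * card ?S = q - 1"
    using sum_over_squares[of "\<lambda>_. 1::nat"] by (simp add: card_UNIV)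
  hence "card (?S \<union> ?T) = q - 1"
    by (subst card_Un_disjoint) (use disj in \<open>auto simp: card_image[OF inj]\<close>)
  hence un: "?S \<union> ?T = UNIV - {0}"
    using assms by (intro card_subset_eq) (auto simp: card_UNIV)
  have split: "(\<Sum>x\<in>UNIV. g x) = g 0 + (\<Sum>x\<in>UNIV - {0::'a}. g x)" for g :: "'a \<Rightarrow> 'b"
    by (simp add: sum.remove)
  have "(\<Sum>x\<in>UNIV. f (x ^ 2)) + (\<Sum>x\<in>UNIV. f (\<epsilon> * x ^ 2)) = f 0 + f 0 + 2 * ((\<Sum>c\<in>?S. f c) + (\<Sum>c\<in>?S. f (\<epsilon> * c)))"
    unfolding split sum_over_squares sum_over_squares[of "\<lambda>c. f (\<epsilon> * c)"]
    by (simp add: algebra_simps)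
  also have "(\<Sum>c\<in>?S. f (\<epsilon> * c)) = (\<Sum>c\<in>?T. f c)"
    by (simp add: sum.reindex[OF inj] o_def)
  also have "(\<Sum>c\<in>?S. f c) + (\<Sum>c\<in>?T. f c) = (\<Sum>c\<in>UNIV - {0}. f c)"
    unfolding un[symmetric] by (rule sum.union_disjoint[symmetric]) (use disj in auto)
  finally show ?thesis unfolding split by (simp add: distrib_left mult_2 add_ac)
qed

definition gauss :: "'a \<Rightarrow> complex" where "gauss a = (\<Sum>x\<in>UNIV. \<chi> (a * x ^ 2))"

text \<open>Squares and \<open>\<epsilon>\<close>-multiples of squares together cover each field element twice.\<close>

lemma gauss_nonsquare:
  assumes "\<epsilon> \<noteq> 0" "\<nexists>b. \<epsilon> = b ^ 2" "a \<noteq> 0"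
  shows "gauss (a * \<epsilon>) = - gauss a"
  using sum_squares_nonsquares[OF assms(1,2), of "\<lambda>c. \<chi> (a * c)"] assms(3)
  by (simp add: gauss_def sum_lam mult.assoc eq_neg_iff_add_eq_0 add.commute)

text \<open>The form \<open>x\<^sup>2 - y\<^sup>2\<close> is hyperbolic: in the coordinates
  \<open>u = x - y\<close>, \<open>v = x + y\<close> it is \<open>u v\<close>, and the sum over
  \<open>v\<close> leaves only \<open>u = 0\<close>.\<close>

lemma gauss_mult_uminus:
  assumes "a \<noteq> 0"
  shows "gauss a * gauss (- a) = of_nat q"
proof -
  have "gauss a * gauss (- a) = (\<Sum>(x, y)\<in>UNIV \<times> UNIV. \<chi> (a * (x ^ 2 - y ^ 2)))"
    unfolding gauss_def by (simp add: sum_product sum.cartesian_product lam_add[symmetric] algebra_simps)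
  also have "\<dots> = (\<Sum>(u, v)\<in>UNIV \<times> UNIV. \<chi> (a * u * v))"
  proof (rule sum.reindex_bij_witness[of _ "\<lambda>(u, v). ((u + v) / 2, (v - u) / 2 :: 'a)" "\<lambda>(x, y). (x - y, x + y)"])
    have half: "(x + x) / 2 = x" for x :: 'a using two_nz by (simp flip: mult_2)
    have e: "x - y + (x + y) = x + x" "x + y - (x - y) = y + y" for x y :: 'a by auto
    show "(\<lambda>(u, v). ((u + v) / 2, (v - u) / 2)) ((\<lambda>(x, y). (x - y, x + y)) p) = p" for p :: "'a \<times> 'a"
      by (cases p) (simp only: prod.case e half)
    show "(\<lambda>(x, y). (x - y, x + y)) ((\<lambda>(u, v). ((u + v) / 2, (v - u) / 2)) p) = p" for p :: "'a \<times> 'a"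
      using half by (cases p) (simp add: diff_divide_distrib[symmetric] add_divide_distrib[symmetric])
  qed (auto simp: algebra_simps power2_eq_square)
  also have "\<dots> = (\<Sum>u\<in>UNIV. \<Sum>v\<in>UNIV. \<chi> (a * u * v))" by (simp add: sum.cartesian_product)
  also have "\<dots> = of_nat q" using assms by (simp add: sum_lam)
  finally show ?thesis .
qed

text \<open>The sum of the anisotropic form \<open>a (x\<^sup>2 - \<epsilon> y\<^sup>2)\<close>. Its
  value does not depend on \<open>a\<close>, and its sign is the source of \<eta>.\<close>

lemma gauss_mult_norm:
  assumes "\<epsilon> \<noteq> 0" "\<nexists>b. \<epsilon> = b ^ 2" "a \<noteq> 0"
  shows "gauss a * gauss (- a * \<epsilon>) = - of_nat q"
  using gauss_nonsquare[OF assms(1,2), of "- a"] gauss_mult_uminus[OF assms(3)] assms(3) by simp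

definition quad_form :: "'a mat \<Rightarrow> 'a mat \<Rightarrow> 'a" where
  "quad_form S z = (z\<^sup>T * S * z) $$ (0, 0)"

definition quad_gauss :: "'a \<Rightarrow> 'a mat \<Rightarrow> complex" where
  "quad_gauss a S = (\<Sum>z\<in>carrier_mat (dim_row S) 1. \<chi> (a * quad_form S z))"

lemma quad_form_sum:
  assumes "S \<in> carrier_mat r r" "z \<in> carrier_mat r 1"
  shows "quad_form S z = (\<Sum>i<r. \<Sum>j<r. z $$ (i, 0) * S $$ (i, j) * z $$ (j, 0))"
proof -
  have "quad_form S z = (\<Sum>i<r. z $$ (i, 0) * (\<Sum>j<r. S $$ (i, j) * z $$ (j, 0)))"
    using assms by (simp add: quad_form_def scalar_prod_def atLeast0LessThan)
  thus ?thesis by (simp add: sum_distrib_left mult.assoc)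
qed

lemma quad_form_congruence:
  assumes "S \<in> carrier_mat r r" "P \<in> carrier_mat r r" "z \<in> carrier_mat r 1"
  shows "quad_form (P\<^sup>T * S * P) z = quad_form S (P * z)"
proof -
  have c: "z\<^sup>T \<in> carrier_mat 1 r" "P\<^sup>T \<in> carrier_mat r r" using assms by auto
  have "z\<^sup>T * (P\<^sup>T * S * P) * z = z\<^sup>T * P\<^sup>T * S * (P * z)"
    using assms c by (simp add: assoc_mult_mat[of "z\<^sup>T" 1 r "P\<^sup>T * S" r "P * z" 1]
        assoc_mult_mat[of "P\<^sup>T" r r S r "P * z" 1] assoc_mult_mat[of "z\<^sup>T" 1 r "P\<^sup>T * (S * P)" r z 1]
        assoc_mult_mat[of "P\<^sup>T" r r "S * P" r z 1] assoc_mult_mat[of S r r P r z 1])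
  thus ?thesis using assms by (simp add: quad_form_def transpose_mult[of _ r r _ 1])
qed

lemma quad_gauss_congruence:
  assumes "S \<in> carrier_mat r r" "P \<in> GL r"
  shows "quad_gauss a (P\<^sup>T * S * P) = quad_gauss a S"
proof -
  from assms(2) have P: "P \<in> carrier_mat r r" by (rule GL_carrier)
  obtain R where R: "R \<in> GL r" "P * R = 1\<^sub>m r" "R * P = 1\<^sub>m r" using GL_inverse[OF assms(2)] by blast
  have Rc: "R \<in> carrier_mat r r" using R GL_carrier by blast
  have "(\<Sum>z\<in>carrier_mat r 1. \<chi> (a * quad_form (P\<^sup>T * S * P) z)) = (\<Sum>z\<in>carrier_mat r 1. \<chi> (a * quad_form S z))"
  proof (rule sum.reindex_bij_witness[of _ "\<lambda>z. R * z" "\<lambda>z. P * z"])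
    fix z :: "'a mat" assume z: "z \<in> carrier_mat r 1"
    show "R * (P * z) = z" using R P Rc z by (simp flip: assoc_mult_mat)
    show "P * (R * z) = z" using R P Rc z by (simp flip: assoc_mult_mat)
    show "\<chi> (a * quad_form S (P * z)) = \<chi> (a * quad_form (P\<^sup>T * S * P) z)"
      using quad_form_congruence[OF assms(1) P z] by simp
  qed (use P Rc in auto)
  thus ?thesis using assms P by (simp add: quad_gauss_def)
qed

lemma quad_gauss_diag:
  assumes "S \<in> carrier_mat r r"
  shows "quad_gauss a (four_block_mat S (0\<^sub>m r 1) (0\<^sub>m 1 r) (sc d)) = quad_gauss a S * gauss (a * d)"
proof -
  let ?D = "four_block_mat S (0\<^sub>m r 1) (0\<^sub>m 1 r) (sc d)"
  let ?f = "\<lambda>(z, x). mat (Suc r) 1 (\<lambda>(i, _). if i < r then z $$ (i, 0) else x) :: 'a mat"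
  have D: "?D \<in> carrier_mat (Suc r) (Suc r)" using assms by (intro carrier_matI) auto
  have qf: "quad_form ?D (?f (z, x)) = quad_form S z + d * x ^ 2" if "z \<in> carrier_mat r 1" for z x
  proof -
    let ?w = "?f (z, x)"
    have w: "?w \<in> carrier_mat (Suc r) 1" by simp
    have "quad_form ?D ?w = (\<Sum>i<Suc r. \<Sum>j<Suc r. ?w $$ (i, 0) * ?D $$ (i, j) * ?w $$ (j, 0))"
      by (rule quad_form_sum[OF D w])
    also have "\<dots> = (\<Sum>i<r. \<Sum>j<r. z $$ (i, 0) * S $$ (i, j) * z $$ (j, 0)) + x * d * x"
      using assms by (simp add: sum.neutral)
    finally show ?thesis using quad_form_sum[OF assms that] by (simp add: power2_eq_square mult_ac)
  qed
  have "quad_gauss a ?D = (\<Sum>w\<in>carrier_mat (Suc r) 1. \<chi> (a * quad_form ?D w))"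
    using D assms by (simp add: quad_gauss_def)
  also have "\<dots> = (\<Sum>(z, x)\<in>carrier_mat r 1 \<times> UNIV. \<chi> (a * quad_form S z) * \<chi> (a * d * x ^ 2))"
  proof (rule sum.reindex_bij_witness[of _ ?f "\<lambda>w. (mat r 1 (\<lambda>(i, _). w $$ (i, 0)), w $$ (r, 0))"])
    fix w :: "'a mat" assume w: "w \<in> carrier_mat (Suc r) 1"
    show e: "?f (mat r 1 (\<lambda>(i, _). w $$ (i, 0)), w $$ (r, 0)) = w"
      using w by (intro eq_matI) (auto simp: less_Suc_eq)
    show "(case (mat r 1 (\<lambda>(i, _). w $$ (i, 0)), w $$ (r, 0)) of (z, x) \<Rightarrow>
        \<chi> (a * quad_form S z) * \<chi> (a * d * x ^ 2)) = \<chi> (a * quad_form ?D w)"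
      using qf[of "mat r 1 (\<lambda>(i, _). w $$ (i, 0))" "w $$ (r, 0)"] unfolding e
      by (simp add: distrib_left lam_add mult.assoc)
  next
    fix p :: "'a mat \<times> 'a" assume "p \<in> carrier_mat r 1 \<times> UNIV"
    thus "(mat r 1 (\<lambda>(i, _). ?f p $$ (i, 0)), ?f p $$ (r, 0)) = p"
      by (auto intro!: eq_matI)
  qed auto
  also have "\<dots> = quad_gauss a S * gauss (a * d)"
    using assms by (simp add: quad_gauss_def gauss_def sum_product sum.cartesian_product)
  finally show ?thesis .
qed

lemma quad_gauss_schur:
  assumes "S \<in> carrier_mat r r" "S\<^sup>T = S" "u \<in> carrier_mat r 1" "x \<noteq> 0"
  shows "quad_gauss a (four_block_mat (S + (1 / x) \<cdot>\<^sub>m (u * u\<^sup>T)) u (u\<^sup>T) (sc x)) = quad_gauss a S * gauss (a * x)"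
proof -
  let ?L = "four_block_mat (1\<^sub>m r) (0\<^sub>m r 1) ((1 / x) \<cdot>\<^sub>m u\<^sup>T) (sc 1)"
  let ?D = "four_block_mat S (0\<^sub>m r 1) (0\<^sub>m 1 r) (sc x)"
  have LT: "?L\<^sup>T = four_block_mat (1\<^sub>m r) ((1 / x) \<cdot>\<^sub>m u) (0\<^sub>m 1 r) (sc 1)"
    using assms by (subst transpose_border[of _ r]) (auto simp: transpose_smult_mat)
  have L: "?L \<in> carrier_mat (Suc r) (Suc r)" by (intro carrier_matI) auto
  have D: "?D \<in> carrier_mat (Suc r) (Suc r)" using assms by (intro carrier_matI) auto
  have "det ?L = 1" using assms
    by (subst det_four_block_mat_upper_right_zero[where n = r and m = 1]) auto
  hence "?L \<in> GL (Suc r)" using L by (simp add: GL_def)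
  moreover have "four_block_mat (S + (1 / x) \<cdot>\<^sub>m (u * u\<^sup>T)) u (u\<^sup>T) (sc x) = ?L\<^sup>T * ?D * ?L"
    unfolding schur_decomposition[OF assms(1,3,4)] LT[symmetric] using L D
    by (subst assoc_mult_mat[of _ "Suc r" "Suc r" _ "Suc r" _ "Suc r"]) auto
  ultimately show ?thesis using quad_gauss_congruence[OF D] quad_gauss_diag[OF assms(1)] by simp
qed

text \<open>Polarization: if the form vanishes at the unit vectors \<open>e k\<close> and
  \<open>e l\<close>, its value at their sum is \<open>2 * S $$ (k, l)\<close>, and 2 is
  invertible.\<close>

lemma quad_form_nonzero:
  assumes "S \<in> carrier_mat r r" "S\<^sup>T = S" "S \<noteq> 0\<^sub>m r r"
  obtains z where "z \<in> carrier_mat r 1" "quad_form S z \<noteq> 0"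
proof -
  define e where "e k = mat r 1 (\<lambda>(i, _). if i = k then 1 else (0::'a))" for k
  have e: "e k \<in> carrier_mat r 1" for k by (simp add: e_def)
  have sum_e: "(\<Sum>i<r. e k $$ (i, 0) * g i) = g k" if "k < r" for k g
  proof -
    have "(\<Sum>i<r. e k $$ (i, 0) * g i) = (\<Sum>i<r. if i = k then g i else 0)"
      by (rule sum.cong) (auto simp: e_def)
    thus ?thesis using that by simp
  qed
  have bil: "(\<Sum>i<r. \<Sum>j<r. e k $$ (i, 0) * S $$ (i, j) * e l $$ (j, 0)) = S $$ (k, l)" if "k < r" "l < r" for k l
  proof -
    have "(\<Sum>i<r. \<Sum>j<r. e k $$ (i, 0) * S $$ (i, j) * e l $$ (j, 0))
      = (\<Sum>i<r. e k $$ (i, 0) * (\<Sum>j<r. e l $$ (j, 0) * S $$ (i, j)))"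
      by (simp add: sum_distrib_left mult_ac)
    thus ?thesis using that by (simp add: sum_e)
  qed
  obtain k l where kl: "k < r" "l < r" "S $$ (k, l) \<noteq> 0"
  proof -
    have "\<exists>k<r. \<exists>l<r. S $$ (k, l) \<noteq> 0"
    proof (rule ccontr)
      assume "\<not> ?thesis"
      hence "S = 0\<^sub>m r r" using assms by (intro eq_matI) auto
      with assms show False by simp
    qed
    thus ?thesis using that by blast
  qed
  have sym: "S $$ (l, k) = S $$ (k, l)"
    using arg_cong[OF assms(2), of "\<lambda>M. M $$ (k, l)"] kl assms(1) by auto
  have diag: "quad_form S (e i) = S $$ (i, i)" if "i < r" for i
    using quad_form_sum[OF assms(1) e[of i]] bil[OF that that] by simp
  have "quad_form S (e k + e l) = S $$ (k, k) + S $$ (k, l) + S $$ (l, k) + S $$ (l, l)"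
  proof -
    have "quad_form S (e k + e l) = (\<Sum>i<r. \<Sum>j<r. (e k $$ (i, 0) + e l $$ (i, 0)) * S $$ (i, j) * (e k $$ (j, 0) + e l $$ (j, 0)))"
      using quad_form_sum[OF assms(1), of "e k + e l"] e by (simp add: e_def)
    also have "\<dots> = S $$ (k, k) + S $$ (k, l) + S $$ (l, k) + S $$ (l, l)"
      using kl by (simp add: distrib_left distrib_right sum.distrib bil add_ac)
    finally show ?thesis .
  qed
  hence pol: "quad_form S (e k + e l) = quad_form S (e k) + quad_form S (e l) + 2 * S $$ (k, l)"
    using diag kl sym by simp
  show ?thesis
  proof (cases "quad_form S (e k) = 0 \<and> quad_form S (e l) = 0")
    case True
    hence "quad_form S (e k + e l) \<noteq> 0" using pol kl two_nz by simp
    thus ?thesis using that[of "e k + e l"] e by auto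
  qed (use that e in blast)
qed

text \<open>One step of diagonalization: a vector where the form is nonzero is made the last basis
  vector, so the corner becomes nonzero and the Schur complement splits off.\<close>

lemma quad_gauss_reduce:
  assumes "S \<in> SymGL (Suc r)"
  obtains S' x where "S' \<in> SymGL r" "x \<noteq> 0" "\<And>a. quad_gauss a S = quad_gauss a S' * gauss (a * x)"
proof -
  from assms have S: "S \<in> carrier_mat (Suc r) (Suc r)" "S\<^sup>T = S" "det S \<noteq> 0"
    by (auto simp: SymGL_def GL_def)
  have "S \<noteq> 0\<^sub>m (Suc r) (Suc r)" using S det_zero[of "Suc r"] by auto
  then obtain z where z: "z \<in> carrier_mat (Suc r) 1" "quad_form S z \<noteq> 0"
    using quad_form_nonzero[OF S(1,2)] by blast
  have "\<exists>k\<le>r. z $$ (k, 0) \<noteq> 0"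
  proof (rule ccontr)
    assume "\<not> ?thesis"
    hence "quad_form S z = 0" unfolding quad_form_sum[OF S(1) z(1)] by (simp add: less_Suc_eq_le)
    with z show False by simp
  qed
  then obtain P where P: "P \<in> GL (Suc r)" "\<And>i. i \<le> r \<Longrightarrow> P $$ (i, r) = z $$ (i, 0)"
    using GL_with_last_col[of _ r "\<lambda>i. z $$ (i, 0)"] by blast
  have Pc: "P \<in> carrier_mat (Suc r) (Suc r)" using P GL_carrier by blast
  let ?M = "P\<^sup>T * S * P"
  have "?M $$ (r, r) = quad_form S z"
  proof -
    have "?M $$ (r, r) = (\<Sum>i<Suc r. P $$ (i, r) * (\<Sum>j<Suc r. S $$ (i, j) * P $$ (j, r)))"
      using Pc S by (simp add: scalar_prod_def atLeast0LessThan del: sum.lessThan_Suc)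
    also have "\<dots> = quad_form S z" unfolding quad_form_sum[OF S(1) z(1)]
      using P(2) by (simp add: sum_distrib_left mult.assoc del: sum.lessThan_Suc)
    finally show ?thesis .
  qed
  moreover have "?M \<in> SymGL (Suc r)"
    using congruence_carrier_sym[OF S(1,2), of "P\<^sup>T"] Pc P S
    by (simp add: SymGL_def GL_def det_mult[of _ "Suc r"] det_transpose[of _ "Suc r"])
  ultimately have "?M \<in> {M \<in> SymGL (Suc r). M $$ (r, r) \<noteq> 0}" using z by simp
  then obtain S' u x where M: "S' \<in> SymGL r" "u \<in> carrier_mat r 1" "x \<noteq> 0"
    "?M = four_block_mat (S' + (1 / x) \<cdot>\<^sub>m (u * u\<^sup>T)) u (u\<^sup>T) (sc x)"
    unfolding bij_betw_imp_surj_on[OF bij_betw_SymGL_schur, symmetric] by auto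
  have "quad_gauss a S = quad_gauss a S' * gauss (a * x)" for a
    using quad_gauss_congruence[OF S(1) P(1), of a] quad_gauss_schur[OF _ _ M(2,3), of S' a] M
    by (simp add: SymGL_def GL_def)
  with M that show ?thesis by blast
qed

text \<open>Every diagonal entry \<open>x\<close> contributes
  \<open>gauss (a * x) * gauss (- a * \<epsilon> * x) = - q\<close>, square or not; thus the class
  of the form drops out.\<close>

lemma quad_gauss_mult_norm:
  assumes "\<epsilon> \<noteq> 0" "\<nexists>b. \<epsilon> = b ^ 2" "a \<noteq> 0" "S \<in> SymGL r"
  shows "quad_gauss a S * quad_gauss (- a * \<epsilon>) S = (- of_nat q) ^ r"
  using assms(4)
proof (induction r arbitrary: S)
  case 0
  hence "S \<in> carrier_mat 0 0" by (auto simp: SymGL_def GL_def)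
  moreover have "carrier_mat 0 1 = {0\<^sub>m 0 1 :: 'a mat}" by auto
  moreover have "quad_form S (0\<^sub>m 0 1) = 0"
    using quad_form_sum[of S 0 "0\<^sub>m 0 1"] calculation by simp
  ultimately show ?case by (simp add: quad_gauss_def)
next
  case (Suc r)
  obtain S' x where S': "S' \<in> SymGL r" "x \<noteq> 0" "\<And>a. quad_gauss a S = quad_gauss a S' * gauss (a * x)"
    using quad_gauss_reduce[OF Suc.prems] by blast
  have "gauss (a * x) * gauss (- a * \<epsilon> * x) = - of_nat q"
    using gauss_mult_norm[OF assms(1,2), of "a * x"] S' assms(3) by (simp add: mult_ac)
  hence "quad_gauss a S * quad_gauss (- a * \<epsilon>) S = (quad_gauss a S' * quad_gauss (- a * \<epsilon>) S') * (- of_nat q)"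
    unfolding S'(3) by (metis mult.assoc mult.left_commute)
  also have "\<dots> = (- of_nat q) ^ Suc r" unfolding Suc.IH[OF S'(1)] by simp
  finally show ?case .
qed

end

section \<open>The binary special orthogonal group\<close>

lemma Jmat_1: "Jmat 1 \<epsilon> = delta_eps \<epsilon>"
  by (rule eq_matI) (auto simp: Jmat_def blocks3_def blk3_def bidx_def delta_eps_def)

text \<open>For nonsquare \<epsilon> this is the norm-one group of the quadratic extension: the
  matrix is multiplication by \<open>x + y sqrt(\<epsilon>)\<close> in the basis
  \<open>1, sqrt(\<epsilon>)\<close>.\<close>

lemma SOminus_1:
  fixes \<epsilon> :: "'a::field"
  assumes "\<epsilon> \<noteq> 0"
  shows "SOminus 1 \<epsilon> = (\<lambda>(x, y). mat 2 2 (\<lambda>(i, j). if i = j then x else if i = 0 then \<epsilon> * y else y)) `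
    {(x, y). x ^ 2 - \<epsilon> * y ^ 2 = 1}" (is "_ = ?f ` ?P")
proof (intro equalityI subsetI)
  have ex: "w\<^sup>T * delta_eps \<epsilon> * w = delta_eps \<epsilon> \<longleftrightarrow>
      w $$ (0,0) ^ 2 - \<epsilon> * w $$ (1,0) ^ 2 = 1 \<and> w $$ (0,0) * w $$ (0,1) = \<epsilon> * w $$ (1,0) * w $$ (1,1)
      \<and> w $$ (0,1) ^ 2 - \<epsilon> * w $$ (1,1) ^ 2 = - \<epsilon>" if "w \<in> carrier_mat 2 2" for w
  proof -
    have 2: "(\<forall>i<2. \<forall>j<2. P i j) \<longleftrightarrow> P 0 0 \<and> P 0 1 \<and> P 1 0 \<and> P 1 1" for P :: "nat \<Rightarrow> nat \<Rightarrow> bool"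
      by (auto simp: numeral_2_eq_2 less_Suc_eq)
    have c: "delta_eps \<epsilon> \<in> carrier_mat 2 2" by (simp add: delta_eps_def)
    have e: "(w\<^sup>T * delta_eps \<epsilon> * w) $$ (i, j) = w $$ (0, i) * w $$ (0, j) - \<epsilon> * w $$ (1, i) * w $$ (1, j)"
      if "i < 2" "j < 2" for i j
      using that \<open>w \<in> carrier_mat 2 2\<close>
      by (simp add: scalar_prod_def delta_eps_def numeral_2_eq_2 algebra_simps)
    have "w\<^sup>T * delta_eps \<epsilon> * w = delta_eps \<epsilon> \<longleftrightarrow>
      (\<forall>i<2. \<forall>j<2. (w\<^sup>T * delta_eps \<epsilon> * w) $$ (i, j) = delta_eps \<epsilon> $$ (i, j))"
    proof
      assume *: "\<forall>i<2. \<forall>j<2. (w\<^sup>T * delta_eps \<epsilon> * w) $$ (i, j) = delta_eps \<epsilon> $$ (i, j)"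
      show "w\<^sup>T * delta_eps \<epsilon> * w = delta_eps \<epsilon>"
        by (rule eq_matI) (use * that c in \<open>simp_all del: index_mult_mat(1)\<close>)
    qed simp
    also have "\<dots> \<longleftrightarrow> (\<forall>i<2. \<forall>j<2. w $$ (0, i) * w $$ (0, j) - \<epsilon> * w $$ (1, i) * w $$ (1, j) = delta_eps \<epsilon> $$ (i, j))"
      using e by simp
    finally show ?thesis unfolding 2
      by (auto simp: delta_eps_def power2_eq_square mult_ac)
  qed
  have d2: "det w = w $$ (0,0) * w $$ (1,1) - w $$ (0,1) * w $$ (1,0)" if "w \<in> carrier_mat 2 2" for w :: "'a mat"
    using that by (subst laplace_expansion_column[OF that, of 0])
      (auto simp: cofactor_def mat_delete_def numeral_2_eq_2 det_single[where A = "mat _ _ _"] algebra_simps)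
  {
    fix w assume "w \<in> SOminus 1 \<epsilon>"
    hence w: "w \<in> carrier_mat 2 2" "w\<^sup>T * delta_eps \<epsilon> * w = delta_eps \<epsilon>" "det w = 1"
      unfolding SOminus_def Ominus_def Jmat_1 by auto
    define a b c d where abcd: "a = w $$ (0,0)" "b = w $$ (0,1)" "c = w $$ (1,0)" "d = w $$ (1,1)"
    have eqs: "a ^ 2 - \<epsilon> * c ^ 2 = 1" "a * b = \<epsilon> * c * d" "b ^ 2 - \<epsilon> * d ^ 2 = - \<epsilon>" "a * d - b * c = 1"
      using w ex[OF w(1)] d2[OF w(1)] abcd by auto
    \<comment> \<open>Multiply \<open>b\<close> by the determinant 1 and eliminate
      \<open>a b\<close> and \<open>b\<^sup>2\<close> through the orthogonality relations. A similar
      elimination yields \<open>d = a\<close>.\<close>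
    have b: "b = \<epsilon> * c"
    proof -
      have "b * (a * d - b * c) = (a * b) * d - b ^ 2 * c" by (simp add: algebra_simps power2_eq_square)
      also have "b ^ 2 = \<epsilon> * d ^ 2 - \<epsilon>" using eqs(3) by (simp add: algebra_simps)
      also have "a * b * d - (\<epsilon> * d ^ 2 - \<epsilon>) * c = \<epsilon> * c * d * d - (\<epsilon> * d ^ 2 - \<epsilon>) * c" unfolding eqs(2) ..
      also have "\<dots> = \<epsilon> * c" by (simp add: algebra_simps power2_eq_square)
      finally show ?thesis using eqs by simp
    qed
    have "\<epsilon> * d = \<epsilon> * a"
    proof -
      have "\<epsilon> * a = a * (\<epsilon> * d ^ 2) - b * (a * b)" 
      proof -
        have "\<epsilon> * d ^ 2 - b ^ 2 = \<epsilon>" using eqs(3) by (simp add: algebra_simps)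
        hence "\<epsilon> * a = (\<epsilon> * d ^ 2 - b ^ 2) * a" by simp
        thus ?thesis by (simp add: algebra_simps power2_eq_square)
      qed
      also have "\<dots> = \<epsilon> * d * (a * d - b * c)" unfolding eqs(2) by (simp add: algebra_simps power2_eq_square)
      finally show ?thesis using eqs(4) by (simp only: mult_1_right)
    qed
    hence "d = a" using assms by simp
    hence "w = ?f (a, c)"
      using b w(1) abcd by (intro eq_matI) (auto simp: numeral_2_eq_2 less_Suc_eq)
    thus "w \<in> ?f ` ?P" using eqs(1) by blast
  }
  {
    fix w assume "w \<in> ?f ` ?P"
    then obtain x y where w: "w = ?f (x, y)" "x ^ 2 - \<epsilon> * y ^ 2 = 1" by auto
    have c: "w \<in> carrier_mat 2 2" by (simp add: w)
    have "det w = 1" using d2[OF c] w by (simp add: power2_eq_square algebra_simps)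
    moreover have "\<epsilon> * \<epsilon> * y ^ 2 - \<epsilon> * x ^ 2 = - \<epsilon>"
    proof -
      have "\<epsilon> * \<epsilon> * y ^ 2 - \<epsilon> * x ^ 2 = - \<epsilon> * (x ^ 2 - \<epsilon> * y ^ 2)" by (simp add: algebra_simps)
      thus ?thesis using w by simp
    qed
    hence "w\<^sup>T * delta_eps \<epsilon> * w = delta_eps \<epsilon>" using ex[OF c] w by (simp add: power2_eq_square mult_ac)
    ultimately show "w \<in> SOminus 1 \<epsilon>" using c invertible_mat_iff_GL[OF c]
      unfolding SOminus_def Ominus_def Jmat_1 by (simp add: GL_def)
  }
qed

context ternary
begin

text \<open>The nonsplit torus is compared with the split one. Elements of trace \<open>2 x\<close>
  correspond to \<open>y\<close> with \<open>\<epsilon> y\<^sup>2 = x\<^sup>2 - 1\<close>,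
  respectively \<open>z\<close> with \<open>z\<^sup>2 = x\<^sup>2 - 1\<close>; for each
  \<open>x\<close> there are two solutions in total.\<close>

lemma sum_SOminus_1:
  fixes F :: "'a \<Rightarrow> 'b::comm_ring_1"
  assumes "\<epsilon> \<noteq> 0" "\<nexists>b. \<epsilon> = b ^ 2"
  shows "(\<Sum>i\<in>SOminus 1 \<epsilon>. F (mat_tr i)) + (\<Sum>\<alpha>\<in>UNIV - {0}. F (\<alpha> + inverse \<alpha>)) = 2 * (\<Sum>x\<in>UNIV. F x)"
proof -
  let ?f = "\<lambda>(x, y). mat 2 2 (\<lambda>(i, j). if i = j then x else if i = 0 then \<epsilon> * y else y)"
  let ?P = "{(x, y). x ^ 2 - \<epsilon> * y ^ 2 = 1}"
  have inj: "inj_on ?f ?P"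
  proof (rule inj_onI, clarify)
    fix x y x' y' assume eq: "mat 2 2 (\<lambda>(i, j). if i = j then x else if i = 0 then \<epsilon> * y else y)
        = mat 2 2 (\<lambda>(i, j). if i = j then x' else if i = 0 then \<epsilon> * y' else y')"
    show "x = x' \<and> y = y'"
      using arg_cong[OF eq, of "\<lambda>M. M $$ (0, 0)"] arg_cong[OF eq, of "\<lambda>M. M $$ (1, 0)"] by simp
  qed
  have "(\<Sum>i\<in>SOminus 1 \<epsilon>. F (mat_tr i)) = (\<Sum>(x, y)\<in>?P. F (2 * x))"
    unfolding SOminus_1[OF assms(1)] sum.reindex[OF inj]
    by (rule sum.cong) (auto simp: mat_tr_def numeral_2_eq_2)
  also have "\<dots> = (\<Sum>(x, y)\<in>UNIV \<times> UNIV. if \<epsilon> * y ^ 2 = x ^ 2 - 1 then F (2 * x) else 0)"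
    by (rule sum.mono_neutral_cong_left) (auto simp: algebra_simps split: if_splits)
  also have "\<dots> = (\<Sum>x\<in>UNIV. F (2 * x) * (\<Sum>y\<in>UNIV. if \<epsilon> * y ^ 2 = x ^ 2 - 1 then 1 else 0))"
    by (subst sum.cartesian_product[symmetric]) (simp add: sum_distrib_left if_distrib cong: if_cong)
  finally have 1: "(\<Sum>i\<in>SOminus 1 \<epsilon>. F (mat_tr i)) = \<dots>" .
  have "(\<Sum>\<alpha>\<in>UNIV - {0}. F (\<alpha> + inverse \<alpha>)) = (\<Sum>(x, z) | z ^ 2 = x ^ 2 - 1. F (2 * x))"
  \<comment> \<open>Since \<open>(x + z) * (x - z) = 1\<close>, a point of the hyperbola is
    \<open>\<alpha> = x + z\<close> with inverse \<open>x - z\<close>.\<close>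
  proof (rule sum.reindex_bij_witness[of _ "\<lambda>(x, z). x + z" "\<lambda>\<alpha>. ((\<alpha> + inverse \<alpha>) / 2, (\<alpha> - inverse \<alpha>) / 2)"])
    fix \<alpha> :: 'a assume \<alpha>: "\<alpha> \<in> UNIV - {0}"
    show "(\<lambda>(x, z). x + z) ((\<alpha> + inverse \<alpha>) / 2, (\<alpha> - inverse \<alpha>) / 2) = \<alpha>"
      using two_nz by (simp add: field_simps)
    have 4: "(2::'a) * 2 = 4" by simp
    have "(4::'a) \<noteq> 0" unfolding 4[symmetric] mult_eq_0_iff using two_nz by blast
    hence "((\<alpha> - inverse \<alpha>) / 2) ^ 2 = ((\<alpha> + inverse \<alpha>) / 2) ^ 2 - 1"
      using \<alpha> two_nz by (simp add: power2_eq_square field_simps)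
    thus "((\<alpha> + inverse \<alpha>) / 2, (\<alpha> - inverse \<alpha>) / 2) \<in> {(x, z). z ^ 2 = x ^ 2 - 1}" by simp
    have "2 * ((\<alpha> + inverse \<alpha>) / 2) = \<alpha> + inverse \<alpha>" using two_nz by (metis nonzero_mult_div_cancel_left times_divide_eq_right)
    thus "(case ((\<alpha> + inverse \<alpha>) / 2, (\<alpha> - inverse \<alpha>) / 2) of (x, z) \<Rightarrow> F (2 * x)) = F (\<alpha> + inverse \<alpha>)"
      by (simp only: prod.case)
  next
    fix p :: "'a \<times> 'a" assume "p \<in> {(x, z). z ^ 2 = x ^ 2 - 1}"
    then obtain x z where p: "p = (x, z)" "z ^ 2 = x ^ 2 - 1" by auto
    have m: "(x + z) * (x - z) = 1" using p by (simp add: algebra_simps power2_eq_square)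
    hence nz: "x + z \<noteq> 0" and inv: "inverse (x + z) = x - z"
      using inverse_unique[of "x + z" "x - z"] by auto
    show "(case p of (x, z) \<Rightarrow> x + z) \<in> UNIV - {0}" using nz p by simp
    show "(((case p of (x, z) \<Rightarrow> x + z) + inverse (case p of (x, z) \<Rightarrow> x + z)) / 2,
      ((case p of (x, z) \<Rightarrow> x + z) - inverse (case p of (x, z) \<Rightarrow> x + z)) / 2) = p"
      using inv p two_nz by (simp add: field_simps)
  qed
  also have "\<dots> = (\<Sum>(x, z)\<in>UNIV \<times> UNIV. if z ^ 2 = x ^ 2 - 1 then F (2 * x) else 0)"
    by (rule sum.mono_neutral_cong_left) (auto split: if_splits)
  also have "\<dots> = (\<Sum>x\<in>UNIV. F (2 * x) * (\<Sum>z\<in>UNIV. if z ^ 2 = x ^ 2 - 1 then 1 else 0))"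
    by (subst sum.cartesian_product[symmetric]) (simp add: sum_distrib_left if_distrib cong: if_cong)
  finally have 2: "(\<Sum>\<alpha>\<in>UNIV - {0}. F (\<alpha> + inverse \<alpha>)) = \<dots>" .
  have "(\<Sum>z\<in>UNIV. if z ^ 2 = x ^ 2 - 1 then 1 else 0) + (\<Sum>y\<in>UNIV. if \<epsilon> * y ^ 2 = x ^ 2 - 1 then 1 else 0) = (2::'b)" for x
    using sum_squares_nonsquares[OF assms, of "\<lambda>c. if c = x ^ 2 - 1 then 1 else 0"] by simp
  hence "(\<Sum>i\<in>SOminus 1 \<epsilon>. F (mat_tr i)) + (\<Sum>\<alpha>\<in>UNIV - {0}. F (\<alpha> + inverse \<alpha>)) = (\<Sum>x\<in>UNIV. F (2 * x) * 2)"
    unfolding 1 2 sum.distrib[symmetric] distrib_left[symmetric] by (simp add: add.commute)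
  also have "\<dots> = (\<Sum>x\<in>UNIV. F x * 2)"
    by (rule sum.reindex_bij_witness[of _ "\<lambda>x. x / 2" "\<lambda>x. 2 * x"]) (use two_nz in auto)
  finally show ?thesis by (simp only: sum_distrib_right[symmetric] mult.commute)
qed

lemma card_SOminus_1:
  fixes \<epsilon> :: 'a
  assumes "\<epsilon> \<noteq> 0" "\<nexists>b. \<epsilon> = b ^ 2"
  shows "card (SOminus 1 \<epsilon>) = q + 1"
proof -
  have "int (card (SOminus 1 \<epsilon>)) + int (card (UNIV - {0::'a})) = 2 * int q"
    using sum_SOminus_1[OF assms, of "\<lambda>_. 1::int"] by (simp add: card_UNIV)
  thus ?thesis using q_gt_1 by (simp only: card_nonzero)
qed

text \<open>Rescaling \<alpha> by \<open>a\<close> writes the sum through the traces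
  \<open>\<alpha> + inverse \<alpha>\<close> of the split torus.\<close>

lemma kloos_square:
  assumes "a \<noteq> 0"
  shows "kloos s (a ^ 2) = (\<Sum>\<alpha>\<in>UNIV - {0}. \<chi> (a * (\<alpha> + inverse \<alpha>)))"
  unfolding kloos_def
proof (rule sum.reindex_bij_witness[of _ "\<lambda>\<alpha>. a * \<alpha>" "\<lambda>\<alpha>. \<alpha> / a"])
  fix \<alpha> :: 'a assume "\<alpha> \<in> UNIV - {0}"
  hence "a * (\<alpha> / a + inverse (\<alpha> / a)) = \<alpha> + a ^ 2 * inverse \<alpha>"
    using assms by (simp add: distrib_left power2_eq_square field_simps)
  thus "\<chi> (a * (\<alpha> / a + inverse (\<alpha> / a))) = \<chi> (\<alpha> + a ^ 2 * inverse \<alpha>)" by simp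
qed (use assms in auto)

text \<open>The character sums to 0 over the whole field, so the nonsplit torus gives minus the sum
  over the split one.\<close>

lemma sum_lam_SOminus_1:
  assumes "\<epsilon> \<noteq> 0" "\<nexists>b. \<epsilon> = b ^ 2" "a \<noteq> 0"
  shows "(\<Sum>i\<in>SOminus 1 \<epsilon>. \<chi> (a * mat_tr i)) = - kloos s (a ^ 2)"
  using sum_SOminus_1[OF assms(1,2), of "\<lambda>x. \<chi> (a * x)"] assms(3)
  by (simp add: sum_lam kloos_square eq_neg_iff_add_eq_0)

end


subsection \<open>The parabolic subgroup\<close>

definition bsize :: "nat \<Rightarrow> nat \<Rightarrow> nat" where "bsize m p = (if p = 2 then 2 else m)"

text \<open>The offset \<open>p * m\<close> is right for all three blocks: the first two have size
  \<open>m\<close> and the third starts at \<open>2 * m\<close>.\<close>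

definition blk :: "nat \<Rightarrow> 'a mat \<Rightarrow> nat \<Rightarrow> nat \<Rightarrow> 'a mat" where
  "blk m w p r = mat (bsize m p) (bsize m r) (\<lambda>(i, j). w $$ (p * m + i, r * m + j))"

lemma blk_carrier [simp]: "blk m w p r \<in> carrier_mat (bsize m p) (bsize m r)"
  by (simp add: blk_def)

lemma bsize_simps [simp]: "bsize m 0 = m" "bsize m (Suc 0) = m" "bsize m 2 = 2"
  by (auto simp: bsize_def)

lemma all_lt_3: "(\<forall>p<3. P p) \<longleftrightarrow> P 0 \<and> P (Suc 0) \<and> P (2::nat)"
  by (auto simp: numeral_3_eq_3 numeral_2_eq_2 less_Suc_eq)

lemma block_index:
  assumes "i < m + m + 2"
  obtains p i' where "p < 3" "i' < bsize m p" "i = p * m + i'"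
proof -
  consider "i < m" | "m \<le> i" "i < m + m" | "m + m \<le> i" by linarith
  thus ?thesis
  proof cases
    case 1 thus ?thesis using that[of 0 i] by simp
  next
    case 2 thus ?thesis using that[of 1 "i - m"] by simp
  next
    case 3 thus ?thesis using that[of 2 "i - (m + m)"] assms by simp
  qed
qed

lemma block_index_less: "p < 3 \<Longrightarrow> i < bsize m p \<Longrightarrow> p * m + i < m + m + 2"
  by (auto simp: bsize_def numeral_3_eq_3 numeral_2_eq_2 less_Suc_eq split: if_splits)

lemma blk_index: "i < bsize m p \<Longrightarrow> j < bsize m r \<Longrightarrow> blk m w p r $$ (i, j) = w $$ (p * m + i, r * m + j)"
  by (simp add: blk_def)

lemma blk_eqI:
  assumes "w \<in> carrier_mat (m + m + 2) (m + m + 2)" "v \<in> carrier_mat (m + m + 2) (m + m + 2)"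
    "\<forall>p<3. \<forall>r<3. blk m w p r = blk m v p r"
  shows "w = v"
proof (rule eq_matI)
  fix i j assume "i < dim_row v" "j < dim_col v"
  hence "i < m + m + 2" "j < m + m + 2" using assms by auto
  then obtain p i' r j' where "p < 3" "i' < bsize m p" "i = p * m + i'"
    "r < 3" "j' < bsize m r" "j = r * m + j'" by (metis block_index)
  thus "w $$ (i, j) = v $$ (i, j)" using assms(3) blk_index by metis
qed (use assms in auto)

lemma sum_split_blocks:
  "(\<Sum>k<m + m + 2. f k) = (\<Sum>k<m. f k) + (\<Sum>k<m. f (m + k)) + (\<Sum>k<(2::nat). f (2 * m + k) :: 'a::comm_monoid_add)"
proof -
  have "(\<Sum>k<a + b. f k) = (\<Sum>k<a. f k) + (\<Sum>k<b. f (a + k))" for a b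
    by (induction b) (simp_all add: add_ac)
  from this[of "m + m" 2] this[of m m] show ?thesis by (simp add: mult_2)
qed

lemma blk_mult:
  fixes w v :: "'a::comm_ring_1 mat"
  assumes "w \<in> carrier_mat (m + m + 2) (m + m + 2)" "v \<in> carrier_mat (m + m + 2) (m + m + 2)" "p < 3" "r < 3"
  shows "blk m (w * v) p r = blk m w p 0 * blk m v 0 r + blk m w p 1 * blk m v 1 r + blk m w p 2 * blk m v 2 r"
proof (rule eq_matI)
  fix i j
  assume "i < dim_row (blk m w p 0 * blk m v 0 r + blk m w p 1 * blk m v 1 r + blk m w p 2 * blk m v 2 r)"
    "j < dim_col (blk m w p 0 * blk m v 0 r + blk m w p 1 * blk m v 1 r + blk m w p 2 * blk m v 2 r)"
  hence ij: "i < bsize m p" "j < bsize m r" by (auto simp: blk_def)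
  note lt = block_index_less[OF assms(3) ij(1)] block_index_less[OF assms(4) ij(2)]
  have "blk m (w * v) p r $$ (i, j) = (\<Sum>k<m + m + 2. w $$ (p * m + i, k) * v $$ (k, r * m + j))"
    using ij lt assms(1,2) by (simp add: blk_index scalar_prod_def atLeast0LessThan del: sum.lessThan_Suc)
  also have "\<dots> = (\<Sum>k<m. w $$ (p * m + i, k) * v $$ (k, r * m + j))
    + (\<Sum>k<m. w $$ (p * m + i, m + k) * v $$ (m + k, r * m + j))
    + (\<Sum>k<2. w $$ (p * m + i, 2 * m + k) * v $$ (2 * m + k, r * m + j))"
    by (rule sum_split_blocks)
  also have "\<dots> = (blk m w p 0 * blk m v 0 r + blk m w p 1 * blk m v 1 r + blk m w p 2 * blk m v 2 r) $$ (i, j)"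
    using ij by (simp add: blk_def scalar_prod_def atLeast0LessThan)
  finally show "blk m (w * v) p r $$ (i, j)
    = (blk m w p 0 * blk m v 0 r + blk m w p 1 * blk m v 1 r + blk m w p 2 * blk m v 2 r) $$ (i, j)" .
qed (auto simp: blk_def)

lemma blk_transpose:
  assumes "w \<in> carrier_mat (m + m + 2) (m + m + 2)" "p < 3" "r < 3"
  shows "blk m (w\<^sup>T) p r = (blk m w r p)\<^sup>T"
proof (rule eq_matI)
  fix i j assume "i < dim_row ((blk m w r p)\<^sup>T)" "j < dim_col ((blk m w r p)\<^sup>T)"
  hence ij: "i < bsize m p" "j < bsize m r" by (auto simp: blk_def)
  note lt = block_index_less[OF assms(2) ij(1)] block_index_less[OF assms(3) ij(2)]
  show "blk m (w\<^sup>T) p r $$ (i, j) = (blk m w r p)\<^sup>T $$ (i, j)"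
    using ij lt assms(1) by (simp add: blk_def)
qed (auto simp: blk_def)

lemma blocks3_carrier [simp]: "blocks3 a b c L \<in> carrier_mat (a + b + c) (a + b + c)"
  by (simp add: blocks3_def blk3_def)

lemma bidx_block: "p < 3 \<Longrightarrow> i < bsize m p \<Longrightarrow> bidx m m (p * m + i) = (p, i)"
  by (auto simp: bidx_def bsize_def numeral_3_eq_3 numeral_2_eq_2 less_Suc_eq split: if_splits)

lemma blk_blocks3:
  assumes "p < 3" "r < 3" "L ! p ! r \<in> carrier_mat (bsize m p) (bsize m r)"
  shows "blk m (blocks3 m m 2 L) p r = L ! p ! r"
proof (rule eq_matI)
  fix i j assume "i < dim_row (L ! p ! r)" "j < dim_col (L ! p ! r)"
  hence ij: "i < bsize m p" "j < bsize m r" using assms by auto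
  note lt = block_index_less[OF assms(1) ij(1)] block_index_less[OF assms(2) ij(2)]
  show "blk m (blocks3 m m 2 L) p r $$ (i, j) = L ! p ! r $$ (i, j)"
    using ij lt by (simp add: blk_index blocks3_def blk3_def bidx_block[OF assms(1) ij(1)] bidx_block[OF assms(2) ij(2)]
        del: add_2_eq_Suc')
qed (use assms in \<open>auto simp: blk_def\<close>)

lemma delta_eps_carrier [simp]: "delta_eps \<epsilon> \<in> carrier_mat 2 2"
  and delta_eps_dim [simp]: "dim_row (delta_eps \<epsilon>) = 2" "dim_col (delta_eps \<epsilon>) = 2"
  by (simp_all add: delta_eps_def)

lemma transpose_delta_eps [simp]: "(delta_eps \<epsilon>)\<^sup>T = delta_eps \<epsilon>"
  by (rule eq_matI) (auto simp: delta_eps_def)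

lemma blk_Jmat:
  "blk m (Jmat (Suc m) \<epsilon>) 0 0 = 0\<^sub>m m m" "blk m (Jmat (Suc m) \<epsilon>) 0 (Suc 0) = 1\<^sub>m m" "blk m (Jmat (Suc m) \<epsilon>) 0 2 = 0\<^sub>m m 2"
  "blk m (Jmat (Suc m) \<epsilon>) (Suc 0) 0 = 1\<^sub>m m" "blk m (Jmat (Suc m) \<epsilon>) (Suc 0) (Suc 0) = 0\<^sub>m m m" "blk m (Jmat (Suc m) \<epsilon>) (Suc 0) 2 = 0\<^sub>m m 2"
  "blk m (Jmat (Suc m) \<epsilon>) 2 0 = 0\<^sub>m 2 m" "blk m (Jmat (Suc m) \<epsilon>) 2 (Suc 0) = 0\<^sub>m 2 m" "blk m (Jmat (Suc m) \<epsilon>) 2 2 = delta_eps \<epsilon>"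
  by (auto simp: Jmat_def blk_blocks3)

lemma Jmat_carrier: "Jmat (Suc m) \<epsilon> \<in> carrier_mat (m + m + 2) (m + m + 2)"
  unfolding Jmat_def Let_def by (metis blocks3_carrier diff_Suc_1)

text \<open>\<open>J\<close> exchanges the first two block rows and weights the third by \<delta>.
  Preserving the form thus becomes nine block equations, on which both inclusions between
  \<open>Q\<close> and \<open>Qchar\<close> rest.\<close>

lemma blk_form:
  fixes w :: "'a::comm_ring_1 mat"
  assumes w: "w \<in> carrier_mat (m + m + 2) (m + m + 2)" and "p < 3" "r < 3"
  shows "blk m (w\<^sup>T * Jmat (Suc m) \<epsilon> * w) p r
    = (blk m w 1 p)\<^sup>T * blk m w 0 r + (blk m w 0 p)\<^sup>T * blk m w 1 r + (blk m w 2 p)\<^sup>T * delta_eps \<epsilon> * blk m w 2 r"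
proof -
  have wT: "w\<^sup>T \<in> carrier_mat (m + m + 2) (m + m + 2)" using w by simp
  note J = Jmat_carrier[of m \<epsilon>]
  have wJ: "w\<^sup>T * Jmat (Suc m) \<epsilon> \<in> carrier_mat (m + m + 2) (m + m + 2)" using wT J by simp
  have c: "(blk m w k p)\<^sup>T \<in> carrier_mat (bsize m p) (bsize m k)" for k by simp
  have "blk m (w\<^sup>T * Jmat (Suc m) \<epsilon>) p 0 = (blk m w 1 p)\<^sup>T"
    "blk m (w\<^sup>T * Jmat (Suc m) \<epsilon>) p 1 = (blk m w 0 p)\<^sup>T"
    "blk m (w\<^sup>T * Jmat (Suc m) \<epsilon>) p 2 = (blk m w 2 p)\<^sup>T * delta_eps \<epsilon>"
    using c[of 0] c[of "Suc 0"] c[of 2]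
    by (simp_all add: blk_mult[OF wT J assms(2)] blk_transpose[OF w assms(2)] blk_Jmat)
  thus ?thesis by (simp add: blk_mult[OF wJ w assms(2,3)])
qed

text \<open>An intrinsic description of the parabolic subgroup, for which closure under multiplication is evident.\<close>

definition Qchar :: "nat \<Rightarrow> 'a::field \<Rightarrow> 'a mat set" where
  "Qchar m \<epsilon> = {w \<in> carrier_mat (m + m + 2) (m + m + 2). w\<^sup>T * Jmat (Suc m) \<epsilon> * w = Jmat (Suc m) \<epsilon> \<and>
     blk m w 1 0 = 0\<^sub>m m m \<and> blk m w 2 0 = 0\<^sub>m 2 m \<and> blk m w 1 2 = 0\<^sub>m m 2 \<and> det (blk m w 2 2) = 1}"

lemma Qchar_mult:
  assumes "w \<in> Qchar m \<epsilon>" "v \<in> Qchar m \<epsilon>"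
  shows "w * v \<in> Qchar m \<epsilon>"
proof -
  let ?n = "m + m + 2" and ?J = "Jmat (Suc m) \<epsilon>"
  have w: "w \<in> carrier_mat ?n ?n" "w\<^sup>T * ?J * w = ?J" and v: "v \<in> carrier_mat ?n ?n" "v\<^sup>T * ?J * v = ?J"
    using assms by (auto simp: Qchar_def)
  have J: "?J \<in> carrier_mat ?n ?n" by (rule Jmat_carrier)
  have T: "w\<^sup>T \<in> carrier_mat ?n ?n" "v\<^sup>T \<in> carrier_mat ?n ?n" using w v by auto
  note a = assoc_mult_mat[of _ ?n ?n _ ?n _ ?n]
  have "(w * v)\<^sup>T * ?J * (w * v) = v\<^sup>T * (w\<^sup>T * ?J * w) * v"
  proof -
    have "(w * v)\<^sup>T * ?J * (w * v) = v\<^sup>T * w\<^sup>T * ?J * (w * v)" using w v by (simp add: transpose_mult[of _ ?n ?n _ ?n])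
    also have "v\<^sup>T * w\<^sup>T * ?J = v\<^sup>T * (w\<^sup>T * ?J)" by (rule a[OF T(2,1) J])
    also have "v\<^sup>T * (w\<^sup>T * ?J) * (w * v) = v\<^sup>T * ((w\<^sup>T * ?J) * (w * v))" by (rule a) (use T J w v in auto)
    also have "(w\<^sup>T * ?J) * (w * v) = (w\<^sup>T * ?J * w) * v" by (rule a[symmetric]) (use T J w v in auto)
    also have "v\<^sup>T * ((w\<^sup>T * ?J * w) * v) = v\<^sup>T * (w\<^sup>T * ?J * w) * v" by (rule a[symmetric]) (use T J w v in auto)
    finally show ?thesis .
  qed
  also have "\<dots> = ?J" using w v by simp
  finally have form: "(w * v)\<^sup>T * ?J * (w * v) = ?J" .
  have bw: "blk m w 1 0 = 0\<^sub>m m m" "blk m w 2 0 = 0\<^sub>m 2 m" "blk m w 1 2 = 0\<^sub>m m 2" "det (blk m w 2 2) = 1"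
    and bv: "blk m v 1 0 = 0\<^sub>m m m" "blk m v 2 0 = 0\<^sub>m 2 m" "blk m v 1 2 = 0\<^sub>m m 2" "det (blk m v 2 2) = 1"
    using assms by (auto simp: Qchar_def)
  have c: "blk m u 0 0 \<in> carrier_mat m m" "blk m u 1 1 \<in> carrier_mat m m" "blk m u 0 2 \<in> carrier_mat m 2"
    "blk m u 2 1 \<in> carrier_mat 2 m" "blk m u 2 2 \<in> carrier_mat 2 2" for u :: "'a mat"
    using blk_carrier[of m u 0 0] blk_carrier[of m u 1 1] blk_carrier[of m u 0 2] blk_carrier[of m u 2 1] blk_carrier[of m u 2 2]
    by simp_all
  \<comment> \<open>Block (2,0) of \<open>w\<close> and block (1,2) of \<open>v\<close> vanish, so
    block (2,2) is multiplicative.\<close>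
  have "blk m (w * v) 2 2 = blk m w 2 2 * blk m v 2 2"
    using bw bv c[of v] c[of w] by (simp add: blk_mult[OF w(1) v(1)])
  hence "det (blk m (w * v) 2 2) = 1" using bw bv c by (simp add: det_mult[of _ 2])
  moreover have "blk m (w * v) 1 0 = 0\<^sub>m m m" "blk m (w * v) 2 0 = 0\<^sub>m 2 m" "blk m (w * v) 1 2 = 0\<^sub>m m 2"
    using bw bv c[of v] c[of w] by (simp_all add: blk_mult[OF w(1) v(1)])
  ultimately show ?thesis using form w v by (simp add: Qchar_def)
qed

lemma Jmat_GL:
  assumes "\<epsilon> \<noteq> (0::'a::field)"
  shows "Jmat (Suc m) \<epsilon> \<in> GL (m + m + 2)"
proof (rule GL_I[OF Jmat_carrier Jmat_carrier])
  let ?n = "m + m + 2"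
  \<comment> \<open>The inverse has the same shape with \<open>1 / \<epsilon>\<close>: the
    hyperbolic part is an involution, and only \<delta> needs inverting.\<close>
  have d: "delta_eps \<epsilon> * delta_eps (1 / \<epsilon>) = 1\<^sub>m 2"
    by (rule eq_matI) (use assms in \<open>auto simp: delta_eps_def scalar_prod_def numeral_2_eq_2 less_Suc_eq\<close>)
  define n where "n = m + m + 2"
  have b1: "blk m (1\<^sub>m n) p r = (if p = r then 1\<^sub>m (bsize m p) else 0\<^sub>m (bsize m p) (bsize m r))"
    if "p < 3" "r < 3" for p r
  proof (rule eq_matI)
    fix i j assume "i < dim_row (if p = r then 1\<^sub>m (bsize m p) else 0\<^sub>m (bsize m p) (bsize m r))"
      "j < dim_col (if p = r then 1\<^sub>m (bsize m p) else 0\<^sub>m (bsize m p) (bsize m r))"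
    hence ij: "i < bsize m p" "j < bsize m r" by (auto split: if_splits)
    have "p * m + i = r * m + j \<longleftrightarrow> p = r \<and> i = j"
      using bidx_block[OF that(1) ij(1)] bidx_block[OF that(2) ij(2)] by (metis prod.inject)
    thus "blk m (1\<^sub>m n) p r $$ (i, j) = (if p = r then 1\<^sub>m (bsize m p) else 0\<^sub>m (bsize m p) (bsize m r)) $$ (i, j)"
      using ij block_index_less[OF that(1) ij(1), folded n_def] block_index_less[OF that(2) ij(2), folded n_def]
      by (auto simp: blk_index)
  qed (auto simp: blk_def)
  have "Jmat (Suc m) \<epsilon> * Jmat (Suc m) (1 / \<epsilon>) = 1\<^sub>m n"
  proof (rule blk_eqI)
    have "blk m (Jmat (Suc m) \<epsilon> * Jmat (Suc m) (1 / \<epsilon>)) p r = blk m (1\<^sub>m n) p r" if "p \<in> {0, Suc 0, 2}" "r \<in> {0, Suc 0, 2}" for p r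
      using that by (elim insertE emptyE) (simp_all add: blk_mult[OF Jmat_carrier Jmat_carrier] blk_Jmat b1 d)
    thus "\<forall>p<3. \<forall>r<3. blk m (Jmat (Suc m) \<epsilon> * Jmat (Suc m) (1 / \<epsilon>)) p r = blk m (1\<^sub>m n) p r"
      unfolding all_lt_3 by simp
  qed (rule mult_carrier_mat[OF Jmat_carrier Jmat_carrier], simp add: n_def)
  thus "Jmat (Suc m) \<epsilon> * Jmat (Suc m) (1 / \<epsilon>) = 1\<^sub>m (m + m + 2)" unfolding n_def .
qed

text \<open>An isometry of a nondegenerate form is invertible.\<close>

lemma Qchar_GL:
  assumes "\<epsilon> \<noteq> 0"
  shows "Qchar m \<epsilon> \<subseteq> GL (m + m + 2)"
proof
  fix w assume "w \<in> Qchar m \<epsilon>"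
  hence w: "w \<in> carrier_mat (m + m + 2) (m + m + 2)" "w\<^sup>T * Jmat (Suc m) \<epsilon> * w = Jmat (Suc m) \<epsilon>"
    by (auto simp: Qchar_def)
  have "det (w\<^sup>T * Jmat (Suc m) \<epsilon> * w) = det (w\<^sup>T * Jmat (Suc m) \<epsilon>) * det w"
    by (rule det_mult[OF mult_carrier_mat[OF _ Jmat_carrier] w(1)]) (use w in simp)
  hence "det w \<noteq> 0" using w Jmat_GL[OF assms, of m] by (auto simp: GL_def)
  thus "w \<in> GL (m + m + 2)" using w by (simp add: GL_def)
qed

definition qmat :: "nat \<Rightarrow> 'a::field \<Rightarrow> 'a mat \<Rightarrow> 'a mat \<Rightarrow> 'a mat \<Rightarrow> 'a mat \<Rightarrow> 'a mat" where
  "qmat m \<epsilon> A B h i = blocks3 m m 2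
        [[A, 0\<^sub>m m m, 0\<^sub>m m 2],
         [0\<^sub>m m m, transpose_mat (mat_inv m A), 0\<^sub>m m 2],
         [0\<^sub>m 2 m, 0\<^sub>m 2 m, i]]
      * blocks3 m m 2
        [[1\<^sub>m m, B, - (transpose_mat h * delta_eps \<epsilon>)],
         [0\<^sub>m m m, 1\<^sub>m m, 0\<^sub>m m 2],
         [0\<^sub>m 2 m, h, 1\<^sub>m 2]]"

lemma Qgrp_qmat:
  "Qgrp (Suc m) \<epsilon> = {qmat m \<epsilon> A B h i | A B h i. A \<in> GL m \<and> i \<in> SOminus 1 \<epsilon> \<and>
     B \<in> carrier_mat m m \<and> h \<in> carrier_mat 2 m \<and>
     transpose_mat B + B + transpose_mat h * delta_eps \<epsilon> * h = 0\<^sub>m m m}"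
proof -
  have "A \<in> carrier_mat m m \<and> invertible_mat A \<longleftrightarrow> A \<in> GL m" for A :: "'a mat"
    using invertible_mat_iff_GL GL_carrier by blast
  thus ?thesis unfolding Qgrp_def qmat_def Let_def diff_Suc_1 by (simp only: conj_assoc[symmetric])
qed

lemma mat_inv:
  fixes A :: "'a::field mat"
  assumes "A \<in> GL m"
  shows "mat_inv m A \<in> GL m" "A * mat_inv m A = 1\<^sub>m m" "mat_inv m A * A = 1\<^sub>m m"
proof -
  obtain B where B: "B \<in> GL m" "A * B = 1\<^sub>m m" "B * A = 1\<^sub>m m" using GL_inverse[OF assms] by blast
  have "mat_inv m A = B" unfolding mat_inv_def
  proof (rule the_equality)
    show "B \<in> carrier_mat m m \<and> A * B = 1\<^sub>m m" using B GL_carrier by blast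
    fix C assume "C \<in> carrier_mat m m \<and> A * C = 1\<^sub>m m"
    thus "C = B" using GL_left_cancel[OF assms, of C m B] B GL_carrier by auto
  qed
  thus "mat_inv m A \<in> GL m" "A * mat_inv m A = 1\<^sub>m m" "mat_inv m A * A = 1\<^sub>m m" using B by auto
qed

lemma mat_inv_unique:
  fixes A :: "'a::field mat"
  assumes "A \<in> carrier_mat m m" "B \<in> carrier_mat m m" "A * B = 1\<^sub>m m"
  shows "mat_inv m A = B"
proof -
  have A: "A \<in> GL m" by (rule GL_I[OF assms])
  show ?thesis using GL_left_cancel[OF A, of "mat_inv m A" m B] mat_inv[OF A] assms GL_carrier by auto
qed

lemma blk_qmat:
  assumes "A \<in> GL m" "B \<in> carrier_mat m m" "h \<in> carrier_mat 2 m" "i \<in> carrier_mat 2 2"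
  shows "qmat m \<epsilon> A B h i \<in> carrier_mat (m + m + 2) (m + m + 2)"
    "blk m (qmat m \<epsilon> A B h i) 0 0 = A" "blk m (qmat m \<epsilon> A B h i) 0 (Suc 0) = A * B"
    "blk m (qmat m \<epsilon> A B h i) 0 2 = - (A * (h\<^sup>T * delta_eps \<epsilon>))"
    "blk m (qmat m \<epsilon> A B h i) (Suc 0) 0 = 0\<^sub>m m m" "blk m (qmat m \<epsilon> A B h i) (Suc 0) (Suc 0) = (mat_inv m A)\<^sup>T"
    "blk m (qmat m \<epsilon> A B h i) (Suc 0) 2 = 0\<^sub>m m 2"
    "blk m (qmat m \<epsilon> A B h i) 2 0 = 0\<^sub>m 2 m" "blk m (qmat m \<epsilon> A B h i) 2 (Suc 0) = i * h"
    "blk m (qmat m \<epsilon> A B h i) 2 2 = i"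
proof -
  have A: "A \<in> carrier_mat m m" "mat_inv m A \<in> carrier_mat m m"
    using assms(1) mat_inv(1)[OF assms(1)] GL_carrier by auto
  have hd: "- (h\<^sup>T * delta_eps \<epsilon>) \<in> carrier_mat m 2" using assms by auto
  have e: "A * - (h\<^sup>T * delta_eps \<epsilon>) = - (A * (h\<^sup>T * delta_eps \<epsilon>))" "- (A * (h\<^sup>T * delta_eps \<epsilon>)) \<in> carrier_mat m 2"
    using A assms by (auto simp: uminus_mult_right_mat)
  have z: "0\<^sub>m m m * - (h\<^sup>T * delta_eps \<epsilon>) = 0\<^sub>m m 2" "0\<^sub>m 2 m * - (h\<^sup>T * delta_eps \<epsilon>) = 0\<^sub>m 2 2"
    using hd left_mult_zero_mat[of _ m 2] by auto
  show "qmat m \<epsilon> A B h i \<in> carrier_mat (m + m + 2) (m + m + 2)"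
    unfolding qmat_def by (rule mult_carrier_mat[OF blocks3_carrier blocks3_carrier])
  show "blk m (qmat m \<epsilon> A B h i) 0 0 = A" "blk m (qmat m \<epsilon> A B h i) 0 (Suc 0) = A * B"
    "blk m (qmat m \<epsilon> A B h i) 0 2 = - (A * (h\<^sup>T * delta_eps \<epsilon>))"
    "blk m (qmat m \<epsilon> A B h i) (Suc 0) 0 = 0\<^sub>m m m" "blk m (qmat m \<epsilon> A B h i) (Suc 0) (Suc 0) = (mat_inv m A)\<^sup>T"
    "blk m (qmat m \<epsilon> A B h i) (Suc 0) 2 = 0\<^sub>m m 2"
    "blk m (qmat m \<epsilon> A B h i) 2 0 = 0\<^sub>m 2 m" "blk m (qmat m \<epsilon> A B h i) 2 (Suc 0) = i * h"
    "blk m (qmat m \<epsilon> A B h i) 2 2 = i"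
    unfolding qmat_def using A assms hd e z
    by (simp_all add: blk_mult[OF blocks3_carrier blocks3_carrier] blk_blocks3 del: uminus_mult_right_mat)
qed


lemma SOminus_1_iff:
  "i \<in> SOminus 1 \<epsilon> \<longleftrightarrow> i \<in> carrier_mat 2 2 \<and> i\<^sup>T * delta_eps \<epsilon> * i = delta_eps \<epsilon> \<and> det i = (1::'a::field)"
  using invertible_mat_iff_GL[of i 2]
  unfolding SOminus_def Ominus_def Jmat_1 by (auto simp: GL_def)

text \<open>Of the nine block equations, (0,1) holds because \<open>mat_inv\<close> inverts
  \<open>A\<close>, (1,2) by the choice of the entry \<open>- h\<^sup>T \<delta>\<close>, (1,1) is
  the condition on \<open>B\<close>, and (2,2) is orthogonality of \<open>i\<close>.\<close>

lemma qmat_in_Qchar: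
  fixes \<epsilon> :: "'a::field"
  assumes A: "A \<in> GL m" and B: "B \<in> carrier_mat m m" and h: "h \<in> carrier_mat 2 m" and i: "i \<in> SOminus 1 \<epsilon>"
    and BB: "B\<^sup>T + B + h\<^sup>T * delta_eps \<epsilon> * h = 0\<^sub>m m m"
  shows "qmat m \<epsilon> A B h i \<in> Qchar m \<epsilon>"
proof -
  let ?w = "qmat m \<epsilon> A B h i" and ?d = "delta_eps \<epsilon>" and ?E = "mat_inv m A"
  have i2: "i \<in> carrier_mat 2 2" "i\<^sup>T * ?d * i = ?d" "det i = 1" using i unfolding SOminus_1_iff by auto
  note b = blk_qmat[OF A B h i2(1), of \<epsilon>]
  have Ac: "A \<in> carrier_mat m m" "?E \<in> carrier_mat m m" using A mat_inv(1)[OF A] GL_carrier by auto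
  have AE: "A\<^sup>T * ?E\<^sup>T = 1\<^sub>m m"
    using transpose_mult[OF Ac(2) Ac(1)] mat_inv(3)[OF A] by simp
  have EA: "?E * (A * X) = X" if "X \<in> carrier_mat m k" for X k
    using assoc_mult_mat[OF Ac(2,1) that] mat_inv(3)[OF A] that by simp
  have d2: "?d \<in> carrier_mat 2 2" by simp
  have iT: "i\<^sup>T \<in> carrier_mat 2 2" and hT: "h\<^sup>T \<in> carrier_mat m 2" using i2 h by auto
  have di: "i\<^sup>T * (?d * i) = ?d" using i2 assoc_mult_mat[OF iT d2 i2(1)] by simp
  have ihT: "(i * h)\<^sup>T = h\<^sup>T * i\<^sup>T" using transpose_mult[OF i2(1) h] .
  have f00: "blk m (?w\<^sup>T * Jmat (Suc m) \<epsilon> * ?w) p r = blk m (Jmat (Suc m) \<epsilon>) p r"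
    if "p \<in> {0, Suc 0, 2}" "r \<in> {0, Suc 0, 2}" for p r
  proof -
    have p3: "p < 3" "r < 3" using that by auto
    note F = blk_form[OF b(1) p3, of \<epsilon>]
    have g1: "(i * h)\<^sup>T * ?d * i = h\<^sup>T * ?d"
    proof -
      have "(i * h)\<^sup>T * ?d * i = h\<^sup>T * (i\<^sup>T * (?d * i))"
        unfolding ihT using h i2 iT hT d2 by (simp add: assoc_mult_mat[of _ m 2 _ 2 _ 2] assoc_mult_mat[of _ 2 2 _ 2 _ 2])
      thus ?thesis using di by simp
    qed
    have g2: "(i * h)\<^sup>T * ?d * (i * h) = h\<^sup>T * ?d * h"
    proof -
      have "(i * h)\<^sup>T * ?d * (i * h) = (i * h)\<^sup>T * ?d * i * h"
        by (rule assoc_mult_mat[symmetric, of _ m 2 _ 2 _ m]) (use h i2 in auto)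
      thus ?thesis using g1 by simp
    qed
    have g3: "(A * B)\<^sup>T * ?E\<^sup>T = B\<^sup>T"
    proof -
      have "(A * B)\<^sup>T * ?E\<^sup>T = B\<^sup>T * (A\<^sup>T * ?E\<^sup>T)"
        using Ac B by (simp add: transpose_mult[OF Ac(1) B] assoc_mult_mat[of _ m m _ m _ m])
      thus ?thesis using AE B by simp
    qed
    have g4: "(- (A * (h\<^sup>T * ?d)))\<^sup>T * ?E\<^sup>T = - (?d * h)"
    proof -
      have "(A * (h\<^sup>T * ?d))\<^sup>T = (?d * h) * A\<^sup>T"
        using Ac h d2 by (simp add: transpose_mult[of A m m _ 2] transpose_mult[of "h\<^sup>T" m 2 _ 2])
      moreover have "((?d * h) * A\<^sup>T) * ?E\<^sup>T = (?d * h) * (A\<^sup>T * ?E\<^sup>T)"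
        by (rule assoc_mult_mat[of _ 2 m _ m _ m]) (use Ac h in auto)
      ultimately have "(A * (h\<^sup>T * ?d))\<^sup>T * ?E\<^sup>T = ?d * h" using AE h by simp
      thus ?thesis using Ac h by (simp add: transpose_uminus uminus_mult_left_mat)
    qed
    have g5: "i\<^sup>T * ?d * (i * h) = ?d * h"
    proof -
      have "i\<^sup>T * ?d * (i * h) = i\<^sup>T * ?d * i * h"
        by (rule assoc_mult_mat[symmetric, of _ 2 2 _ 2 _ m]) (use h i2 in auto)
      thus ?thesis using i2 by simp
    qed
    have hd: "h\<^sup>T * ?d \<in> carrier_mat m 2" using h by auto
    have g6: "?E * - (A * (h\<^sup>T * ?d)) = - (h\<^sup>T * ?d)"
      using EA[OF hd] Ac h by (simp add: uminus_mult_right_mat)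
    have bf: "(blk m ?w 1 0)\<^sup>T * blk m ?w 0 0 + (blk m ?w 0 0)\<^sup>T * blk m ?w 1 0 + (blk m ?w 2 0)\<^sup>T * ?d * blk m ?w 2 0 = 0\<^sub>m m m"
      "(blk m ?w 1 0)\<^sup>T * blk m ?w 0 1 + (blk m ?w 0 0)\<^sup>T * blk m ?w 1 1 + (blk m ?w 2 0)\<^sup>T * ?d * blk m ?w 2 1 = 1\<^sub>m m"
      "(blk m ?w 1 0)\<^sup>T * blk m ?w 0 2 + (blk m ?w 0 0)\<^sup>T * blk m ?w 1 2 + (blk m ?w 2 0)\<^sup>T * ?d * blk m ?w 2 2 = 0\<^sub>m m 2"
      "(blk m ?w 1 1)\<^sup>T * blk m ?w 0 0 + (blk m ?w 0 1)\<^sup>T * blk m ?w 1 0 + (blk m ?w 2 1)\<^sup>T * ?d * blk m ?w 2 0 = 1\<^sub>m m"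
      "(blk m ?w 1 1)\<^sup>T * blk m ?w 0 1 + (blk m ?w 0 1)\<^sup>T * blk m ?w 1 1 + (blk m ?w 2 1)\<^sup>T * ?d * blk m ?w 2 1 = 0\<^sub>m m m"
      "(blk m ?w 1 1)\<^sup>T * blk m ?w 0 2 + (blk m ?w 0 1)\<^sup>T * blk m ?w 1 2 + (blk m ?w 2 1)\<^sup>T * ?d * blk m ?w 2 2 = 0\<^sub>m m 2"
      "(blk m ?w 1 2)\<^sup>T * blk m ?w 0 0 + (blk m ?w 0 2)\<^sup>T * blk m ?w 1 0 + (blk m ?w 2 2)\<^sup>T * ?d * blk m ?w 2 0 = 0\<^sub>m 2 m"
      "(blk m ?w 1 2)\<^sup>T * blk m ?w 0 1 + (blk m ?w 0 2)\<^sup>T * blk m ?w 1 1 + (blk m ?w 2 2)\<^sup>T * ?d * blk m ?w 2 1 = 0\<^sub>m 2 m"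
      "(blk m ?w 1 2)\<^sup>T * blk m ?w 0 2 + (blk m ?w 0 2)\<^sup>T * blk m ?w 1 2 + (blk m ?w 2 2)\<^sup>T * ?d * blk m ?w 2 2 = ?d"
    proof -
      have c: "A * B \<in> carrier_mat m m" "i * h \<in> carrier_mat 2 m" "A * (h\<^sup>T * ?d) \<in> carrier_mat m 2"
        "(A * B)\<^sup>T \<in> carrier_mat m m" "(i * h)\<^sup>T * ?d \<in> carrier_mat m 2" "(- (A * (h\<^sup>T * ?d)))\<^sup>T \<in> carrier_mat 2 m"
        "i\<^sup>T * ?d \<in> carrier_mat 2 2"
        using Ac B h i2 by auto
      note bb = b(2-) One_nat_def
      show "(blk m ?w 1 0)\<^sup>T * blk m ?w 0 0 + (blk m ?w 0 0)\<^sup>T * blk m ?w 1 0 + (blk m ?w 2 0)\<^sup>T * ?d * blk m ?w 2 0 = 0\<^sub>m m m"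
        unfolding bb using Ac by simp
      show "(blk m ?w 1 0)\<^sup>T * blk m ?w 0 1 + (blk m ?w 0 0)\<^sup>T * blk m ?w 1 1 + (blk m ?w 2 0)\<^sup>T * ?d * blk m ?w 2 1 = 1\<^sub>m m"
        unfolding bb AE using Ac c B left_mult_zero_mat[OF c(2), of m] by simp
      show "(blk m ?w 1 0)\<^sup>T * blk m ?w 0 2 + (blk m ?w 0 0)\<^sup>T * blk m ?w 1 2 + (blk m ?w 2 0)\<^sup>T * ?d * blk m ?w 2 2 = 0\<^sub>m m 2"
        unfolding bb using Ac c i2 left_mult_zero_mat[of "- (A * (h\<^sup>T * ?d))" m 2 m] by simp
      show "(blk m ?w 1 1)\<^sup>T * blk m ?w 0 0 + (blk m ?w 0 1)\<^sup>T * blk m ?w 1 0 + (blk m ?w 2 1)\<^sup>T * ?d * blk m ?w 2 0 = 1\<^sub>m m"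
        unfolding bb transpose_transpose mat_inv(3)[OF A]
        using c right_mult_zero_mat[OF c(4), of m] right_mult_zero_mat[OF c(5), of m] by simp
      show "(blk m ?w 1 1)\<^sup>T * blk m ?w 0 1 + (blk m ?w 0 1)\<^sup>T * blk m ?w 1 1 + (blk m ?w 2 1)\<^sup>T * ?d * blk m ?w 2 1 = 0\<^sub>m m m"
        unfolding bb transpose_transpose EA[OF B] g2 g3 using BB comm_add_mat[of B m m "B\<^sup>T"] B by simp
      show "(blk m ?w 1 1)\<^sup>T * blk m ?w 0 2 + (blk m ?w 0 1)\<^sup>T * blk m ?w 1 2 + (blk m ?w 2 1)\<^sup>T * ?d * blk m ?w 2 2 = 0\<^sub>m m 2"
        unfolding bb transpose_transpose g6 g1 right_mult_zero_mat[OF c(4), of 2] using hd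
        by (simp add: uminus_l_inv_mat[of _ m 2])
      show "(blk m ?w 1 2)\<^sup>T * blk m ?w 0 0 + (blk m ?w 0 2)\<^sup>T * blk m ?w 1 0 + (blk m ?w 2 2)\<^sup>T * ?d * blk m ?w 2 0 = 0\<^sub>m 2 m"
        unfolding bb right_mult_zero_mat[OF c(6), of m] right_mult_zero_mat[OF c(7), of m] using Ac by simp
      show "(blk m ?w 1 2)\<^sup>T * blk m ?w 0 1 + (blk m ?w 0 2)\<^sup>T * blk m ?w 1 1 + (blk m ?w 2 2)\<^sup>T * ?d * blk m ?w 2 1 = 0\<^sub>m 2 m"
      proof -
        have "0\<^sub>m 2 m + - X + X = 0\<^sub>m 2 m" if "X \<in> carrier_mat 2 m" for X :: "'a mat"
          by (rule eq_matI) (use that in auto)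
        moreover have "?d * h \<in> carrier_mat 2 m" using h by (intro mult_carrier_mat[OF d2])
        ultimately have z: "0\<^sub>m 2 m + - (?d * h) + ?d * h = 0\<^sub>m 2 m" by blast
        have t: "(0\<^sub>m m 2)\<^sup>T * (A * B) = (0\<^sub>m 2 m :: 'a mat)" using Ac B by simp
        show ?thesis unfolding bb g4 g5 t by (rule z)
      qed
      show "(blk m ?w 1 2)\<^sup>T * blk m ?w 0 2 + (blk m ?w 0 2)\<^sup>T * blk m ?w 1 2 + (blk m ?w 2 2)\<^sup>T * ?d * blk m ?w 2 2 = ?d"
        unfolding bb right_mult_zero_mat[OF c(6), of 2] i2(2) using c left_mult_zero_mat[of "- (A * (h\<^sup>T * ?d))" m 2 2] by simp
    qed
    from that show ?thesis unfolding F
      using bf by (elim insertE emptyE) (simp_all only: One_nat_def blk_Jmat)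
  qed
  have "?w\<^sup>T * Jmat (Suc m) \<epsilon> * ?w = Jmat (Suc m) \<epsilon>"
  proof (rule blk_eqI)
    show "\<forall>p<3. \<forall>r<3. blk m (?w\<^sup>T * Jmat (Suc m) \<epsilon> * ?w) p r = blk m (Jmat (Suc m) \<epsilon>) p r"
      unfolding all_lt_3 using f00 by simp
    show "?w\<^sup>T * Jmat (Suc m) \<epsilon> * ?w \<in> carrier_mat (m + m + 2) (m + m + 2)"
      by (rule mult_carrier_mat[OF mult_carrier_mat[OF _ Jmat_carrier] b(1)]) (use b(1) in simp)
  qed (rule Jmat_carrier)
  thus ?thesis using b i2(3) unfolding Qchar_def by simp
qed

text \<open>The block equations read backwards: (0,1) makes \<open>E\<^sup>T\<close> the inverse of
  \<open>A\<close>, (2,2) puts \<open>i\<close> into the orthogonal group, (1,1) yields the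
  condition on \<open>B\<close>, and (1,2) determines the remaining block \<open>Y\<close>.\<close>

lemma Qchar_imp_qmat:
  fixes \<epsilon> :: "'a::field"
  assumes w: "w \<in> Qchar m \<epsilon>"
  obtains A B h i where "A \<in> GL m" "B \<in> carrier_mat m m" "h \<in> carrier_mat 2 m" "i \<in> SOminus 1 \<epsilon>"
    "B\<^sup>T + B + h\<^sup>T * delta_eps \<epsilon> * h = 0\<^sub>m m m" "w = qmat m \<epsilon> A B h i"
proof -
  let ?d = "delta_eps \<epsilon>"
  have wc: "w \<in> carrier_mat (m + m + 2) (m + m + 2)" and wf: "w\<^sup>T * Jmat (Suc m) \<epsilon> * w = Jmat (Suc m) \<epsilon>"
    and w0: "blk m w 1 0 = 0\<^sub>m m m" "blk m w 2 0 = 0\<^sub>m 2 m" "blk m w 1 2 = 0\<^sub>m m 2" "det (blk m w 2 2) = 1"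
    using w by (auto simp: Qchar_def)
  define A X Y E Z i where defs: "A = blk m w 0 0" "X = blk m w 0 1" "Y = blk m w 0 2" "E = blk m w 1 1"
    "Z = blk m w 2 1" "i = blk m w 2 2"
  have c: "A \<in> carrier_mat m m" "X \<in> carrier_mat m m" "Y \<in> carrier_mat m 2" "E \<in> carrier_mat m m"
    "Z \<in> carrier_mat 2 m" "i \<in> carrier_mat 2 2"
    unfolding defs using blk_carrier[of m w 0 0] blk_carrier[of m w 0 1] blk_carrier[of m w 0 2]
      blk_carrier[of m w 1 1] blk_carrier[of m w 2 1] blk_carrier[of m w 2 2] by simp_all
  note defs1 = defs[unfolded One_nat_def]
  note F = blk_form[OF wc, of _ _ \<epsilon>, unfolded wf]
  have d2: "?d \<in> carrier_mat 2 2" by simp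
  have e01: "A\<^sup>T * E = 1\<^sub>m m"
    using F[of 0 1] c w0[unfolded One_nat_def] unfolding One_nat_def defs1[symmetric] blk_Jmat by simp
  have e11: "E\<^sup>T * X + X\<^sup>T * E + Z\<^sup>T * ?d * Z = 0\<^sub>m m m"
    using F[of 1 1] unfolding One_nat_def defs1[symmetric] blk_Jmat by simp
  have e12: "E\<^sup>T * Y + Z\<^sup>T * ?d * i = 0\<^sub>m m 2"
    using F[of 1 2] w0[unfolded One_nat_def] c unfolding One_nat_def defs1[symmetric] blk_Jmat by simp
  have id: "i\<^sup>T * ?d * i \<in> carrier_mat 2 2" using c by auto
  have e22: "i\<^sup>T * ?d * i = ?d"
    using id F[of 2 2] w0[unfolded One_nat_def] c unfolding One_nat_def defs1[symmetric] blk_Jmat by simp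
  have iSO: "i \<in> SOminus 1 \<epsilon>" using c(6) e22 w0(4) unfolding SOminus_1_iff defs by simp
  have "i \<in> GL 2" using c(6) w0(4) unfolding GL_def defs by simp
  then obtain k where k: "k \<in> carrier_mat 2 2" "i * k = 1\<^sub>m 2" "k * i = 1\<^sub>m 2"
    using GL_inverse GL_carrier by metis
  have EA: "E\<^sup>T * A = 1\<^sub>m m"
    using arg_cong[OF e01, of transpose_mat] c by (simp add: transpose_mult[of _ m m _ m])
  have AE: "A * E\<^sup>T = 1\<^sub>m m" using mat_mult_left_right_inverse[of "E\<^sup>T" m A] EA c by simp
  have AGL: "A \<in> GL m" by (rule GL_I[of A m "E\<^sup>T"]) (use c AE in auto)
  have inv: "mat_inv m A = E\<^sup>T" by (rule mat_inv_unique) (use c AE in auto)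
  \<comment> \<open>As \<open>k\<close> inverts \<open>i\<close> and \<open>E\<^sup>T\<close>
    inverts \<open>A\<close>, these choices solve \<open>i * h = Z\<close> and
    \<open>A * B = X\<close>.\<close>
  define h where "h = k * Z"
  define B where "B = E\<^sup>T * X"
  have h: "h \<in> carrier_mat 2 m" and B: "B \<in> carrier_mat m m" using k c by (auto simp: h_def B_def)
  have ih: "i * h = Z" unfolding h_def using k c assoc_mult_mat[OF c(6) k(1) c(5)] by simp
  have AB: "A * B = X" unfolding B_def using c AE assoc_mult_mat[OF c(1) _ c(2), of "E\<^sup>T"] by simp
  have ZT: "Z\<^sup>T * ?d * i = h\<^sup>T * ?d"
  proof -
    have "Z\<^sup>T * ?d * i = h\<^sup>T * i\<^sup>T * ?d * i"
      unfolding ih[symmetric] by (subst transpose_mult[OF c(6) h]) simp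
    also have "h\<^sup>T * i\<^sup>T * ?d = h\<^sup>T * (i\<^sup>T * ?d)"
      by (rule assoc_mult_mat[of _ m 2 _ 2 _ 2]) (use h c in auto)
    also have "h\<^sup>T * (i\<^sup>T * ?d) * i = h\<^sup>T * (i\<^sup>T * ?d * i)"
      by (rule assoc_mult_mat[of _ m 2 _ 2 _ 2]) (use h c in auto)
    finally show ?thesis using e22 by simp
  qed
  have ZdZ: "Z\<^sup>T * ?d * Z = h\<^sup>T * ?d * h"
  proof -
    have "Z\<^sup>T * ?d * Z = Z\<^sup>T * ?d * i * h"
      using assoc_mult_mat[of "Z\<^sup>T * ?d" m 2 i 2 h m] c h ih by simp
    thus ?thesis using ZT by simp
  qed
  have "X\<^sup>T * E = B\<^sup>T" unfolding B_def using c by (simp add: transpose_mult[of _ m m _ m])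
  hence BB: "B\<^sup>T + B + h\<^sup>T * ?d * h = 0\<^sub>m m m"
    using e11 ZdZ comm_add_mat[of B m m "B\<^sup>T"] B by (simp add: B_def[symmetric])
  have hd: "h\<^sup>T * ?d \<in> carrier_mat m 2" using h by auto
  have Y: "Y = - (A * (h\<^sup>T * ?d))"
  proof -
    have "E\<^sup>T * Y = - (h\<^sup>T * ?d)"
    proof (rule eq_matI)
      fix a b assume "a < dim_row (- (h\<^sup>T * ?d))" "b < dim_col (- (h\<^sup>T * ?d))"
      hence ab: "a < m" "b < 2" using hd by auto
      have "(E\<^sup>T * Y + h\<^sup>T * ?d) $$ (a, b) = 0" using e12 ab unfolding ZT by simp
      hence "(E\<^sup>T * Y) $$ (a, b) + (h\<^sup>T * ?d) $$ (a, b) = 0"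
        using ab hd by (subst (asm) index_add_mat) auto
      thus "(E\<^sup>T * Y) $$ (a, b) = (- (h\<^sup>T * ?d)) $$ (a, b)"
        using ab hd by (subst index_uminus_mat) (auto simp: eq_neg_iff_add_eq_0)
    qed (use c hd in auto)
    hence "A * (E\<^sup>T * Y) = A * - (h\<^sup>T * ?d)" by simp
    thus ?thesis using c AE hd h assoc_mult_mat[OF c(1) _ c(3), of "E\<^sup>T"] by (simp add: uminus_mult_right_mat)
  qed
  note b = blk_qmat[OF AGL B h c(6), of \<epsilon>]
  have "w = qmat m \<epsilon> A B h i"
  proof (rule blk_eqI[OF wc b(1)])
    show "\<forall>p<3. \<forall>r<3. blk m w p r = blk m (qmat m \<epsilon> A B h i) p r"
      unfolding all_lt_3 b AB ih inv transpose_transpose Y[symmetric] using w0 by (simp add: defs)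
  qed
  with that AGL B h iSO BB show ?thesis by blast
qed

lemma Qgrp_eq_Qchar: "Qgrp (Suc m) \<epsilon> = Qchar m \<epsilon>"
  unfolding Qgrp_qmat
proof (intro equalityI subsetI)
  fix w assume "w \<in> Qchar m \<epsilon>"
  thus "w \<in> {qmat m \<epsilon> A B h i | A B h i. A \<in> GL m \<and> i \<in> SOminus 1 \<epsilon> \<and>
     B \<in> carrier_mat m m \<and> h \<in> carrier_mat 2 m \<and>
     transpose_mat B + B + transpose_mat h * delta_eps \<epsilon> * h = 0\<^sub>m m m}"
    by (rule Qchar_imp_qmat) blast
qed (use qmat_in_Qchar in blast)


subsection \<open>Double cosets\<close>

text \<open>Left multiplication by \<open>w\<close> is injective on the finite set \<open>G\<close>,
  hence onto; this yields the identity and then an inverse inside \<open>G\<close>, so elements of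
  \<open>Q\<close> never have to be inverted explicitly.\<close>

lemma finite_mult_closed_inverse:
  fixes G :: "'a::field mat set"
  assumes fin: "finite G" and sub: "G \<subseteq> GL n" and closed: "\<And>x y. x \<in> G \<Longrightarrow> y \<in> G \<Longrightarrow> x * y \<in> G"
    and w: "w \<in> G"
  obtains v where "v \<in> G" "w * v = 1\<^sub>m n" "v * w = 1\<^sub>m n"
proof -
  have c: "x \<in> carrier_mat n n" if "x \<in> G" for x using sub that GL_carrier by blast
  have "inj_on (\<lambda>x. w * x) G"
    using GL_left_cancel[of w n _ n] sub w c by (intro inj_onI) blast
  moreover have "(\<lambda>x. w * x) ` G \<subseteq> G" using closed w by auto
  ultimately have surj: "(\<lambda>x. w * x) ` G = G" using fin by (simp add: endo_inj_surj)
  obtain e where e: "e \<in> G" "w = w * e" using surj w by blast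
  have "w * e = w * 1\<^sub>m n" using e(2)[symmetric] c[OF w] by simp
  moreover have "w \<in> GL n" using sub w by blast
  ultimately have "e = 1\<^sub>m n" using GL_left_cancel[OF _ c[OF e(1)] one_carrier_mat] by blast
  then obtain v where v: "v \<in> G" "1\<^sub>m n = w * v" using surj e by blast
  have "v * w = 1\<^sub>m n" using mat_mult_left_right_inverse[OF c[OF w] c[OF v(1)]] v by simp
  with v that show ?thesis by simp
qed

text \<open>Every fibre of \<open>(x, y) \<mapsto> x \<sigma> y\<close> has as many elements as \<open>G \<inter> \<sigma> G \<sigma>\<close>, and \<open>f (x \<sigma> y) = f (y x \<sigma>)\<close>.\<close>

lemma double_coset_sum:
  fixes G :: "'a::field mat set" and f :: "'a mat \<Rightarrow> complex"
  assumes fin: "finite G" and sub: "G \<subseteq> GL n" and closed: "\<And>x y. x \<in> G \<Longrightarrow> y \<in> G \<Longrightarrow> x * y \<in> G"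
    and \<sigma>: "\<sigma> \<in> carrier_mat n n" "\<sigma> * \<sigma> = 1\<^sub>m n"
    and f: "\<And>x y. x \<in> carrier_mat n n \<Longrightarrow> y \<in> carrier_mat n n \<Longrightarrow> f (x * y) = f (y * x)"
  shows "of_nat (card {w \<in> G. \<sigma> * w * \<sigma> \<in> G}) * (\<Sum>d\<in>{x * \<sigma> * y | x y. x \<in> G \<and> y \<in> G}. f d)
    = of_nat (card G) * (\<Sum>x\<in>G. f (x * \<sigma>))"
proof -
  let ?S = "{w \<in> G. \<sigma> * w * \<sigma> \<in> G}" and ?D = "{x * \<sigma> * y | x y. x \<in> G \<and> y \<in> G}"
  let ?p = "\<lambda>(x, y). x * \<sigma> * y"
  have c: "x \<in> carrier_mat n n" if "x \<in> G" for x using sub that GL_carrier by blast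
  note a = assoc_mult_mat[of _ n n _ n _ n]
  have "\<forall>w\<in>G. \<exists>v. v \<in> G \<and> w * v = 1\<^sub>m n \<and> v * w = 1\<^sub>m n"
    using finite_mult_closed_inverse[OF fin sub closed] by metis
  then obtain iv where iv: "\<And>w. w \<in> G \<Longrightarrow> iv w \<in> G" "\<And>w. w \<in> G \<Longrightarrow> w * iv w = 1\<^sub>m n" "\<And>w. w \<in> G \<Longrightarrow> iv w * w = 1\<^sub>m n"
    by metis
  have inv_cancel: "iv w * (w * z) = z" "w * (iv w * z) = z" if "w \<in> G" "z \<in> carrier_mat n n" for w z
    using a[OF c[OF iv(1)[OF that(1)]] c[OF that(1)] that(2)] a[OF c[OF that(1)] c[OF iv(1)[OF that(1)]] that(2)] iv that by simp_all
  have s_cancel: "\<sigma> * (\<sigma> * z) = z" if "z \<in> carrier_mat n n" for z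
    using a[OF \<sigma>(1) \<sigma>(1) that] \<sigma>(2) that by simp
  have fiber: "card {p \<in> G \<times> G. ?p p = d} = card ?S" if dD: "d \<in> ?D" for d
  proof -
    obtain x0 y0 where d: "d = x0 * \<sigma> * y0" "x0 \<in> G" "y0 \<in> G" using dD by blast
    note cx = c[OF d(2)] c[OF d(3)]
    \<comment> \<open>Two representations of \<open>d\<close> differ by moving an element
      \<open>v\<close> of \<open>G\<close> across \<sigma>; it is recovered as
      \<open>y0 * iv y\<close>.\<close>
    have "bij_betw (\<lambda>v. (x0 * (\<sigma> * v * \<sigma>), iv v * y0)) ?S {p \<in> G \<times> G. ?p p = d}"
    proof (rule bij_betw_byWitness[where f' = "\<lambda>(x, y). y0 * iv y"])
      show "\<forall>v\<in>?S. (\<lambda>(x, y). y0 * iv y) (x0 * (\<sigma> * v * \<sigma>), iv v * y0) = v"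
      proof
        fix v assume "v \<in> ?S"
        hence v: "v \<in> G" by simp
        let ?y = "iv v * y0"
        have y: "?y \<in> G" using closed iv v d by blast
        have "y0 = v * ?y" using inv_cancel(2)[OF v cx(2)] by simp
        hence "y0 * iv ?y = v * (?y * iv ?y)" using a[OF c[OF v] c[OF y] c[OF iv(1)[OF y]]] by simp
        thus "(\<lambda>(x, y). y0 * iv y) (x0 * (\<sigma> * v * \<sigma>), iv v * y0) = v"
          using iv(2)[OF y] c[OF v] by simp
      qed
      show "(\<lambda>v. (x0 * (\<sigma> * v * \<sigma>), iv v * y0)) ` ?S \<subseteq> {p \<in> G \<times> G. ?p p = d}"
      proof safe
        fix v assume v: "v \<in> G" "\<sigma> * v * \<sigma> \<in> G"
        show "x0 * (\<sigma> * v * \<sigma>) \<in> G" "iv v * y0 \<in> G" using closed iv v d by blast+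
        have cv: "v \<in> carrier_mat n n" "iv v \<in> carrier_mat n n" using c v iv by auto
        have "x0 * (\<sigma> * v * \<sigma>) * \<sigma> * (iv v * y0) = x0 * (\<sigma> * (v * (\<sigma> * (\<sigma> * (iv v * y0)))))"
          using \<sigma>(1) cx cv by (simp add: a)
        also have "\<dots> = x0 * (\<sigma> * y0)"
          using s_cancel[of "iv v * y0"] inv_cancel(2)[OF v(1) cx(2)] cx cv by simp
        finally show "x0 * (\<sigma> * v * \<sigma>) * \<sigma> * (iv v * y0) = d" using d \<sigma>(1) cx by (simp add: a)
      qed
      have key: "\<sigma> * (y0 * iv y) * \<sigma> = iv x0 * x"
        if xy: "x \<in> G" "y \<in> G" "x * \<sigma> * y = d" for x y
      proof -
        note cc = c[OF xy(1)] c[OF xy(2)] c[OF iv(1)[OF xy(2)]] c[OF iv(1)[OF d(2)]]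
        have "\<sigma> * y0 = iv x0 * d" unfolding d(1)
          using inv_cancel(1)[OF d(2), of "\<sigma> * y0"] \<sigma>(1) cx by (simp add: a)
        also have "\<dots> = iv x0 * x * \<sigma> * y" using xy(3)[symmetric] \<sigma>(1) cc by (simp add: a)
        finally have e: "\<sigma> * y0 = iv x0 * x * \<sigma> * y" .
        have "\<sigma> * (y0 * iv y) * \<sigma> = (\<sigma> * y0) * iv y * \<sigma>" using \<sigma>(1) cx cc by (simp add: a)
        also have "\<dots> = iv x0 * (x * (\<sigma> * (y * (iv y * \<sigma>))))" unfolding e using \<sigma>(1) cx cc by (simp add: a)
        also have "\<dots> = iv x0 * x" using inv_cancel(2)[OF xy(2) \<sigma>(1)] \<sigma>(2) cc by simp
        finally show ?thesis .
      qed
      show "\<forall>p\<in>{p \<in> G \<times> G. ?p p = d}. (x0 * (\<sigma> * ((\<lambda>(x, y). y0 * iv y) p) * \<sigma>), iv ((\<lambda>(x, y). y0 * iv y) p) * y0) = p"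
      proof safe
        fix x y assume xy: "x \<in> G" "y \<in> G" "d = x * \<sigma> * y"
        show "x0 * (\<sigma> * (y0 * iv y) * \<sigma>) = x"
          unfolding key[OF xy(1,2) xy(3)[symmetric]] using inv_cancel(2)[OF d(2) c[OF xy(1)]] .
        let ?v = "y0 * iv y"
        have v: "?v \<in> G" using closed iv xy d by blast
        have "y0 = ?v * y" using cx c[OF xy(2)] c[OF iv(1)[OF xy(2)]] iv(3)[OF xy(2)] by (simp add: a)
        thus "iv ?v * y0 = y" using inv_cancel(1)[OF v c[OF xy(2)]] by simp
      qed
      show "(\<lambda>(x, y). y0 * iv y) ` {p \<in> G \<times> G. ?p p = d} \<subseteq> ?S"
      proof safe
        fix x y assume xy: "x \<in> G" "y \<in> G" "d = x * \<sigma> * y"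
        show "y0 * iv y \<in> G" using closed iv xy d by blast
        show "\<sigma> * (y0 * iv y) * \<sigma> \<in> G" unfolding key[OF xy(1,2) xy(3)[symmetric]]
          using closed iv xy d by blast
      qed
    qed
    thus ?thesis by (rule bij_betw_same_card[symmetric])
  qed
  have D: "?D = ?p ` (G \<times> G)" by auto
  have "(\<Sum>p\<in>G \<times> G. f (?p p)) = (\<Sum>d\<in>?D. \<Sum>p | p \<in> G \<times> G \<and> ?p p = d. f (?p p))"
    by (rule sum.group[symmetric]) (use fin in \<open>auto simp: D\<close>)
  also have "\<dots> = (\<Sum>d\<in>?D. of_nat (card ?S) * f d)"
    by (rule sum.cong) (use fiber in auto)
  finally have 1: "(\<Sum>p\<in>G \<times> G. f (?p p)) = of_nat (card ?S) * (\<Sum>d\<in>?D. f d)"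
    by (simp add: sum_distrib_left)
  have "(\<Sum>p\<in>G \<times> G. f (?p p)) = (\<Sum>(x, y)\<in>G \<times> G. f (x * \<sigma> * y))"
    by (rule sum.cong) auto
  also have "\<dots> = (\<Sum>x\<in>G. \<Sum>y\<in>G. f (x * \<sigma> * y))" by (rule sum.cartesian_product[symmetric])
  also have "\<dots> = (\<Sum>y\<in>G. \<Sum>x\<in>G. f (x * \<sigma> * y))" by (rule sum.swap)
  also have "\<dots> = (\<Sum>y\<in>G. \<Sum>x\<in>G. f (x * \<sigma>))"
  proof (rule sum.cong[OF refl])
    fix y assume y: "y \<in> G"
    \<comment> \<open>The trace property brings \<open>y\<close> to the front, where translation by
      \<open>y\<close> permutes \<open>G\<close>.\<close>
    have "f (x * \<sigma> * y) = f (y * x * \<sigma>)" if "x \<in> G" for x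
      using f[of "x * \<sigma>" y] c[OF that] c[OF y] \<sigma>(1) by (simp add: a)
    hence "(\<Sum>x\<in>G. f (x * \<sigma> * y)) = (\<Sum>x\<in>G. f (y * x * \<sigma>))" by simp
    also have "\<dots> = (\<Sum>x\<in>G. f (x * \<sigma>))"
      by (rule sum.reindex_bij_witness[of _ "\<lambda>x. iv y * x" "\<lambda>x. y * x"])
         (use y closed iv inv_cancel c in auto)
    finally show "(\<Sum>x\<in>G. f (x * \<sigma> * y)) = (\<Sum>x\<in>G. f (x * \<sigma>))" .
  qed
  also have "\<dots> = of_nat (card G) * (\<Sum>x\<in>G. f (x * \<sigma>))" by simp
  finally show ?thesis using 1 by simp
qed

lemma mat_tr_mult_comm:
  fixes x y :: "'a::comm_ring_1 mat"
  assumes "x \<in> carrier_mat n n" "y \<in> carrier_mat n n"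
  shows "mat_tr (x * y) = mat_tr (y * x)"
proof -
  have *: "mat_tr (u * v) = (\<Sum>i<n. \<Sum>k<n. u $$ (i, k) * v $$ (k, i))"
    if "u \<in> carrier_mat n n" "v \<in> carrier_mat n n" for u v :: "'a mat"
    using that by (simp add: mat_tr_def scalar_prod_def atLeast0LessThan)
  show ?thesis unfolding *[OF assms] *[OF assms(2,1)]
    by (subst sum.swap) (simp add: mult.commute)
qed

text \<open>From here on \<open>n = r + 2\<close>: the blocks have sizes \<open>m = r + 1\<close>, \<open>m\<close> and \<open>2\<close>, and \<open>\<sigma>\<^sub>n\<^sub>-\<^sub>2\<close>
  is the matrix of the involution \<open>\<pi> r\<close>.\<close>

abbreviation \<pi> :: "nat \<Rightarrow> nat \<Rightarrow> nat" where "\<pi> r \<equiv> sigma_perm (Suc (Suc r)) r"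

lemma \<pi>_def: "\<pi> r i = (if i < r then Suc r + i else if Suc r \<le> i \<and> i < Suc r + r then i - Suc r else i)"
  by (simp add: sigma_perm_def)

lemma \<pi>_less: "i < Suc r + Suc r + 2 \<Longrightarrow> \<pi> r i < Suc r + Suc r + 2"
  and \<pi>_\<pi>: "\<pi> r (\<pi> r i) = i"
  by (auto simp: \<pi>_def)

abbreviation \<sigma> :: "nat \<Rightarrow> 'a::comm_ring_1 mat" where "\<sigma> r \<equiv> sigma_mat (Suc (Suc r)) r"

lemma sigma_carrier: "\<sigma> r \<in> carrier_mat (Suc r + Suc r + 2) (Suc r + Suc r + 2)"
  and sigma_dim [simp]: "dim_row (\<sigma> r) = Suc r + Suc r + 2" "dim_col (\<sigma> r) = Suc r + Suc r + 2"
  by (simp_all add: sigma_mat_def mult_2)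

lemma sigma_index:
  "i < Suc r + Suc r + 2 \<Longrightarrow> j < Suc r + Suc r + 2 \<Longrightarrow> \<sigma> r $$ (i, j) = (if j = \<pi> r i then 1 else 0)"
  by (simp add: sigma_mat_def mult_2)

lemma mult_sigma_index:
  fixes w :: "'a::comm_ring_1 mat"
  assumes "w \<in> carrier_mat (Suc r + Suc r + 2) (Suc r + Suc r + 2)" "i < Suc r + Suc r + 2" "j < Suc r + Suc r + 2"
  shows "(w * \<sigma> r) $$ (i, j) = w $$ (i, \<pi> r j)" "(\<sigma> r * w) $$ (i, j) = w $$ (\<pi> r i, j)"
proof -
  let ?N = "Suc r + Suc r + 2"
  have "(w * \<sigma> r) $$ (i, j) = (\<Sum>k<?N. w $$ (i, k) * \<sigma> r $$ (k, j))"
    using assms sigma_carrier[of r] by (simp add: scalar_prod_def atLeast0LessThan del: sum.lessThan_Suc)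
  also have "\<dots> = (\<Sum>k<?N. if k = \<pi> r j then w $$ (i, k) else 0)"
    by (rule sum.cong) (use assms \<pi>_\<pi> in \<open>auto simp: sigma_index\<close>)
  also have "\<dots> = w $$ (i, \<pi> r j)" using \<pi>_less[OF assms(3)] by (simp del: sum.lessThan_Suc)
  finally show "(w * \<sigma> r) $$ (i, j) = w $$ (i, \<pi> r j)" .
  have "(\<sigma> r * w) $$ (i, j) = (\<Sum>k<?N. \<sigma> r $$ (i, k) * w $$ (k, j))"
    using assms sigma_carrier[of r] by (simp add: scalar_prod_def atLeast0LessThan del: sum.lessThan_Suc)
  also have "\<dots> = (\<Sum>k<?N. if k = \<pi> r i then w $$ (k, j) else 0)"
    by (rule sum.cong) (use assms in \<open>auto simp: sigma_index\<close>)
  also have "\<dots> = w $$ (\<pi> r i, j)" using \<pi>_less[OF assms(2)] by (simp del: sum.lessThan_Suc)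
  finally show "(\<sigma> r * w) $$ (i, j) = w $$ (\<pi> r i, j)" .
qed

lemma sigma_conj_index:
  fixes w :: "'a::comm_ring_1 mat"
  assumes "w \<in> carrier_mat (Suc r + Suc r + 2) (Suc r + Suc r + 2)" "i < Suc r + Suc r + 2" "j < Suc r + Suc r + 2"
  shows "(\<sigma> r * w * \<sigma> r) $$ (i, j) = w $$ (\<pi> r i, \<pi> r j)"
  using mult_sigma_index(1)[OF mult_carrier_mat[OF sigma_carrier assms(1)] assms(2,3)]
    mult_sigma_index(2)[OF assms(1,2) \<pi>_less[OF assms(3)]] by simp

lemma sigma_sigma: "\<sigma> r * \<sigma> r = (1\<^sub>m (Suc r + Suc r + 2) :: 'a::comm_ring_1 mat)"
proof (rule eq_matI)
  let ?N = "Suc r + Suc r + 2"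
  fix i j assume "i < dim_row (1\<^sub>m ?N :: 'a mat)" "j < dim_col (1\<^sub>m ?N :: 'a mat)"
  hence ij: "i < ?N" "j < ?N" by auto
  have "(\<sigma> r * \<sigma> r :: 'a mat) $$ (i, j) = \<sigma> r $$ (\<pi> r i, j)" by (rule mult_sigma_index(2)[OF sigma_carrier ij])
  thus "(\<sigma> r * \<sigma> r) $$ (i, j) = (1\<^sub>m ?N :: 'a mat) $$ (i, j)"
    using ij \<pi>_less[OF ij(1)] \<pi>_\<pi>[of r i] by (auto simp: sigma_index)
qed (use sigma_carrier[of r] in auto)

lemma sigma_transpose: "(\<sigma> r)\<^sup>T = (\<sigma> r :: 'a::comm_ring_1 mat)"
proof (rule eq_matI)
  fix i j assume "i < dim_row (\<sigma> r :: 'a mat)" "j < dim_col (\<sigma> r :: 'a mat)"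
  hence ij: "i < Suc r + Suc r + 2" "j < Suc r + Suc r + 2" using sigma_carrier[of r] by auto
  have "i = \<pi> r j \<longleftrightarrow> j = \<pi> r i" using \<pi>_\<pi> by metis
  thus "(\<sigma> r)\<^sup>T $$ (i, j) = (\<sigma> r :: 'a mat) $$ (i, j)"
    using ij sigma_carrier[of r] by (simp add: sigma_index)
qed (use sigma_carrier[of r] in auto)

text \<open>\<open>Jmat\<close> is monomial, with the nonzero entry of row \<open>i\<close> in
  column \<open>Jperm m i\<close>; its compatibility with \<sigma> thus becomes a computation with
  indices.\<close>

definition Jperm :: "nat \<Rightarrow> nat \<Rightarrow> nat" where
  "Jperm m i = (if i < m then m + i else if i < m + m then i - m else i)"

lemma Jmat_index:
  assumes "i < m + m + 2" "j < m + m + 2"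
  shows "Jmat (Suc m) \<epsilon> $$ (i, j) = (if j = Jperm m i then (if i = Suc (m + m) then - \<epsilon> else 1) else 0)"
  using assms by (auto simp: Jmat_def Let_def blocks3_def blk3_def bidx_def delta_eps_def Jperm_def)

text \<open>\<open>\<pi> r\<close> exchanges the members of the first \<open>r\<close> hyperbolic
  pairs, so it commutes with \<open>Jperm\<close>, and it fixes the row carrying
  \<open>- \<epsilon>\<close>.\<close>

lemma sigma_J: "\<sigma> r * Jmat (Suc (Suc r)) \<epsilon> * \<sigma> r = Jmat (Suc (Suc r)) \<epsilon>"
proof (rule eq_matI)
  note J = Jmat_carrier[of "Suc r" \<epsilon>]
  fix i j assume "i < dim_row (Jmat (Suc (Suc r)) \<epsilon>)" "j < dim_col (Jmat (Suc (Suc r)) \<epsilon>)"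
  hence ij: "i < Suc r + Suc r + 2" "j < Suc r + Suc r + 2" using J by auto
  have "\<pi> r (Jperm (Suc r) (\<pi> r i)) = Jperm (Suc r) i" by (auto simp: \<pi>_def Jperm_def)
  hence "\<pi> r j = Jperm (Suc r) (\<pi> r i) \<longleftrightarrow> j = Jperm (Suc r) i" by (metis \<pi>_\<pi>)
  moreover have "\<pi> r i = Suc (Suc r + Suc r) \<longleftrightarrow> i = Suc (Suc r + Suc r)" by (auto simp: \<pi>_def)
  ultimately show "(\<sigma> r * Jmat (Suc (Suc r)) \<epsilon> * \<sigma> r) $$ (i, j) = Jmat (Suc (Suc r)) \<epsilon> $$ (i, j)"
    unfolding sigma_conj_index[OF J ij] Jmat_index[OF \<pi>_less[OF ij(1)] \<pi>_less[OF ij(2)]] Jmat_index[OF ij]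
    by simp
qed (use Jmat_carrier[of "Suc r" \<epsilon>] sigma_carrier[of r] in auto)

lemma sigma_conj_form:
  fixes w :: "'a::comm_ring_1 mat"
  assumes "w \<in> carrier_mat (Suc r + Suc r + 2) (Suc r + Suc r + 2)"
    "w\<^sup>T * Jmat (Suc (Suc r)) \<epsilon> * w = Jmat (Suc (Suc r)) \<epsilon>"
  shows "(\<sigma> r * w * \<sigma> r)\<^sup>T * Jmat (Suc (Suc r)) \<epsilon> * (\<sigma> r * w * \<sigma> r) = Jmat (Suc (Suc r)) \<epsilon>"
proof -
  let ?N = "Suc r + Suc r + 2"
  define J where "J = Jmat (Suc (Suc r)) \<epsilon>"
  define s where "s = (\<sigma> r :: 'a mat)"
  define N where "N = ?N"
  have c: "J \<in> carrier_mat N N" "s \<in> carrier_mat N N" "w \<in> carrier_mat N N" "w\<^sup>T \<in> carrier_mat N N"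
    unfolding J_def s_def N_def by (rule Jmat_carrier sigma_carrier assms(1) transpose_carrier_mat[THEN iffD2])+
  note a = assoc_mult_mat[of _ N N _ N _ N]
  have e: "s * J * s = J" "s\<^sup>T = s" "w\<^sup>T * J * w = J" unfolding J_def s_def using sigma_J sigma_transpose assms(2) by auto
  have "(s * w * s)\<^sup>T = s * w\<^sup>T * s" using c e
    by (simp add: transpose_mult[of _ N N _ N] a)
  hence "(s * w * s)\<^sup>T * J * (s * w * s) = s * (w\<^sup>T * ((s * J * s) * w)) * s" using c by (simp add: a)
  also have "\<dots> = s * (w\<^sup>T * J * w) * s" using c e by (simp add: a)
  finally show ?thesis using e unfolding J_def s_def by simp
qed

text \<open>The trace reads the entries at \<open>(i, \<pi> r i)\<close>. The exchanged indices hit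
  blocks (0,1) and (1,0), the latter zero; the fixed ones stay on the diagonal.\<close>

lemma mat_tr_mult_sigma:
  fixes w :: "'a::comm_ring_1 mat"
  assumes "w \<in> carrier_mat (Suc r + Suc r + 2) (Suc r + Suc r + 2)" "blk (Suc r) w 1 0 = 0\<^sub>m (Suc r) (Suc r)"
  shows "mat_tr (w * \<sigma> r) = (\<Sum>i<r. blk (Suc r) w 0 1 $$ (i, i)) + blk (Suc r) w 0 0 $$ (r, r)
    + blk (Suc r) w 1 1 $$ (r, r) + mat_tr (blk (Suc r) w 2 2)"
proof -
  let ?m = "Suc r"
  let ?N = "?m + ?m + 2"
  have z: "w $$ (?m + i, i) = 0" if "i < r" for i
    using arg_cong[OF assms(2), of "\<lambda>M. M $$ (i, i)"] that by (simp add: blk_index)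
  have "mat_tr (w * \<sigma> r) = (\<Sum>i<?N. w $$ (i, \<pi> r i))"
    unfolding mat_tr_def
  proof (rule sum.cong)
    show "{..<dim_row (w * \<sigma> r)} = {..<?N}" using assms(1) by simp
    fix i assume "i \<in> {..<?N}"
    thus "(w * \<sigma> r) $$ (i, i) = w $$ (i, \<pi> r i)" using mult_sigma_index(1)[OF assms(1)] by auto
  qed
  also have "\<dots> = (\<Sum>i<?m. w $$ (i, \<pi> r i)) + (\<Sum>i<?m. w $$ (?m + i, \<pi> r (?m + i)))
      + (\<Sum>i<2. w $$ (2 * ?m + i, \<pi> r (2 * ?m + i)))" by (rule sum_split_blocks)
  also have "(\<Sum>i<?m. w $$ (i, \<pi> r i)) = (\<Sum>i<r. blk ?m w 0 1 $$ (i, i)) + blk ?m w 0 0 $$ (r, r)"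
    by (simp add: \<pi>_def blk_index)
  also have "(\<Sum>i<?m. w $$ (?m + i, \<pi> r (?m + i))) = blk ?m w 1 1 $$ (r, r)"
    using z by (simp add: \<pi>_def blk_index)
  also have "(\<Sum>i<2. w $$ (2 * ?m + i, \<pi> r (2 * ?m + i))) = mat_tr (blk ?m w 2 2)"
    unfolding mat_tr_def by (rule sum.cong) (auto simp: \<pi>_def blk_index blk_def)
  finally show ?thesis by (simp add: add_ac)
qed


subsection \<open>Parametrising the parabolic subgroup\<close>

lemma gram_index:
  fixes h :: "'a::comm_ring_1 mat"
  assumes "h \<in> carrier_mat 2 m" "k < m" "l < m"
  shows "(h\<^sup>T * delta_eps \<epsilon> * h) $$ (k, l) = h $$ (0, k) * h $$ (0, l) - \<epsilon> * (h $$ (1, k) * h $$ (1, l))"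
  using assms by (simp add: scalar_prod_def delta_eps_def numeral_2_eq_2 algebra_simps)

lemma gram_carrier: "h \<in> carrier_mat 2 m \<Longrightarrow> h\<^sup>T * delta_eps \<epsilon> * h \<in> carrier_mat m m"
  by auto

lemma gram_sym:
  fixes h :: "'a::comm_ring_1 mat"
  assumes "h \<in> carrier_mat 2 m" "k < m" "l < m"
  shows "(h\<^sup>T * delta_eps \<epsilon> * h) $$ (k, l) = (h\<^sup>T * delta_eps \<epsilon> * h) $$ (l, k)"
  unfolding gram_index[OF assms] gram_index[OF assms(1,3,2)] by (simp add: mult.commute)

text \<open>The solutions of \<open>\<^sup>tB + B + \<^sup>th \<delta> h = 0\<close> are \<open>B = C + \<^sup>th \<delta> h\<close> with \<open>C\<close> skew, because \<open>-1/2 = 1\<close> in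
  characteristic 3.\<close>

definition qpar :: "nat \<Rightarrow> 'a::field \<Rightarrow> 'a mat \<times> 'a mat \<times> 'a mat \<times> 'a mat \<Rightarrow> 'a mat" where
  "qpar m \<epsilon> = (\<lambda>(A, i, h, C). qmat m \<epsilon> A (C + h\<^sup>T * delta_eps \<epsilon> * h) h i)"

definition qdom :: "nat \<Rightarrow> 'a::field \<Rightarrow> ('a mat \<times> 'a mat \<times> 'a mat \<times> 'a mat) set" where
  "qdom m \<epsilon> = GL m \<times> SOminus 1 \<epsilon> \<times> carrier_mat 2 m \<times> Skew m"

lemma SOminus_1_carrier: "i \<in> SOminus 1 (\<epsilon>::'a::field) \<Longrightarrow> i \<in> carrier_mat 2 2"
  unfolding SOminus_1_iff by blast

lemma SOminus_1_GL: "i \<in> SOminus 1 (\<epsilon>::'a::field) \<Longrightarrow> i \<in> GL 2"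
  unfolding SOminus_1_iff GL_def by auto

lemma finite_SOminus_1: "finite (SOminus 1 (\<epsilon> :: 'a::{finite,field}))"
  by (rule finite_subset[OF _ finite_carrier_mat[of 2 2]]) (use SOminus_1_carrier in blast)

lemma qdomD:
  assumes "(A, i, h, C) \<in> qdom m \<epsilon>"
  shows "A \<in> GL m" "i \<in> SOminus 1 \<epsilon>" "h \<in> carrier_mat 2 m" "C \<in> Skew m"
    "i \<in> carrier_mat 2 2" "C + h\<^sup>T * delta_eps \<epsilon> * h \<in> carrier_mat m m"
  using assms SOminus_1_carrier unfolding qdom_def by (auto simp: Skew_def)

lemma blk_qpar:
  assumes "(A, i, h, C) \<in> qdom m \<epsilon>"
  shows "qpar m \<epsilon> (A, i, h, C) \<in> carrier_mat (m + m + 2) (m + m + 2)"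
    "blk m (qpar m \<epsilon> (A, i, h, C)) 0 0 = A"
    "blk m (qpar m \<epsilon> (A, i, h, C)) 0 (Suc 0) = A * (C + h\<^sup>T * delta_eps \<epsilon> * h)"
    "blk m (qpar m \<epsilon> (A, i, h, C)) 0 2 = - (A * (h\<^sup>T * delta_eps \<epsilon>))"
    "blk m (qpar m \<epsilon> (A, i, h, C)) (Suc 0) 0 = 0\<^sub>m m m"
    "blk m (qpar m \<epsilon> (A, i, h, C)) (Suc 0) (Suc 0) = (mat_inv m A)\<^sup>T"
    "blk m (qpar m \<epsilon> (A, i, h, C)) (Suc 0) 2 = 0\<^sub>m m 2"
    "blk m (qpar m \<epsilon> (A, i, h, C)) 2 0 = 0\<^sub>m 2 m" "blk m (qpar m \<epsilon> (A, i, h, C)) 2 (Suc 0) = i * h"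
    "blk m (qpar m \<epsilon> (A, i, h, C)) 2 2 = i"
  using blk_qmat[OF qdomD(1,6,3,5)[OF assms], of \<epsilon>] unfolding qpar_def prod.case by blast+

text \<open>\<open>A\<close> and \<open>i\<close> are blocks; then \<open>i * h\<close> gives
  \<open>h\<close> since \<open>i\<close> is invertible, and the block (0,1) gives \<open>C\<close>
  since \<open>A\<close> is.\<close>

lemma qpar_inj: "inj_on (qpar m \<epsilon>) (qdom m \<epsilon>)"
proof (rule inj_onI)
  fix p p' assume pp: "p \<in> qdom m \<epsilon>" "p' \<in> qdom m \<epsilon>" "qpar m \<epsilon> p = qpar m \<epsilon> p'"
  obtain A i h C where p: "p = (A, i, h, C)" by (rule prod_cases4)
  obtain A' i' h' C' where p': "p' = (A', i', h', C')" by (rule prod_cases4)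
  note d = pp(1)[unfolded p] and d' = pp(2)[unfolded p'] and eq = pp(3)[unfolded p p']
  have A: "A = A'" using blk_qpar(2)[OF d] blk_qpar(2)[OF d'] eq by simp
  have i: "i = i'" using blk_qpar(10)[OF d] blk_qpar(10)[OF d'] eq by simp
  have "i * h = i * h'" using blk_qpar(9)[OF d] blk_qpar(9)[OF d'] eq i by simp
  hence h: "h = h'" by (rule GL_left_cancel[OF SOminus_1_GL[OF qdomD(2)[OF d]] qdomD(3)[OF d] qdomD(3)[OF d']])
  have "A * (C + h\<^sup>T * delta_eps \<epsilon> * h) = A * (C' + h\<^sup>T * delta_eps \<epsilon> * h)"
    using blk_qpar(3)[OF d] blk_qpar(3)[OF d'] eq A h by simp
  hence e: "C + h\<^sup>T * delta_eps \<epsilon> * h = C' + h\<^sup>T * delta_eps \<epsilon> * h"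
    by (rule GL_left_cancel[OF qdomD(1)[OF d] qdomD(6)[OF d] qdomD(6)[OF d', folded h]])
  have Cc: "C \<in> carrier_mat m m" "C' \<in> carrier_mat m m" using qdomD(4)[OF d] qdomD(4)[OF d'] by (auto simp: Skew_def)
  have "C = C'"
  proof (rule eq_matI)
    fix k l assume kl: "k < dim_row C'" "l < dim_col C'"
    have "(C + h\<^sup>T * delta_eps \<epsilon> * h) $$ (k, l) = (C' + h\<^sup>T * delta_eps \<epsilon> * h) $$ (k, l)" by (simp only: e)
    thus "C $$ (k, l) = C' $$ (k, l)"
      using kl Cc gram_carrier[OF qdomD(3)[OF d], of \<epsilon>] by (subst (asm) (1 2) index_add_mat) auto
  qed (use Cc in auto)
  thus "p = p'" unfolding p p' using A i h by simp
qed

context ternary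
begin

lemma Qgrp_eq_image: "Qgrp (Suc m) (\<epsilon>::'a) = qpar m \<epsilon> ` qdom m \<epsilon>"
proof (intro equalityI subsetI)
  fix w assume "w \<in> Qgrp (Suc m) \<epsilon>"
  then obtain A B h i where w: "w = qmat m \<epsilon> A B h i" "A \<in> GL m" "i \<in> SOminus 1 \<epsilon>" "B \<in> carrier_mat m m"
    "h \<in> carrier_mat 2 m" "B\<^sup>T + B + h\<^sup>T * delta_eps \<epsilon> * h = 0\<^sub>m m m"
    unfolding Qgrp_qmat by blast
  define T where "T = h\<^sup>T * delta_eps \<epsilon> * h"
  have T: "T \<in> carrier_mat m m" using gram_carrier[OF w(5)] unfolding T_def .
  define C where "C = B - T"
  have C: "C \<in> carrier_mat m m" unfolding C_def using T by (rule minus_carrier_mat)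
  have "C\<^sup>T = - C"
  proof (rule eq_matI)
    fix k l assume "k < dim_row (- C)" "l < dim_col (- C)"
    hence kl: "k < m" "l < m" using C by auto
    have "(B\<^sup>T + B + T) $$ (k, l) = 0" using w(6) kl unfolding T_def by simp
    hence "B $$ (l, k) + B $$ (k, l) + T $$ (k, l) = 0" using kl w(4) T by (simp add: add.assoc)
    moreover have "T $$ (l, k) = T $$ (k, l)" unfolding T_def using gram_sym[OF w(5) kl(2,1)] .
    moreover have "T $$ (k, l) + T $$ (k, l) = - T $$ (k, l)"
      using two_eq by (metis mult_2 mult_minus1)
    ultimately have "B $$ (l, k) - T $$ (l, k) = - (B $$ (k, l) - T $$ (k, l))"
    proof -
      assume s: "B $$ (l, k) + B $$ (k, l) + T $$ (k, l) = 0" "T $$ (l, k) = T $$ (k, l)"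
        "T $$ (k, l) + T $$ (k, l) = - T $$ (k, l)"
      have "B $$ (l, k) + B $$ (k, l) = T $$ (k, l) + T $$ (k, l)"
        unfolding s(3) using s(1) by (simp add: eq_neg_iff_add_eq_0)
      thus ?thesis unfolding s(2) by (simp add: algebra_simps)
    qed
    thus "C\<^sup>T $$ (k, l) = (- C) $$ (k, l)" using kl w(4) T by (simp add: C_def)
  qed (use C in auto)
  hence "C \<in> Skew m" using C by (simp add: Skew_def)
  moreover have "C + T = B" using w(4) T by (intro eq_matI) (auto simp: C_def)
  ultimately show "w \<in> qpar m \<epsilon> ` qdom m \<epsilon>"
    using w unfolding T_def by (intro image_eqI[of _ _ "(A, i, h, C)"]) (auto simp: qpar_def qdom_def)
next
  fix w assume "w \<in> qpar m \<epsilon> ` qdom m \<epsilon>"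
  then obtain A i h C where w: "w = qpar m \<epsilon> (A, i, h, C)" "(A, i, h, C) \<in> qdom m \<epsilon>" by auto
  note d = qdomD[OF w(2)]
  define T where "T = h\<^sup>T * delta_eps \<epsilon> * h"
  have T: "T \<in> carrier_mat m m" using gram_carrier[OF d(3)] unfolding T_def .
  have C: "C \<in> carrier_mat m m" "C\<^sup>T = - C" using d by (auto simp: Skew_def)
  have "(C + T)\<^sup>T + (C + T) + T = 0\<^sub>m m m"
  proof (rule eq_matI)
    fix k l assume "k < dim_row (0\<^sub>m m m :: 'a mat)" "l < dim_col (0\<^sub>m m m :: 'a mat)"
    hence kl: "k < m" "l < m" by auto
    have "C $$ (l, k) = - C $$ (k, l)" using arg_cong[OF C(2), of "\<lambda>M. M $$ (k, l)"] kl C(1) by simp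
    moreover have "T $$ (l, k) = T $$ (k, l)" unfolding T_def using gram_sym[OF d(3) kl(2,1)] .
    moreover have "T $$ (k, l) + T $$ (k, l) + T $$ (k, l) = 0"
    proof -
      have "T $$ (k, l) + T $$ (k, l) + T $$ (k, l) = 3 * T $$ (k, l)" by simp
      thus ?thesis unfolding three_eq_0 by simp
    qed
    ultimately show "((C + T)\<^sup>T + (C + T) + T) $$ (k, l) = (0\<^sub>m m m :: 'a mat) $$ (k, l)"
      using kl C T by (simp add: algebra_simps)
  qed (use C T in auto)
  thus "w \<in> Qgrp (Suc m) \<epsilon>" unfolding Qgrp_qmat w(1) qpar_def prod.case T_def using d by blast
qed

lemma card_Qgrp:
  fixes \<epsilon> :: 'a
  assumes "\<epsilon> \<noteq> 0" "\<nexists>b. \<epsilon> = b ^ 2"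
  shows "card (Qgrp (Suc m) \<epsilon>) = card (GL m :: 'a mat set) * (q + 1) * q ^ (2 * m) * card (Skew m :: 'a mat set)"
  unfolding Qgrp_eq_image card_image[OF qpar_inj] unfolding qdom_def
  by (simp only: card_cartesian_product card_SOminus_1[OF assms] card_carrier_mat card_UNIV mult.assoc)

lemma finite_Qgrp: "finite (Qgrp (Suc m) (\<epsilon>::'a))"
  unfolding Qgrp_eq_image qdom_def by (intro finite_imageI finite_cartesian_product) (simp_all add: finite_SOminus_1[unfolded One_nat_def])

section \<open>The intersection of \<open>Q\<close> with its conjugate\<close>

text \<open>Comparing last columns in \<open>mat_inv A * A = 1\<close>: only the corner of
  \<open>A\<close> multiplies the last column of the inverse.\<close>

lemma corner_inverse:
  fixes A :: "'a mat"
  assumes A: "A \<in> GL (Suc r)" "\<forall>i<r. A $$ (i, r) = 0"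
  shows "A $$ (r, r) \<noteq> 0" "mat_inv (Suc r) A $$ (r, r) = inverse (A $$ (r, r))"
    "\<And>i. i < r \<Longrightarrow> mat_inv (Suc r) A $$ (i, r) = 0"
proof -
  let ?R = "mat_inv (Suc r) A"
  have c: "A \<in> carrier_mat (Suc r) (Suc r)" "?R \<in> carrier_mat (Suc r) (Suc r)"
    using A mat_inv(1)[OF A(1)] GL_carrier by auto
  have e: "?R $$ (i, r) * A $$ (r, r) = (if i = r then 1 else 0)" if "i < Suc r" for i
  proof -
    have "(?R * A) $$ (i, r) = (\<Sum>k<Suc r. ?R $$ (i, k) * A $$ (k, r))"
      using c that by (simp add: scalar_prod_def atLeast0LessThan del: sum.lessThan_Suc)
    also have "\<dots> = ?R $$ (i, r) * A $$ (r, r)" using A(2) by simp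
    finally show ?thesis using mat_inv(3)[OF A(1)] that by simp
  qed
  from e[of r] show nz: "A $$ (r, r) \<noteq> 0" by auto
  show "?R $$ (r, r) = inverse (A $$ (r, r))" using e[of r] nz by (simp add: field_simps)
  show "?R $$ (i, r) = 0" if "i < r" for i using e[of i] nz that by simp
qed

text \<open>The upper left corner of the inverse inverts that of \<open>A\<close>, because the last
  column of the inverse vanishes above the diagonal.\<close>

lemma corner_left_cancel:
  fixes A :: "'a mat"
  assumes A: "A \<in> GL (Suc r)" "\<forall>i<r. A $$ (i, r) = 0" and l: "l < r"
    and z: "\<And>i. i < r \<Longrightarrow> (\<Sum>k<r. A $$ (i, k) * f k) = 0"
  shows "f l = 0"
proof -
  let ?R = "mat_inv (Suc r) A"
  have c: "A \<in> carrier_mat (Suc r) (Suc r)" "?R \<in> carrier_mat (Suc r) (Suc r)"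
    using A mat_inv(1)[OF A(1)] GL_carrier by auto
  have e: "(\<Sum>i<r. ?R $$ (l, i) * A $$ (i, k)) = (if l = k then 1 else 0)" if "k < r" for k
  proof -
    have "(?R * A) $$ (l, k) = (\<Sum>i<Suc r. ?R $$ (l, i) * A $$ (i, k))"
      using c that l by (simp add: scalar_prod_def atLeast0LessThan del: sum.lessThan_Suc)
    thus ?thesis using mat_inv(3)[OF A(1)] that l corner_inverse(3)[OF A l] by simp
  qed
  have "0 = (\<Sum>i<r. ?R $$ (l, i) * (\<Sum>k<r. A $$ (i, k) * f k))" using z by simp
  also have "\<dots> = (\<Sum>k<r. (\<Sum>i<r. ?R $$ (l, i) * A $$ (i, k)) * f k)"
    by (simp only: sum_distrib_left sum_distrib_right mult.assoc) (rule sum.swap)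
  also have "\<dots> = (\<Sum>k<r. if k = l then f k else 0)" by (rule sum.cong) (auto simp: e)
  also have "\<dots> = f l" using l by simp
  finally show ?thesis by simp
qed

text \<open>Parameters of \<open>Q \<inter> \<sigma>Q\<sigma>\<close>: \<open>A\<close> block lower
  triangular, \<open>h\<close> living in its last column, \<open>C\<close> in its last row and
  column.\<close>

definition stab_dom :: "nat \<Rightarrow> 'a \<Rightarrow> ('a mat \<times> 'a mat \<times> 'a mat \<times> 'a mat) set" where
  "stab_dom r \<epsilon> = {A \<in> GL (Suc r). \<forall>i<r. A $$ (i, r) = 0} \<times> SOminus 1 \<epsilon>
     \<times> {h \<in> carrier_mat 2 (Suc r). \<forall>i<2. \<forall>j<r. h $$ (i, j) = 0}
     \<times> {C \<in> Skew (Suc r). \<forall>i<r. \<forall>j<r. C $$ (i, j) = 0}"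

text \<open>Conjugation by \<sigma> preserves the form and block (2,2), so only the vanishing of
  three blocks matters. Invertibility of \<open>i\<close> then clears the first \<open>r\<close>
  columns of \<open>h\<close>, hence the corner of the Gram matrix, and the corner of
  \<open>A\<close> can be cancelled to clear that of \<open>C\<close>.\<close>

lemma stab_iff:
  assumes p: "(A, i, h, C) \<in> qdom (Suc r) \<epsilon>"
  shows "\<sigma> r * qpar (Suc r) \<epsilon> (A, i, h, C) * \<sigma> r \<in> Qgrp (Suc (Suc r)) \<epsilon> \<longleftrightarrow> (A, i, h, C) \<in> stab_dom r \<epsilon>"
proof -
  let ?m = "Suc r" and ?d = "delta_eps \<epsilon>"
  define w where "w = qpar ?m \<epsilon> (A, i, h, C)"
  define v where "v = \<sigma> r * w * \<sigma> r"
  define T where "T = h\<^sup>T * ?d * h"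
  define R where "R = mat_inv ?m A"
  note d = qdomD[OF p] and b = blk_qpar[OF p, folded w_def T_def R_def]
  have Ac: "A \<in> carrier_mat ?m ?m" and Rc: "R \<in> carrier_mat ?m ?m"
    using d(1) mat_inv(1)[OF d(1)] GL_carrier unfolding R_def by auto
  have Cc: "C \<in> carrier_mat ?m ?m" using d by (simp add: Skew_def)
  have Tc: "T \<in> carrier_mat ?m ?m" unfolding T_def using gram_carrier[OF d(3)] .
  have wQ: "w \<in> Qchar ?m \<epsilon>" unfolding Qgrp_eq_Qchar[symmetric] Qgrp_eq_image w_def using p by blast
  have vc: "v \<in> carrier_mat (?m + ?m + 2) (?m + ?m + 2)"
    unfolding v_def by (intro mult_carrier_mat[of _ _ "?m + ?m + 2"] sigma_carrier b(1))
  have vJ: "v\<^sup>T * Jmat (Suc ?m) \<epsilon> * v = Jmat (Suc ?m) \<epsilon>"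
    unfolding v_def by (rule sigma_conj_form[OF b(1)]) (use wQ in \<open>simp add: Qchar_def\<close>)
  have vi: "v $$ (k, l) = w $$ (\<pi> r k, \<pi> r l)" if "k < ?m + ?m + 2" "l < ?m + ?m + 2" for k l
    unfolding v_def by (rule sigma_conj_index[OF b(1) that])
  have w01: "w $$ (k, ?m + l) = (A * (C + T)) $$ (k, l)" if "k < ?m" "l < ?m" for k l
    using arg_cong[OF b(3), of "\<lambda>M. M $$ (k, l)"] that by (simp add: blk_index)
  have w00: "w $$ (k, l) = A $$ (k, l)" if "k < ?m" "l < ?m" for k l
    using arg_cong[OF b(2), of "\<lambda>M. M $$ (k, l)"] that by (simp add: blk_index)
  have w10: "w $$ (?m + k, l) = 0" if "k < ?m" "l < ?m" for k l
    using arg_cong[OF b(5), of "\<lambda>M. M $$ (k, l)"] that by (simp add: blk_index)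
  have w11: "w $$ (?m + k, ?m + l) = R $$ (l, k)" if "k < ?m" "l < ?m" for k l
    using arg_cong[OF b(6), of "\<lambda>M. M $$ (k, l)"] that Rc by (simp add: blk_index)
  have w20: "w $$ (2 * ?m + k, l) = 0" if "k < 2" "l < ?m" for k l
    using arg_cong[OF b(8), of "\<lambda>M. M $$ (k, l)"] that by (simp add: blk_index)
  have w21: "w $$ (2 * ?m + k, ?m + l) = (i * h) $$ (k, l)" if "k < 2" "l < ?m" for k l
    using arg_cong[OF b(9), of "\<lambda>M. M $$ (k, l)"] that by (simp add: blk_index)
  have w02: "w $$ (k, 2 * ?m + l) = - (A * (h\<^sup>T * ?d)) $$ (k, l)" if "k < ?m" "l < 2" for k l
    using arg_cong[OF b(4), of "\<lambda>M. M $$ (k, l)"] that Ac d(3) by (simp add: blk_index)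
  have w12: "w $$ (?m + k, 2 * ?m + l) = 0" if "k < ?m" "l < 2" for k l
    using arg_cong[OF b(7), of "\<lambda>M. M $$ (k, l)"] that by (simp add: blk_index)
  have \<pi>0: "\<pi> r k = ?m + k" if "k < r" for k using that by (simp add: \<pi>_def)
  have \<pi>0r: "\<pi> r r = r" by (simp add: \<pi>_def)
  have \<pi>1: "\<pi> r (?m + k) = k" if "k < r" for k using that by (simp add: \<pi>_def)
  have \<pi>1r: "\<pi> r (?m + r) = ?m + r" by (simp add: \<pi>_def)
  have \<pi>2: "\<pi> r (2 * ?m + k) = 2 * ?m + k" for k by (simp add: \<pi>_def)
  have eq0: "blk ?m v p q = 0\<^sub>m (bsize ?m p) (bsize ?m q) \<longleftrightarrow>
      (\<forall>k<bsize ?m p. \<forall>l<bsize ?m q. w $$ (\<pi> r (p * ?m + k), \<pi> r (q * ?m + l)) = 0)" if "p < 3" "q < 3" for p q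
  proof -
    have "blk ?m v p q = 0\<^sub>m (bsize ?m p) (bsize ?m q) \<longleftrightarrow> (\<forall>k<bsize ?m p. \<forall>l<bsize ?m q. blk ?m v p q $$ (k, l) = 0)"
    proof
      assume "\<forall>k<bsize ?m p. \<forall>l<bsize ?m q. blk ?m v p q $$ (k, l) = 0"
      thus "blk ?m v p q = 0\<^sub>m (bsize ?m p) (bsize ?m q)" by (intro eq_matI) (auto simp: blk_def)
    qed auto
    also have "\<dots> \<longleftrightarrow> (\<forall>k<bsize ?m p. \<forall>l<bsize ?m q. w $$ (\<pi> r (p * ?m + k), \<pi> r (q * ?m + l)) = 0)"
    proof -
      have "blk ?m v p q $$ (k, l) = w $$ (\<pi> r (p * ?m + k), \<pi> r (q * ?m + l))"
        if kl: "k < bsize ?m p" "l < bsize ?m q" for k l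
        using blk_index[OF kl, of v] vi[OF block_index_less[OF \<open>p < 3\<close> kl(1)] block_index_less[OF \<open>q < 3\<close> kl(2)]]
        by (simp only:)
      thus ?thesis by metis
    qed
    finally show ?thesis .
  qed
  have split: "(\<forall>k<?m. P k) \<longleftrightarrow> (\<forall>k<r. P k) \<and> P r" for P using less_Suc_eq by auto
  \<comment> \<open>After permuting, the corner of this block comes from block (0,1) of
    \<open>w\<close>, its last column from \<open>A\<close>, its last row from the inverse of
    \<open>A\<close>, and its last entry from the zero block.\<close>
  have v10: "blk ?m v 1 0 = 0\<^sub>m ?m ?m \<longleftrightarrow> (\<forall>k<r. A $$ (k, r) = 0) \<and> (\<forall>k<r. \<forall>l<r. (A * (C + T)) $$ (k, l) = 0)
      \<and> (\<forall>l<r. R $$ (l, r) = 0)"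
    using eq0[of 1 0] w01 w00 w11 w10 unfolding bsize_simps One_nat_def split
    by (auto simp: \<pi>0 \<pi>0r \<pi>1[simplified] \<pi>1r[simplified])
  have v20: "blk ?m v 2 0 = 0\<^sub>m 2 ?m \<longleftrightarrow> (\<forall>k<2. \<forall>l<r. (i * h) $$ (k, l) = 0)"
    using eq0[of 2 0] w21 w20 unfolding bsize_simps split \<pi>2
    by (auto simp: \<pi>0 \<pi>0r)
  have v12: "blk ?m v 1 2 = 0\<^sub>m ?m 2 \<longleftrightarrow> (\<forall>k<r. \<forall>l<2. (A * (h\<^sup>T * ?d)) $$ (k, l) = 0)"
    using eq0[of 1 2] w02 w12[of r] unfolding bsize_simps One_nat_def split \<pi>2
    by (auto simp: \<pi>1[simplified] \<pi>1r[simplified])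
  have v22: "blk ?m v 2 2 = i"
  proof (rule eq_matI)
    fix k l assume "k < dim_row i" "l < dim_col i"
    hence kl: "k < 2" "l < 2" using d(5) by auto
    have "w $$ (2 * ?m + k, 2 * ?m + l) = i $$ (k, l)"
      using arg_cong[OF b(10), of "\<lambda>M. M $$ (k, l)"] kl by (simp add: blk_index)
    thus "blk ?m v 2 2 $$ (k, l) = i $$ (k, l)"
      using kl vi[of "2 * ?m + k" "2 * ?m + l"] unfolding \<pi>2 by (simp add: blk_index)
  qed (use d(5) in \<open>auto simp: blk_def\<close>)
  have "det i = 1" using d(2) unfolding SOminus_1_iff by blast
  hence main: "v \<in> Qchar ?m \<epsilon> \<longleftrightarrow> (\<forall>k<r. A $$ (k, r) = 0) \<and> (\<forall>k<r. \<forall>l<r. (A * (C + T)) $$ (k, l) = 0)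
      \<and> (\<forall>l<r. R $$ (l, r) = 0) \<and> (\<forall>k<2. \<forall>l<r. (i * h) $$ (k, l) = 0) \<and> (\<forall>k<r. \<forall>l<2. (A * (h\<^sup>T * ?d)) $$ (k, l) = 0)"
    unfolding Qchar_def mem_Collect_eq v10 v20 v12 v22 using vc vJ by auto
  have ih: "(i * h) $$ (k, l) = i $$ (k, 0) * h $$ (0, l) + i $$ (k, 1) * h $$ (1, l)" if "k < 2" "l < ?m" for k l
    using that d(3,5) by (simp add: scalar_prod_def numeral_2_eq_2)
  have AB: "(A * (C + T)) $$ (k, l) = (\<Sum>j<r. A $$ (k, j) * (C $$ (j, l) + T $$ (j, l)))"
    if "k < r" "l < r" "A $$ (k, r) = 0" for k l
    using that Ac Cc Tc by (simp add: scalar_prod_def atLeast0LessThan)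
  have T0: "T $$ (j, l) = 0" if "\<forall>k<2. \<forall>l<r. h $$ (k, l) = 0" "j < r" "l < r" for j l
    unfolding T_def using gram_index[OF d(3), of j l \<epsilon>] that by simp
  show ?thesis
  proof
    assume "\<sigma> r * qpar ?m \<epsilon> (A, i, h, C) * \<sigma> r \<in> Qgrp (Suc ?m) \<epsilon>"
    hence "v \<in> Qchar ?m \<epsilon>" unfolding Qgrp_eq_Qchar v_def w_def .
    hence c: "\<forall>k<r. A $$ (k, r) = 0" "\<forall>k<r. \<forall>l<r. (A * (C + T)) $$ (k, l) = 0" "\<forall>k<2. \<forall>l<r. (i * h) $$ (k, l) = 0"
      unfolding main by blast+
    have h0: "h $$ (k, l) = 0" if "k < 2" "l < r" for k l
    proof -
      obtain j where j: "j \<in> GL 2" "j * i = 1\<^sub>m 2" using GL_inverse[OF SOminus_1_GL[OF d(2)]] by metis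
      have jc: "j \<in> carrier_mat 2 2" using j GL_carrier by blast
      have "h = j * (i * h)" using assoc_mult_mat[OF jc d(5,3)] j d(3) by simp
      hence "h $$ (k, l) = (j * (i * h)) $$ (k, l)" by simp
      also have "\<dots> = (\<Sum>t<2. j $$ (k, t) * (i * h) $$ (t, l))"
        using that jc d(3,5) by (simp add: scalar_prod_def atLeast0LessThan)
      also have "\<dots> = 0" using c(3) that by simp
      finally show ?thesis .
    qed
    hence "\<forall>k<2. \<forall>l<r. h $$ (k, l) = 0" by blast
    note T00 = T0[OF this]
    have "C $$ (k, l) = 0" if kl: "k < r" "l < r" for k l
    proof (rule corner_left_cancel[OF d(1) c(1) kl(1)])
      fix t assume t: "t < r"
      show "(\<Sum>k<r. A $$ (t, k) * C $$ (k, l)) = 0"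
        using AB[OF t kl(2)] c(1,2) t kl T00 by simp
    qed
    thus "(A, i, h, C) \<in> stab_dom r \<epsilon>" using d c h0 unfolding stab_dom_def by blast
  next
    assume "(A, i, h, C) \<in> stab_dom r \<epsilon>"
    hence s: "\<forall>k<r. A $$ (k, r) = 0" "\<forall>k<2. \<forall>l<r. h $$ (k, l) = 0" "\<forall>k<r. \<forall>l<r. C $$ (k, l) = 0"
      unfolding stab_dom_def by blast+
    have "R $$ (l, r) = 0" if "l < r" for l unfolding R_def using corner_inverse(3)[OF d(1) s(1) that] .
    moreover have "(A * (C + T)) $$ (k, l) = 0" if "k < r" "l < r" for k l
      using AB[OF that] s T0[OF s(2)] that by simp
    moreover have "(i * h) $$ (k, l) = 0" if "k < 2" "l < r" for k l
      using ih[of k l] s(2) that by simp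
    moreover have "(A * (h\<^sup>T * ?d)) $$ (k, l) = 0" if "k < r" "l < 2" for k l
    proof -
      have "(A * (h\<^sup>T * ?d)) $$ (k, l) = (\<Sum>j<?m. A $$ (k, j) * (h\<^sup>T * ?d) $$ (j, l))"
        using that Ac d(3) by (simp add: scalar_prod_def atLeast0LessThan del: sum.lessThan_Suc)
      also have "\<dots> = (\<Sum>j<r. A $$ (k, j) * (h\<^sup>T * ?d) $$ (j, l))" using s(1) that by simp
      also have "\<dots> = 0"
      proof (rule sum.neutral, rule ballI)
        fix j assume "j \<in> {..<r}"
        hence "(h\<^sup>T * ?d) $$ (j, l) = 0" using s(2) d(3) that by (simp add: scalar_prod_def numeral_2_eq_2)
        thus "A $$ (k, j) * (h\<^sup>T * ?d) $$ (j, l) = 0" by simp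
      qed
      finally show ?thesis .
    qed
    ultimately have "v \<in> Qchar ?m \<epsilon>" unfolding main using s by blast
    thus "\<sigma> r * qpar ?m \<epsilon> (A, i, h, C) * \<sigma> r \<in> Qgrp (Suc ?m) \<epsilon>" unfolding Qgrp_eq_Qchar v_def w_def .
  qed
qed

lemma stab_dom_subset: "stab_dom r \<epsilon> \<subseteq> qdom (Suc r) \<epsilon>"
  unfolding stab_dom_def qdom_def by blast

lemma card_stab:
  fixes \<epsilon> :: 'a
  assumes "\<epsilon> \<noteq> 0" "\<nexists>b. \<epsilon> = b ^ 2"
  shows "card {w \<in> Qgrp (Suc (Suc r)) \<epsilon>. \<sigma> r * w * \<sigma> r \<in> Qgrp (Suc (Suc r)) \<epsilon>}
    = ((q - 1) * q ^ r * card (GL r :: 'a mat set)) * (q + 1) * q ^ 2 * q ^ r"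
proof -
  have "{w \<in> Qgrp (Suc (Suc r)) \<epsilon>. \<sigma> r * w * \<sigma> r \<in> Qgrp (Suc (Suc r)) \<epsilon>} = qpar (Suc r) \<epsilon> ` stab_dom r \<epsilon>"
  proof (intro equalityI subsetI)
    fix w assume "w \<in> {w \<in> Qgrp (Suc (Suc r)) \<epsilon>. \<sigma> r * w * \<sigma> r \<in> Qgrp (Suc (Suc r)) \<epsilon>}"
    then obtain A i h C where "w = qpar (Suc r) \<epsilon> (A, i, h, C)" "(A, i, h, C) \<in> qdom (Suc r) \<epsilon>"
      "\<sigma> r * w * \<sigma> r \<in> Qgrp (Suc (Suc r)) \<epsilon>"
      unfolding Qgrp_eq_image[of "Suc r"] by auto
    thus "w \<in> qpar (Suc r) \<epsilon> ` stab_dom r \<epsilon>" using stab_iff by blast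
  next
    fix w assume "w \<in> qpar (Suc r) \<epsilon> ` stab_dom r \<epsilon>"
    then obtain A i h C where w: "w = qpar (Suc r) \<epsilon> (A, i, h, C)" "(A, i, h, C) \<in> stab_dom r \<epsilon>" by auto
    moreover from this have "(A, i, h, C) \<in> qdom (Suc r) \<epsilon>" using stab_dom_subset by blast
    ultimately show "w \<in> {w \<in> Qgrp (Suc (Suc r)) \<epsilon>. \<sigma> r * w * \<sigma> r \<in> Qgrp (Suc (Suc r)) \<epsilon>}"
      using stab_iff Qgrp_eq_image[of "Suc r" \<epsilon>] by blast
  qed
  moreover have "card (qpar (Suc r) \<epsilon> ` stab_dom r \<epsilon>) = card (stab_dom r \<epsilon>)"
    by (rule card_image[OF inj_on_subset[OF qpar_inj stab_dom_subset]])
  \<comment> \<open>Two free entries, those of the last column.\<close>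
  moreover have "card {h \<in> carrier_mat 2 (Suc r). \<forall>i<2. \<forall>j<r. h $$ (i, j) = (0::'a)} = q ^ 2"
  proof -
    have "bij_betw (\<lambda>c. mat 2 (Suc r) (\<lambda>(i, j). if j = r then c $$ (i, 0) else 0)) (carrier_mat 2 1)
      {h \<in> carrier_mat 2 (Suc r). \<forall>i<2. \<forall>j<r. h $$ (i, j) = (0::'a)}"
      by (rule bij_betw_byWitness[where f' = "\<lambda>h. mat 2 1 (\<lambda>(i, _). h $$ (i, r))"])
         (auto intro!: eq_matI simp: less_Suc_eq)
    from bij_betw_same_card[OF this] show ?thesis by (simp add: card_carrier_mat card_UNIV)
  qed
  \<comment> \<open>Only the border column is free; the diagonal corner is 0.\<close>
  moreover have "card {C \<in> Skew (Suc r). \<forall>i<r. \<forall>j<r. C $$ (i, j) = (0::'a)} = q ^ r"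
  proof -
    let ?f = "\<lambda>(C, u). four_block_mat C u (- u\<^sup>T) (sc 0)"
    have "bij_betw ?f ({0\<^sub>m r r} \<times> carrier_mat r 1) {C \<in> Skew (Suc r). \<forall>i<r. \<forall>j<r. C $$ (i, j) = (0::'a)}"
    proof (rule bij_betw_subset[OF bij_betw_Skew_Suc])
      have "0\<^sub>m r r \<in> (Skew r :: 'a mat set)" by (auto simp: Skew_def intro!: eq_matI)
      thus "{0\<^sub>m r r} \<times> carrier_mat r 1 \<subseteq> (Skew r :: 'a mat set) \<times> (carrier_mat r 1 :: 'a mat set)" by auto
      show "?f ` ({0\<^sub>m r r} \<times> carrier_mat r 1) = {C \<in> Skew (Suc r). \<forall>i<r. \<forall>j<r. C $$ (i, j) = (0::'a)}"
      proof (intro equalityI subsetI)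
        fix M :: "'a mat" assume "M \<in> ?f ` ({0\<^sub>m r r} \<times> carrier_mat r 1)"
        then obtain u where u: "u \<in> carrier_mat r 1" "M = ?f (0\<^sub>m r r, u)" by auto
        have "M \<in> Skew (Suc r)" unfolding u(2)
          by (rule bij_betw_apply[OF bij_betw_Skew_Suc]) (use u \<open>0\<^sub>m r r \<in> Skew r\<close> in auto)
        thus "M \<in> {C \<in> Skew (Suc r). \<forall>i<r. \<forall>j<r. C $$ (i, j) = 0}" using u by auto
      next
        fix M :: "'a mat" assume M: "M \<in> {C \<in> Skew (Suc r). \<forall>i<r. \<forall>j<r. C $$ (i, j) = 0}"
        then obtain C u where b: "C \<in> Skew r" "u \<in> carrier_mat r 1" "M = ?f (C, u)"
          unfolding bij_betw_imp_surj_on[OF bij_betw_Skew_Suc, symmetric] by auto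
        have c: "C \<in> carrier_mat r r" using b by (simp add: Skew_def)
        have "C $$ (i, j) = 0" if "i < r" "j < r" for i j
        proof -
          have "M $$ (i, j) = C $$ (i, j)" using that b c by simp
          thus ?thesis using M that by simp
        qed
        hence "C = 0\<^sub>m r r" using c by (intro eq_matI) auto
        thus "M \<in> ?f ` ({0\<^sub>m r r} \<times> carrier_mat r 1)" using b by auto
      qed
    qed
    from bij_betw_same_card[OF this] show ?thesis by (simp add: card_cartesian_product card_carrier_mat card_UNIV)
  qed
  ultimately show ?thesis
    by (simp only: stab_dom_def card_cartesian_product card_GL_corner card_SOminus_1[OF assms] card_UNIV mult.assoc)
qed

end


subsection \<open>The exponential sum over the double coset\<close>

context ternary
begin

text \<open>Translation by \<open>D\<close> multiplies the sum by \<open>\<chi> (L D)\<close>, which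
  is not 1.\<close>

lemma skew_character_sum_zero:
  fixes L :: "'a mat \<Rightarrow> 'a"
  assumes add: "\<And>C D. C \<in> Skew m \<Longrightarrow> D \<in> Skew m \<Longrightarrow> L (C + D) = L C + L D"
    and D: "D \<in> Skew m" "\<chi> (L D) \<noteq> 1"
  shows "(\<Sum>C\<in>Skew m. \<chi> (L C)) = 0"
proof -
  have c: "C \<in> carrier_mat m m" "C\<^sup>T = - C" if "C \<in> Skew m" for C :: "'a mat" using that by (auto simp: Skew_def)
  have uc: "- C \<in> Skew m" if "C \<in> Skew m" for C :: "'a mat"
    using c[OF that] by (simp add: Skew_def transpose_uminus)
  have ac: "C + E \<in> Skew m" if "C \<in> Skew m" "E \<in> Skew m" for C E :: "'a mat"
  proof -
    have "(C + E)\<^sup>T = - C + - E" using c[OF that(1)] c[OF that(2)] by (simp add: transpose_add[of _ m m])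
    also have "\<dots> = - (C + E)" using c[OF that(1)] c[OF that(2)] by (intro eq_matI) auto
    finally show ?thesis using c[OF that(1)] c[OF that(2)] by (simp add: Skew_def)
  qed
  have "(\<Sum>C\<in>Skew m. \<chi> (L C)) = (\<Sum>C\<in>Skew m. \<chi> (L (C + D)))"
  proof (rule sum.reindex_bij_witness[of _ "\<lambda>C. C + D" "\<lambda>C. C + - D"])
    fix C assume C: "C \<in> (Skew m :: 'a mat set)"
    show e: "C + - D + D = C" using c[OF C] c[OF D(1)] by (intro eq_matI) auto
    show "C + D + - D = C" using c[OF C] c[OF D(1)] by (intro eq_matI) auto
    show "C + D \<in> Skew m" "C + - D \<in> Skew m" using ac uc C D by auto
    show "\<chi> (L (C + - D + D)) = \<chi> (L C)" by (simp only: e)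
  qed
  also have "\<dots> = \<chi> (L D) * (\<Sum>C\<in>Skew m. \<chi> (L C))"
    using add D by (simp add: lam_add sum_distrib_left mult.commute)
  finally show ?thesis using D(2) by auto
qed

text \<open>The contribution of block (0,1) to the trace of \<open>w \<sigma>\<close>: the last
  diagonal position is left out because \<sigma> does not move it.\<close>

definition partial_tr :: "nat \<Rightarrow> 'a mat \<Rightarrow> 'a" where
  "partial_tr r M = (\<Sum>i<r. M $$ (i, i))"

lemma partial_tr_mult:
  assumes "A \<in> carrier_mat (Suc r) (Suc r)" "B \<in> carrier_mat (Suc r) (Suc r)"
  shows "partial_tr r (A * B) = (\<Sum>i<r. \<Sum>k<Suc r. A $$ (i, k) * B $$ (k, i))"
  using assms by (simp add: partial_tr_def scalar_prod_def atLeast0LessThan del: sum.lessThan_Suc)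

text \<open>The sum over the skew part kills all \<open>A\<close> except the block lower triangular ones with symmetric corner.\<close>

lemma sum_skew:
  fixes A :: "'a mat"
  assumes A: "A \<in> carrier_mat (Suc r) (Suc r)" and a: "a \<noteq> 0"
  shows "(\<Sum>C\<in>Skew (Suc r). \<chi> (a * partial_tr r (A * C)))
    = (if (\<forall>i<r. A $$ (i, r) = 0) \<and> (\<forall>i<r. \<forall>j<r. A $$ (i, j) = A $$ (j, i)) then of_nat (card (Skew (Suc r) :: 'a mat set)) else 0)"
proof (cases "(\<forall>i<r. A $$ (i, r) = 0) \<and> (\<forall>i<r. \<forall>j<r. A $$ (i, j) = A $$ (j, i))")
  case True
  \<comment> \<open>Trace of symmetric times skew: transposing shows that it equals its own
    negative.\<close>
  have "partial_tr r (A * C) = 0" if C: "C \<in> Skew (Suc r)" for C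
  proof -
    have Cc: "C \<in> carrier_mat (Suc r) (Suc r)" and Ct: "C\<^sup>T = - C" using C by (auto simp: Skew_def)
    have sk: "C $$ (k, i) = - C $$ (i, k)" if "i < r" "k < r" for i k
      using arg_cong[OF Ct, of "\<lambda>M. M $$ (i, k)"] Cc that by simp
    have e: "partial_tr r (A * C) = (\<Sum>i<r. \<Sum>k<r. A $$ (i, k) * C $$ (k, i))"
      unfolding partial_tr_mult[OF A Cc] using True by simp
    also have "\<dots> = (\<Sum>k<r. \<Sum>i<r. A $$ (i, k) * C $$ (k, i))" by (rule sum.swap)
    also have "\<dots> = (\<Sum>k<r. \<Sum>i<r. - (A $$ (k, i) * C $$ (i, k)))"
    proof (intro sum.cong refl)
      fix k i assume ki: "k \<in> {..<r}" "i \<in> {..<r}"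
      hence "A $$ (i, k) = A $$ (k, i)" using True by blast
      moreover have "C $$ (k, i) = - C $$ (i, k)" using sk ki by blast
      ultimately show "A $$ (i, k) * C $$ (k, i) = - (A $$ (k, i) * C $$ (i, k))" by simp
    qed
    also have "\<dots> = - partial_tr r (A * C)" unfolding e by (simp add: sum_negf)
    finally show ?thesis using neg_eq_iff by metis
  qed
  thus ?thesis using True by simp
next
  case False
  \<comment> \<open>Either some entry of the last column is nonzero (\<open>l = r\<close>), or the
    corner is not symmetric. For \<open>l = r\<close> the mirrored entry counts as 0, since the
    partial trace omits row \<open>r\<close>.\<close>
  have "\<exists>k l. k < r \<and> l < Suc r \<and> k \<noteq> l \<and> A $$ (k, l) - (if l < r then A $$ (l, k) else 0) \<noteq> 0"
  proof (cases "\<forall>i<r. A $$ (i, r) = 0")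
    case True
    with False obtain i j where "i < r" "j < r" "A $$ (i, j) \<noteq> A $$ (j, i)" by blast
    thus ?thesis by (intro exI[of _ i] exI[of _ j]) auto
  next
    case False
    then obtain i where "i < r" "A $$ (i, r) \<noteq> 0" by blast
    thus ?thesis by (intro exI[of _ i] exI[of _ r]) auto
  qed
  then obtain k l where kl: "k < r" "l < Suc r" "k \<noteq> l"
    and c: "A $$ (k, l) - (if l < r then A $$ (l, k) else 0) \<noteq> 0" (is "?c \<noteq> 0") by blast
  obtain y :: 'a where y: "\<chi> y \<noteq> 1" using lam_nontrivial by blast
  \<comment> \<open>Scaled so that the elementary skew matrix \<open>D\<close> at
    \<open>(k, l)\<close> is sent to \<open>y\<close>, where the character is not 1.\<close>
  define t where "t = y / (a * ?c)"
  define D where "D = mat (Suc r) (Suc r) (\<lambda>(i, j). if i = l \<and> j = k then t else if i = k \<and> j = l then - t else 0)"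
  have Dc: "D \<in> carrier_mat (Suc r) (Suc r)" by (simp add: D_def)
  have "D\<^sup>T = - D" using kl by (intro eq_matI) (auto simp: D_def)
  hence D: "D \<in> Skew (Suc r)" using Dc by (simp add: Skew_def)
  have inner: "(\<Sum>j<Suc r. A $$ (i, j) * D $$ (j, i))
      = (if i = k then A $$ (k, l) * t else if i = l then - (A $$ (l, k) * t) else 0)" if "i < r" for i
  proof -
    have "(\<Sum>j<Suc r. A $$ (i, j) * D $$ (j, i)) = (\<Sum>j<Suc r. if j = (if i = k then l else k)
        then A $$ (i, j) * D $$ (j, i) else 0)"
      by (rule sum.cong) (use that kl in \<open>auto simp: D_def\<close>)
    also have "\<dots> = A $$ (i, if i = k then l else k) * D $$ (if i = k then l else k, i)"
      using kl by (simp del: sum.lessThan_Suc)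
    finally show ?thesis using kl that by (auto simp: D_def)
  qed
  have "partial_tr r (A * D) = (\<Sum>i<r. if i = k then A $$ (k, l) * t else if i = l then - (A $$ (l, k) * t) else 0)"
    unfolding partial_tr_mult[OF A Dc] by (rule sum.cong) (auto simp: inner simp del: sum.lessThan_Suc)
  also have "\<dots> = (\<Sum>i<r. (if i = k then A $$ (k, l) * t else 0) + (if i = l then - (A $$ (l, k) * t) else 0))"
    by (rule sum.cong) (use kl in auto)
  also have "\<dots> = A $$ (k, l) * t + (if l < r then - (A $$ (l, k) * t) else 0)"
    using kl by (simp add: sum.distrib)
  also have "\<dots> = ?c * t" by (simp add: algebra_simps)
  finally have "a * partial_tr r (A * D) = y" using a c by (simp add: t_def)
  hence nt: "\<chi> (a * partial_tr r (A * D)) \<noteq> 1" using y by simp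
  have "(\<Sum>C\<in>Skew (Suc r). \<chi> (a * partial_tr r (A * C))) = 0"
  proof (rule skew_character_sum_zero[where L = "\<lambda>C. a * partial_tr r (A * C)", OF _ D nt])
    fix C E :: "'a mat" assume "C \<in> Skew (Suc r)" "E \<in> Skew (Suc r)"
    hence ce: "C \<in> carrier_mat (Suc r) (Suc r)" "E \<in> carrier_mat (Suc r) (Suc r)" by (auto simp: Skew_def)
    have "A * (C + E) = A * C + A * E" by (rule mult_add_distrib_mat[OF A ce])
    thus "a * partial_tr r (A * (C + E)) = a * partial_tr r (A * C) + a * partial_tr r (A * E)"
      using A ce by (simp add: partial_tr_def sum.distrib distrib_left)
  qed
  thus ?thesis by (simp only: False if_False)
qed

text \<open>The first \<open>r\<close> entries of the two rows of \<open>h\<close> enter through the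
  form of \<open>A\<close>, with coefficients 1 and \<open>- \<epsilon>\<close>, which gives two
  Gauss sums; the last column of \<open>h\<close> is free and gives
  \<open>q\<^sup>2\<close>.\<close>

lemma sum_gram_character:
  fixes A :: "'a mat"
  assumes eps: "\<epsilon> \<noteq> 0" "\<nexists>b. \<epsilon> = b ^ 2" and a: "a \<noteq> 0" and A: "A \<in> SymGL r" and v: "v \<in> carrier_mat 1 r"
  shows "(\<Sum>h\<in>carrier_mat 2 (Suc r). \<chi> (a * partial_tr r (four_block_mat A (0\<^sub>m r 1) v (sc x) * (h\<^sup>T * delta_eps \<epsilon> * h))))
    = of_nat q ^ 2 * (- of_nat q) ^ r"
proof -
  let ?M = "four_block_mat A (0\<^sub>m r 1) v (sc x)"
  have Ac: "A \<in> carrier_mat r r" using A by (simp add: SymGL_def GL_def)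
  have Mc: "?M \<in> carrier_mat (Suc r) (Suc r)" using Ac by (intro carrier_matI) auto
  define z where "z t h = mat r 1 (\<lambda>(j, _). h $$ (t, j))" for t and h :: "'a mat"
  have zc: "z t h \<in> carrier_mat r 1" for t h by (simp add: z_def)
  have pt: "partial_tr r (?M * (h\<^sup>T * delta_eps \<epsilon> * h)) = quad_form A (z 0 h) - \<epsilon> * quad_form A (z 1 h)"
    if h: "h \<in> carrier_mat 2 (Suc r)" for h
  proof -
    have "partial_tr r (?M * (h\<^sup>T * delta_eps \<epsilon> * h))
      = (\<Sum>i<r. \<Sum>k<r. A $$ (i, k) * (h $$ (0, k) * h $$ (0, i) - \<epsilon> * (h $$ (1, k) * h $$ (1, i))))"
      unfolding partial_tr_mult[OF Mc gram_carrier[OF h]]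
    proof (rule sum.cong[OF refl])
      fix i assume i: "i \<in> {..<r}"
      have "(\<Sum>k<Suc r. ?M $$ (i, k) * (h\<^sup>T * delta_eps \<epsilon> * h) $$ (k, i))
        = (\<Sum>k<r. ?M $$ (i, k) * (h\<^sup>T * delta_eps \<epsilon> * h) $$ (k, i))" using i Ac by simp
      also have "\<dots> = (\<Sum>k<r. A $$ (i, k) * (h $$ (0, k) * h $$ (0, i) - \<epsilon> * (h $$ (1, k) * h $$ (1, i))))"
      proof (rule sum.cong[OF refl])
        fix k assume k: "k \<in> {..<r}"
        have "(h\<^sup>T * delta_eps \<epsilon> * h) $$ (k, i) = h $$ (0, k) * h $$ (0, i) - \<epsilon> * (h $$ (1, k) * h $$ (1, i))"
          using gram_index[OF h, of k i \<epsilon>] i k by simp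
        thus "?M $$ (i, k) * (h\<^sup>T * delta_eps \<epsilon> * h) $$ (k, i)
          = A $$ (i, k) * (h $$ (0, k) * h $$ (0, i) - \<epsilon> * (h $$ (1, k) * h $$ (1, i)))" using i k Ac by simp
      qed
      finally show "(\<Sum>k<Suc r. ?M $$ (i, k) * (h\<^sup>T * delta_eps \<epsilon> * h) $$ (k, i))
        = (\<Sum>k<r. A $$ (i, k) * (h $$ (0, k) * h $$ (0, i) - \<epsilon> * (h $$ (1, k) * h $$ (1, i))))" .
    qed
    also have "\<dots> = (\<Sum>i<r. \<Sum>k<r. z 0 h $$ (i, 0) * A $$ (i, k) * z 0 h $$ (k, 0))
        - \<epsilon> * (\<Sum>i<r. \<Sum>k<r. z 1 h $$ (i, 0) * A $$ (i, k) * z 1 h $$ (k, 0))"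
      unfolding sum_distrib_left sum_subtractf[symmetric]
      by (intro sum.cong refl) (simp add: z_def algebra_simps)
    finally show ?thesis unfolding quad_form_sum[OF Ac zc] .
  qed
  let ?Z = "carrier_mat r 1 :: 'a mat set"
  let ?g = "\<lambda>(u, v, c, d). mat 2 (Suc r) (\<lambda>(i, j). if j < r then (if i = 0 then u else v) $$ (j, 0) else if i = 0 then c else d) :: 'a mat"
  have "(\<Sum>h\<in>carrier_mat 2 (Suc r). \<chi> (a * partial_tr r (?M * (h\<^sup>T * delta_eps \<epsilon> * h))))
    = (\<Sum>(u, v, c, d)\<in>?Z \<times> ?Z \<times> (UNIV :: 'a set) \<times> (UNIV :: 'a set). \<chi> (a * quad_form A u) * \<chi> (- a * \<epsilon> * quad_form A v))"
  proof (rule sum.reindex_bij_witness[of _ ?g "\<lambda>h. (z 0 h, z 1 h, h $$ (0, r), h $$ (1, r))"])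
    fix h :: "'a mat" assume h: "h \<in> carrier_mat 2 (Suc r)"
    show "?g (z 0 h, z 1 h, h $$ (0, r), h $$ (1, r)) = h"
    proof (rule eq_matI)
      fix i j assume "i < dim_row h" "j < dim_col h"
      hence "i = 0 \<or> i = 1" "j < r \<or> j = r" using h by auto
      thus "?g (z 0 h, z 1 h, h $$ (0, r), h $$ (1, r)) $$ (i, j) = h $$ (i, j)" by (auto simp: z_def)
    qed (use h in auto)
    show "(case (z 0 h, z 1 h, h $$ (0, r), h $$ (1, r)) of (u, v, c, d) \<Rightarrow>
        \<chi> (a * quad_form A u) * \<chi> (- a * \<epsilon> * quad_form A v))
      = \<chi> (a * partial_tr r (?M * (h\<^sup>T * delta_eps \<epsilon> * h)))"
      unfolding pt[OF h] prod.case lam_add[symmetric] by (simp add: algebra_simps)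
    show "(z 0 h, z 1 h, h $$ (0, r), h $$ (1, r)) \<in> ?Z \<times> ?Z \<times> UNIV \<times> UNIV" using zc by simp
  next
    fix p :: "'a mat \<times> 'a mat \<times> 'a \<times> 'a" assume "p \<in> ?Z \<times> ?Z \<times> UNIV \<times> UNIV"
    then obtain u v c d where p: "p = (u, v, c, d)" "u \<in> ?Z" "v \<in> ?Z" by auto
    show "?g p \<in> carrier_mat 2 (Suc r)" unfolding p by simp
    have "z 0 (?g p) = u" "z 1 (?g p) = v" using p by (auto simp: z_def intro!: eq_matI)
    thus "(z 0 (?g p), z 1 (?g p), ?g p $$ (0, r), ?g p $$ (1, r)) = p" unfolding p by simp
  qed
  also have "\<dots> = (\<Sum>u\<in>?Z. \<Sum>v\<in>?Z. \<Sum>c\<in>(UNIV :: 'a set). \<Sum>d\<in>(UNIV :: 'a set). \<chi> (a * quad_form A u) * \<chi> (- a * \<epsilon> * quad_form A v))"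
    by (simp only: sum.cartesian_product)
  also have "\<dots> = (\<Sum>u\<in>?Z. \<Sum>v\<in>?Z. of_nat q ^ 2 * (\<chi> (a * quad_form A u) * \<chi> (- a * \<epsilon> * quad_form A v)))"
    by (simp only: sum_constant card_UNIV power2_eq_square mult.assoc)
  also have "\<dots> = of_nat q ^ 2 * ((\<Sum>u\<in>?Z. \<chi> (a * quad_form A u)) * (\<Sum>v\<in>?Z. \<chi> (- a * \<epsilon> * quad_form A v)))"
    by (subst sum_product) (simp only: sum_distrib_left)
  also have "\<dots> = of_nat q ^ 2 * (quad_gauss a A * quad_gauss (- a * \<epsilon>) A)"
    unfolding quad_gauss_def carrier_matD(1)[OF Ac] ..
  finally show ?thesis unfolding quad_gauss_mult_norm[OF eps a A] .
qed

text \<open>Coordinates on the matrices \<open>A\<close> that survive the sum over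
  \<open>C\<close>.\<close>

lemma bij_betw_sym_corner:
  "bij_betw (\<lambda>(A, v, x). four_block_mat A (0\<^sub>m r 1) v (sc x))
    (SymGL r \<times> carrier_mat 1 r \<times> (UNIV - {0}))
    {A \<in> GL (Suc r). (\<forall>i<r. A $$ (i, r) = 0) \<and> (\<forall>i<r. \<forall>j<r. A $$ (i, j) = A $$ (j, i :: nat) :: bool)}"
  (is "bij_betw ?f ?X ?Y")
proof (rule bij_betw_subset[OF bij_betw_GL_corner])
  show "?X \<subseteq> GL r \<times> carrier_mat 1 r \<times> (UNIV - {0})" by (auto simp: SymGL_def)
  have idx: "?f (A, v, x) $$ (i, j) = A $$ (i, j)" if "A \<in> carrier_mat r r" "i < r" "j < r" for A v x i j
    using that by simp
  show "?f ` ?X = ?Y"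
  proof (intro equalityI subsetI)
    fix M assume "M \<in> ?f ` ?X"
    then obtain A v x where b: "A \<in> SymGL r" "v \<in> carrier_mat 1 r" "x \<noteq> 0" "M = ?f (A, v, x)" by auto
    have "?f (A, v, x) \<in> {A \<in> GL (Suc r). \<forall>i<r. A $$ (i, r) = 0}"
      by (rule bij_betw_apply[OF bij_betw_GL_corner]) (use b in \<open>auto simp: SymGL_def\<close>)
    moreover have Ac: "A \<in> carrier_mat r r" "A\<^sup>T = A" using b by (auto simp: SymGL_def GL_def)
    have "A $$ (i, j) = A $$ (j, i)" if "i < r" "j < r" for i j
      using arg_cong[OF Ac(2), of "\<lambda>M. M $$ (i, j)"] that Ac(1) by auto
    hence "?f (A, v, x) $$ (i, j) = ?f (A, v, x) $$ (j, i)" if "i < r" "j < r" for i j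
      using that idx[OF Ac(1) that, of v x] idx[OF Ac(1) that(2,1), of v x] by (simp only:)
    ultimately show "M \<in> ?Y" unfolding b(4) by blast
  next
    fix M assume M: "M \<in> ?Y"
    hence "M \<in> {A \<in> GL (Suc r). \<forall>i<r. A $$ (i, r) = 0}" by auto
    then obtain A v x where b: "A \<in> GL r" "v \<in> carrier_mat 1 r" "x \<noteq> 0" "M = ?f (A, v, x)"
      unfolding bij_betw_imp_surj_on[OF bij_betw_GL_corner, symmetric] by auto
    have Ac: "A \<in> carrier_mat r r" using b(1) GL_carrier by blast
    have "A\<^sup>T = A"
    proof (rule eq_matI)
      fix i j assume "i < dim_row A" "j < dim_col A"
      hence ij: "i < r" "j < r" using Ac by auto
      hence "M $$ (j, i) = M $$ (i, j)" using M by blast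
      thus "A\<^sup>T $$ (i, j) = A $$ (i, j)" using idx[OF Ac ij, of v x] idx[OF Ac ij(2,1), of v x] b(4) ij Ac by simp
    qed (use Ac in auto)
    with b show "M \<in> ?f ` ?X" by (intro image_eqI[of _ _ "(A, v, x)"]) (auto simp: SymGL_def)
  qed
qed

text \<open>For fixed \<open>A\<close> the parameters \<open>C\<close>, \<open>h\<close> and
  \<open>i\<close> sit in separate summands, so the character sum factors.\<close>

lemma mat_tr_qpar_sigma:
  assumes "(A, i, h, C) \<in> qdom (Suc r) \<epsilon>"
  shows "mat_tr (qpar (Suc r) \<epsilon> (A, i, h, C) * \<sigma> r)
    = partial_tr r (A * C) + partial_tr r (A * (h\<^sup>T * delta_eps \<epsilon> * h))
      + (A $$ (r, r) + mat_inv (Suc r) A $$ (r, r)) + mat_tr i"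
proof -
  note d = qdomD[OF assms] and b = blk_qpar[OF assms]
  define T where "T = h\<^sup>T * delta_eps \<epsilon> * h"
  have Ac: "A \<in> carrier_mat (Suc r) (Suc r)" and Rc: "mat_inv (Suc r) A \<in> carrier_mat (Suc r) (Suc r)"
    using d(1) mat_inv(1)[OF d(1)] GL_carrier by auto
  have Cc: "C \<in> carrier_mat (Suc r) (Suc r)" using d by (simp add: Skew_def)
  have Tc: "T \<in> carrier_mat (Suc r) (Suc r)" unfolding T_def using gram_carrier[OF d(3)] .
  have "mat_tr (qpar (Suc r) \<epsilon> (A, i, h, C) * \<sigma> r)
    = partial_tr r (A * (C + T)) + A $$ (r, r) + (mat_inv (Suc r) A)\<^sup>T $$ (r, r) + mat_tr i"
    using mat_tr_mult_sigma[OF b(1) b(5)[folded One_nat_def]]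
    unfolding One_nat_def b T_def partial_tr_def .
  also have "partial_tr r (A * (C + T)) = partial_tr r (A * C) + partial_tr r (A * T)"
    unfolding mult_add_distrib_mat[OF Ac Cc Tc] using Ac Cc Tc by (simp add: partial_tr_def sum.distrib)
  also have "(mat_inv (Suc r) A)\<^sup>T $$ (r, r) = mat_inv (Suc r) A $$ (r, r)" using Rc by simp
  finally show ?thesis unfolding T_def by (simp add: add_ac)
qed

text \<open>On the surviving \<open>A\<close> only the factor with \<open>x\<close> varies. The
  border \<open>v\<close> contributes \<open>q ^ r\<close>, and together with
  \<open>q\<^sup>2 * (- q) ^ r\<close> this makes \<open>q ^ (2 * r + 2)\<close> and the sign; the
  leading minus stems from the orthogonal factor.\<close>

lemma sum_Qgrp_sigma:
  assumes eps: "\<epsilon> \<noteq> 0" "\<nexists>b. \<epsilon> = b ^ 2" and a: "a \<noteq> 0"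
  shows "(\<Sum>w\<in>Qgrp (Suc (Suc r)) \<epsilon>. \<chi> (a * mat_tr (w * \<sigma> r)))
    = - ((-1) ^ r * of_nat (card (Skew (Suc r) :: 'a mat set) * q ^ (2 * r + 2) * card (SymGL r :: 'a mat set))
        * kloos s (a ^ 2) ^ 2)"
proof -
  let ?m = "Suc r" and ?K = "kloos s (a ^ 2)" and ?Sk = "Skew (Suc r) :: 'a mat set"
  let ?R = "\<lambda>A. mat_inv (Suc r) A"
  let ?X = "\<lambda>A. \<Sum>C\<in>?Sk. \<chi> (a * partial_tr r (A * C))"
  let ?Y = "\<lambda>A. \<Sum>h\<in>carrier_mat 2 ?m. \<chi> (a * partial_tr r (A * (h\<^sup>T * delta_eps \<epsilon> * h)))"
  let ?Z = "\<lambda>A. \<chi> (a * (A $$ (r, r) + ?R A $$ (r, r)))"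
  let ?W = "\<lambda>i. \<chi> (a * mat_tr i)"
  let ?AA = "{A \<in> GL (Suc r). (\<forall>i<r. A $$ (i, r) = (0::'a)) \<and> (\<forall>i<r. \<forall>j<r. A $$ (i, j) = A $$ (j, i))}"
  let ?f = "\<lambda>(A, v, x). four_block_mat A (0\<^sub>m r 1) v (sc x) :: 'a mat"
  have "(\<Sum>w\<in>Qgrp (Suc ?m) \<epsilon>. \<chi> (a * mat_tr (w * \<sigma> r))) = (\<Sum>p\<in>qdom ?m \<epsilon>. \<chi> (a * mat_tr (qpar ?m \<epsilon> p * \<sigma> r)))"
    unfolding Qgrp_eq_image sum.reindex[OF qpar_inj] o_def ..
  also have "\<dots> = (\<Sum>(A, i, h, C)\<in>qdom ?m \<epsilon>. ?Z A * ?W i * \<chi> (a * partial_tr r (A * (h\<^sup>T * delta_eps \<epsilon> * h)))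
      * \<chi> (a * partial_tr r (A * C)))"
  proof (rule sum.cong[OF refl], safe)
    fix A i h C assume "(A, i, h, C) \<in> qdom ?m \<epsilon>"
    from mat_tr_qpar_sigma[OF this]
    show "\<chi> (a * mat_tr (qpar ?m \<epsilon> (A, i, h, C) * \<sigma> r)) = ?Z A * ?W i
      * \<chi> (a * partial_tr r (A * (h\<^sup>T * delta_eps \<epsilon> * h))) * \<chi> (a * partial_tr r (A * C))"
      by (simp only: lam_add[symmetric] distrib_left add_ac)
  qed
  also have "\<dots> = (\<Sum>A\<in>GL ?m. \<Sum>i\<in>SOminus 1 \<epsilon>. \<Sum>h\<in>carrier_mat 2 ?m. \<Sum>C\<in>?Sk.
      ?Z A * ?W i * \<chi> (a * partial_tr r (A * (h\<^sup>T * delta_eps \<epsilon> * h))) * \<chi> (a * partial_tr r (A * C)))"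
    unfolding qdom_def by (simp only: sum.cartesian_product)
  also have "\<dots> = (\<Sum>A\<in>GL ?m. ?Z A * (\<Sum>i\<in>SOminus 1 \<epsilon>. ?W i) * ?Y A * ?X A)"
    by (simp only: sum_distrib_left[symmetric] sum_distrib_right[symmetric])
  also have "\<dots> = (\<Sum>A\<in>GL ?m. if A \<in> ?AA then ?Z A * (- ?K) * ?Y A * of_nat (card ?Sk) else 0)"
  proof (rule sum.cong[OF refl])
    fix A assume A: "A \<in> (GL ?m :: 'a mat set)"
    have AA: "A \<in> ?AA \<longleftrightarrow> (\<forall>i<r. A $$ (i, r) = 0) \<and> (\<forall>i<r. \<forall>j<r. A $$ (i, j) = A $$ (j, i))"
      using A by blast
    show "?Z A * (\<Sum>i\<in>SOminus 1 \<epsilon>. ?W i) * ?Y A * ?X A = (if A \<in> ?AA then ?Z A * (- ?K) * ?Y A * of_nat (card ?Sk) else 0)"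
      unfolding sum_skew[OF GL_carrier[OF A] a] sum_lam_SOminus_1[OF eps a] AA
      by (simp only: if_distrib[of "\<lambda>z. _ * z"] mult_zero_right)
  qed
  also have "\<dots> = (\<Sum>A\<in>?AA. ?Z A * (- ?K) * ?Y A * of_nat (card ?Sk))"
    by (rule sum.mono_neutral_cong_right) auto
  also have "\<dots> = (\<Sum>p\<in>SymGL r \<times> carrier_mat 1 r \<times> (UNIV - {0}). ?Z (?f p) * (- ?K) * ?Y (?f p) * of_nat (card ?Sk))"
    by (rule sum.reindex_bij_betw[OF bij_betw_sym_corner, symmetric])
  also have "\<dots> = (\<Sum>(A, v, x)\<in>(SymGL r :: 'a mat set) \<times> (carrier_mat 1 r :: 'a mat set) \<times> (UNIV - {0::'a}).
      \<chi> (a * (x + inverse x)) * (- ?K * of_nat q ^ 2 * (- of_nat q) ^ r * of_nat (card ?Sk)))"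
  proof (rule sum.cong[OF refl])
    fix p :: "'a mat \<times> 'a mat \<times> 'a" assume p: "p \<in> SymGL r \<times> carrier_mat 1 r \<times> (UNIV - {0})"
    then obtain A v x where e: "p = (A, v, x)" "A \<in> SymGL r" "v \<in> carrier_mat 1 r" "x \<noteq> 0" by auto
    have "?f p \<in> {A \<in> GL (Suc r). \<forall>i<r. A $$ (i, r) = 0}"
      by (rule bij_betw_apply[OF bij_betw_GL_corner]) (use e in \<open>auto simp: SymGL_def\<close>)
    hence "?R (?f p) $$ (r, r) = inverse (?f p $$ (r, r))" using corner_inverse(2)[of "?f p" r] by blast
    moreover have "A \<in> carrier_mat r r" using e by (simp add: SymGL_def GL_def)
    hence "?f p $$ (r, r) = x" using e by simp
    ultimately have Z: "?Z (?f p) = \<chi> (a * (x + inverse x))" by simp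
    have Y: "?Y (?f p) = of_nat q ^ 2 * (- of_nat q) ^ r" unfolding e prod.case by (rule sum_gram_character[OF eps a e(2,3)])
    show "?Z (?f p) * (- ?K) * ?Y (?f p) * of_nat (card ?Sk) = (case p of (A, v, x) \<Rightarrow>
      \<chi> (a * (x + inverse x)) * (- ?K * of_nat q ^ 2 * (- of_nat q) ^ r * of_nat (card ?Sk)))"
      unfolding Z Y unfolding e prod.case by (simp only: mult_ac)
  qed
  also have "\<dots> = (\<Sum>A\<in>(SymGL r :: 'a mat set). \<Sum>v\<in>(carrier_mat 1 r :: 'a mat set). \<Sum>x\<in>UNIV - {0::'a}.
      \<chi> (a * (x + inverse x)) * (- ?K * of_nat q ^ 2 * (- of_nat q) ^ r * of_nat (card ?Sk)))"
    by (simp only: sum.cartesian_product)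
  also have "\<dots> = of_nat (card (SymGL r :: 'a mat set)) * (of_nat q ^ r *
      (?K * (- ?K * of_nat q ^ 2 * (- of_nat q) ^ r * of_nat (card ?Sk))))"
    unfolding sum_distrib_right[symmetric] kloos_square[OF a, symmetric] sum_constant card_carrier_mat card_UNIV by simp
  also have "\<dots> = - ((-1) ^ r * of_nat (card ?Sk * q ^ (2 * r + 2) * card (SymGL r :: 'a mat set)) * ?K ^ 2)"
  proof -
    have e1: "(of_nat (q ^ (2 * r + 2)) :: complex) = of_nat q ^ r * of_nat q ^ r * of_nat q ^ 2"
      by (simp only: power_add mult_2 of_nat_mult of_nat_power)
    have e2: "(- of_nat q) ^ r = (-1) ^ r * (of_nat q ^ r :: complex)" by (rule power_minus)
    show ?thesis
      unfolding of_nat_mult e1 e2 power2_eq_square[of ?K]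
      by (simp only: mult_minus_left mult_minus_right mult_ac)
  qed
  finally show ?thesis .
qed

end


section \<open>Closed formulas for the matrix counts and the two constants\<close>

context ternary
begin

text \<open>The two-term recurrence collapses to alternating one-term factors. Each parity uses the
  preceding step of the other, so both are proved in one induction.\<close>

lemma nSym_step: "card (SymGL (2 * k + 1) :: 'a mat set) = (q ^ (2 * k + 1) - 1) * card (SymGL (2 * k) :: 'a mat set)
  \<and> card (SymGL (2 * k + 2) :: 'a mat set) = q ^ (2 * k + 2) * card (SymGL (2 * k + 1) :: 'a mat set)"
proof (induction k)
  case 0
  have 1: "card (SymGL (Suc 0) :: 'a mat set) = q - 1" using card_SymGL_1[where ?'a = 'a] by (simp add: card_UNIV)
  have "card (SymGL (Suc (Suc 0)) :: 'a mat set) = (q - 1) * q * (q - 1) + (q - 1) * q"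
    using card_SymGL_Suc_Suc[of 0, where ?'a = 'a] by (simp add: card_UNIV 1 card_SymGL_0)
  also have "\<dots> = (q - 1) * q * (q - 1 + 1)" by (simp only: distrib_left mult_1_right)
  also have "q - 1 + 1 = q" using q_gt_1 by simp
  finally show ?case using 1 by (simp add: card_SymGL_0 numeral_2_eq_2)
next
  case (Suc k)
  define x where "x = q ^ (2 * k + 2)"
  have x: "x \<ge> 1" unfolding x_def using q_gt_1 by simp
  have q1: "q \<ge> 1" using q_gt_1 by simp
  have odd: "card (SymGL (2 * k + 3) :: 'a mat set) = (q * x - 1) * (x * card (SymGL (2 * k + 1) :: 'a mat set))"
  proof -
    have "card (SymGL (Suc (Suc (2 * k + 1))) :: 'a mat set) = (q - 1) * x * card (SymGL (Suc (2 * k + 1)) :: 'a mat set) + (x - 1) * x * card (SymGL (2 * k + 1) :: 'a mat set)"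
      using card_SymGL_Suc_Suc[of "2 * k + 1", where ?'a = 'a] by (simp add: card_UNIV x_def)
    also have "card (SymGL (Suc (2 * k + 1)) :: 'a mat set) = x * card (SymGL (2 * k + 1) :: 'a mat set)" using Suc by (simp add: x_def)
    also have "(q - 1) * x * (x * card (SymGL (2 * k + 1) :: 'a mat set)) + (x - 1) * x * card (SymGL (2 * k + 1) :: 'a mat set)
      = ((q - 1) * x + (x - 1)) * (x * card (SymGL (2 * k + 1) :: 'a mat set))"
      by (simp only: distrib_left distrib_right mult_ac)
    \<comment> \<open>Subtraction on naturals: this needs \<open>q \<ge> 1\<close> and
      \<open>x \<ge> 1\<close>.\<close>
    also have "(q - 1) * x + (x - 1) = q * x - 1"
      using x q1 by (simp add: diff_mult_distrib)
    finally show ?thesis by (simp add: numeral_3_eq_3)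
  qed
  have even: "card (SymGL (2 * k + 4) :: 'a mat set) = q * q * x * card (SymGL (2 * k + 3) :: 'a mat set)"
  proof -
    have "card (SymGL (Suc (Suc (2 * k + 2))) :: 'a mat set) = (q - 1) * (q * x) * card (SymGL (2 * k + 3) :: 'a mat set) + (q * x - 1) * (q * x) * card (SymGL (2 * k + 2) :: 'a mat set)"
      using card_SymGL_Suc_Suc[of "2 * k + 2", where ?'a = 'a] by (simp add: card_UNIV x_def numeral_3_eq_3)
    also have "card (SymGL (2 * k + 2) :: 'a mat set) = x * card (SymGL (2 * k + 1) :: 'a mat set)" using Suc by (simp add: x_def)
    also have "(q - 1) * (q * x) * card (SymGL (2 * k + 3) :: 'a mat set) + (q * x - 1) * (q * x) * (x * card (SymGL (2 * k + 1) :: 'a mat set))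
      = (q - 1) * (q * x) * card (SymGL (2 * k + 3) :: 'a mat set) + (q * x) * ((q * x - 1) * (x * card (SymGL (2 * k + 1) :: 'a mat set)))" by (simp only: mult_ac)
    also have "\<dots> = (q - 1 + 1) * ((q * x) * card (SymGL (2 * k + 3) :: 'a mat set))" unfolding odd by (simp only: distrib_left distrib_right mult_1_left mult_1_right mult_ac)
    also have "q - 1 + 1 = q" using q1 by simp
    finally show ?thesis by (simp add: mult_ac eval_nat_numeral)
  qed
  have i: "2 * Suc k = 2 * k + 2" "2 * Suc k + 1 = 2 * k + 3" "2 * Suc k + 2 = 2 * k + 4" by simp_all
  have p: "q ^ (2 * k + 3) = q * x" "q ^ (2 * k + 4) = q * q * x"
  proof -
    have "2 * k + 3 = Suc (2 * k + 2)" "2 * k + 4 = Suc (Suc (2 * k + 2))" by simp_all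
    thus "q ^ (2 * k + 3) = q * x" "q ^ (2 * k + 4) = q * q * x"
      unfolding x_def by (simp_all only: power_Suc mult.assoc)
  qed
  have "x * card (SymGL (2 * k + 1) :: 'a mat set) = card (SymGL (2 * k + 2) :: 'a mat set)" using Suc by (simp add: x_def)
  hence "card (SymGL (2 * k + 3) :: 'a mat set) = (q * x - 1) * card (SymGL (2 * k + 2) :: 'a mat set)"
    using odd by (simp only:)
  moreover have "2 * k + 2 + 1 = 2 * k + 3" "2 * k + 2 + 2 = 2 * k + 4" by simp_all
  ultimately show ?case unfolding i(1) using p even by (simp only:)
qed

lemma nSym_closed:
  "card (SymGL (2 * k) :: 'a mat set) = q ^ (k * (k + 1)) * (\<Prod>j=1..k. q ^ (2 * j - 1) - 1)"
  "card (SymGL (2 * k + 1) :: 'a mat set) = q ^ (k * (k + 1)) * (\<Prod>j=1..k + 1. q ^ (2 * j - 1) - 1)"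
proof -
  show e: "card (SymGL (2 * k) :: 'a mat set) = q ^ (k * (k + 1)) * (\<Prod>j=1..k. q ^ (2 * j - 1) - 1)"
  proof (induction k)
    case (Suc k)
    have "card (SymGL (2 * Suc k) :: 'a mat set) = q ^ (2 * k + 2) * ((q ^ (2 * k + 1) - 1) * card (SymGL (2 * k) :: 'a mat set))"
      using nSym_step[of k] by simp
    also have "\<dots> = (q ^ (2 * k + 2) * q ^ (k * (k + 1))) * ((\<Prod>j=1..k. q ^ (2 * j - 1) - 1) * (q ^ (2 * k + 1) - 1))"
      unfolding Suc.IH by (simp only: mult_ac)
    also have "q ^ (2 * k + 2) * q ^ (k * (k + 1)) = q ^ (Suc k * (Suc k + 1))"
      unfolding power_add[symmetric] by (rule arg_cong[where f = "\<lambda>e. q ^ e"]) simp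
    also have "(\<Prod>j=1..k. q ^ (2 * j - 1) - 1) * (q ^ (2 * k + 1) - 1) = (\<Prod>j=1..Suc k. q ^ (2 * j - 1) - 1)"
      by simp
    finally show ?case .
  qed (simp add: card_SymGL_0)
  have "card (SymGL (2 * k + 1) :: 'a mat set) = (q ^ (2 * k + 1) - 1) * card (SymGL (2 * k) :: 'a mat set)" using nSym_step[of k] by blast
  thus "card (SymGL (2 * k + 1) :: 'a mat set) = q ^ (k * (k + 1)) * (\<Prod>j=1..k + 1. q ^ (2 * j - 1) - 1)"
    unfolding e by (simp add: mult_ac)
qed

lemma nSkew_closed: "card (Skew (2 * k) :: 'a mat set) = q ^ (k * (2 * k - 1))" "card (Skew (2 * k + 1) :: 'a mat set) = q ^ (k * (2 * k + 1))"
proof -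
  show e: "card (Skew (2 * k) :: 'a mat set) = q ^ (k * (2 * k - 1))" for k
  proof (induction k)
    case (Suc k)
    have "card (Skew (2 * Suc k) :: 'a mat set) = q ^ (2 * k + 1) * (q ^ (2 * k) * card (Skew (2 * k) :: 'a mat set))"
      using card_Skew_Suc[of "2 * k + 1"] card_Skew_Suc[of "2 * k"] by simp
    also have "\<dots> = q ^ (2 * k + 1 + (2 * k + k * (2 * k - 1)))" unfolding Suc.IH by (simp only: power_add)
    also have "2 * k + 1 + (2 * k + k * (2 * k - 1)) = Suc k * (2 * Suc k - 1)"
      by (cases k) (simp_all add: algebra_simps)
    finally show ?case .
  qed (simp add: card_Skew_0)
  have "card (Skew (2 * k + 1) :: 'a mat set) = q ^ (2 * k + k * (2 * k - 1))"
    using card_Skew_Suc[of "2 * k"] e[of k] by (simp add: power_add)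
  also have "2 * k + k * (2 * k - 1) = k * (2 * k + 1)" by (cases k) (simp_all add: algebra_simps)
  finally show "card (Skew (2 * k + 1) :: 'a mat set) = q ^ (k * (2 * k + 1))" .
qed

lemma nGL_Suc: "card (GL (Suc k) :: 'a mat set) = (q ^ Suc k - 1) * q ^ k * card (GL k :: 'a mat set)"
  using card_GL_Suc[of k, where ?'a = 'a] by (simp only: card_UNIV)

text \<open>The order of the linear group with the number of symmetric matrices one size smaller
  split off; the cofactor is \<open>B2plus\<close> without its \<open>q + 1\<close>.\<close>

lemma nGL_odd: "card (GL (2 * k + 1) :: 'a mat set) = q ^ (k ^ 2) * (q ^ (2 * k + 1) - 1) * (\<Prod>j=1..k. q ^ (2 * j) - 1) * card (SymGL (2 * k) :: 'a mat set)"
proof (induction k)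
  case 0
  show ?case using nGL_Suc[of 0] by (simp add: card_GL_0 card_SymGL_0)
next
  case (Suc k)
  have i: "2 * Suc k + 1 = Suc (Suc (2 * k + 1))" "2 * Suc k = 2 * k + 2" by simp_all
  have "card (GL (2 * Suc k + 1) :: 'a mat set) = (q ^ (2 * Suc k + 1) - 1) * q ^ (2 * k + 2) * ((q ^ (2 * k + 2) - 1) * q ^ (2 * k + 1) * card (GL (2 * k + 1) :: 'a mat set))"
    unfolding i(1) nGL_Suc by simp
  also have "\<dots> = (q ^ (2 * k + 1) * q ^ (k ^ 2)) * (q ^ (2 * Suc k + 1) - 1) * ((\<Prod>j=1..k. q ^ (2 * j) - 1) * (q ^ (2 * k + 2) - 1))
      * (q ^ (2 * k + 2) * ((q ^ (2 * k + 1) - 1) * card (SymGL (2 * k) :: 'a mat set)))"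
    unfolding Suc.IH by (simp only: mult_ac)
  also have "q ^ (2 * k + 2) * ((q ^ (2 * k + 1) - 1) * card (SymGL (2 * k) :: 'a mat set)) = card (SymGL (2 * Suc k) :: 'a mat set)"
    using nSym_step[of k] by simp
  also have "(\<Prod>j=1..k. q ^ (2 * j) - 1) * (q ^ (2 * k + 2) - 1) = (\<Prod>j=1..Suc k. q ^ (2 * j) - 1)" by simp
  also have "q ^ (2 * k + 1) * q ^ (k ^ 2) = q ^ (Suc k ^ 2)"
    unfolding power_add[symmetric] by (rule arg_cong[where f = "\<lambda>e. q ^ e"]) (simp add: power2_eq_square)
  finally show ?case .
qed

lemma nGL_even: "card (GL (2 * k + 2) :: 'a mat set) = q ^ ((k + 1) ^ 2) * (\<Prod>j=1..k + 1. q ^ (2 * j) - 1) * card (SymGL (2 * k + 1) :: 'a mat set)"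
proof -
  have "card (GL (2 * k + 2) :: 'a mat set) = (q ^ (2 * k + 2) - 1) * q ^ (2 * k + 1) * card (GL (2 * k + 1) :: 'a mat set)"
    using nGL_Suc[of "2 * k + 1"] by simp
  also have "\<dots> = (q ^ (2 * k + 1) * q ^ (k ^ 2)) * ((\<Prod>j=1..k. q ^ (2 * j) - 1) * (q ^ (2 * k + 2) - 1))
      * ((q ^ (2 * k + 1) - 1) * card (SymGL (2 * k) :: 'a mat set))"
    unfolding nGL_odd by (simp only: mult_ac)
  also have "(q ^ (2 * k + 1) - 1) * card (SymGL (2 * k) :: 'a mat set) = card (SymGL (2 * k + 1) :: 'a mat set)" using nSym_step[of k] by simp
  also have "(\<Prod>j=1..k. q ^ (2 * j) - 1) * (q ^ (2 * k + 2) - 1) = (\<Prod>j=1..k + 1. q ^ (2 * j) - 1)" by simp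
  also have "q ^ (2 * k + 1) * q ^ (k ^ 2) = q ^ ((k + 1) ^ 2)"
    unfolding power_add[symmetric] by (rule arg_cong[where f = "\<lambda>e. q ^ e"]) (simp add: power2_eq_square)
  finally show ?thesis .
qed

text \<open>The division in \<open>qbin1\<close> is exact.\<close>

lemma qbin1_mult: "qbin1 q m * (q - 1) = q ^ m - 1"
proof -
  have "q - 1 dvd q ^ m - 1"
  proof (induction m)
    case (Suc m)
    have "q ^ Suc m - 1 = q ^ m * (q - 1) + (q ^ m - 1)"
    proof -
      obtain p where p: "q = Suc p" using q_gt_1 by (cases q) auto
      obtain x where x: "q ^ m = Suc x" using q_gt_1 by (cases "q ^ m") auto
      show ?thesis unfolding power_Suc x p by (simp add: algebra_simps)
    qed
    thus ?case by (simp only: dvd_add[OF dvd_triv_right Suc.IH])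
  qed simp
  thus ?thesis unfolding qbin1_def by simp
qed

text \<open>The parity-free form of \<open>A\<^sub>2\<^sup>+\<close> and \<open>A\<^sub>2\<^sup>-\<close>.\<close>

definition Aconst :: "'a itself \<Rightarrow> nat \<Rightarrow> nat" where
  "Aconst T r = qbin1 q (Suc r) * q ^ (2 * r) * card (Skew r :: 'a mat set) * (card (Skew (Suc r) :: 'a mat set) * q ^ (2 * r + 2) * card (SymGL r :: 'a mat set))"

text \<open>The products agree factor by factor; what remains is that the exponent of
  \<open>q\<close> adds up over \<open>q ^ (2 * r)\<close>, the two skew counts,
  \<open>q ^ (2 * r + 2)\<close> and the symmetric count.\<close>

lemma Aconst_plus: "Aconst TYPE('a) (2 * k) = A2plus (2 * k + 2) q"
proof -
  have e: "(5 * (2 * k + 2)^2 - 2 * (2 * k + 2) - 8) div 4 = 2 * (2 * k) + k * (2 * k - 1) + k * (2 * k + 1) + (2 * (2 * k) + 2) + k * (k + 1)"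
  proof -
    have "5 * (2 * k + 2)^2 = 4 * (5 * k^2 + 9 * k + 2) + (2 * (2 * k + 2) + 8)"
      by (simp add: power2_eq_square algebra_simps)
    hence "5 * (2 * k + 2)^2 - 2 * (2 * k + 2) - 8 = 4 * (5 * k^2 + 9 * k + 2)" by linarith
    moreover have "2 * (2 * k) + k * (2 * k - 1) + k * (2 * k + 1) + (2 * (2 * k) + 2) + k * (k + 1) = 5 * k^2 + 9 * k + 2"
      by (cases k) (simp_all add: power2_eq_square algebra_simps)
    ultimately show ?thesis by simp
  qed
  have i: "2 * k + 2 - 1 = Suc (2 * k)" "(2 * k + 2 - 2) div 2 = k" by simp_all
  have S: "card (Skew (Suc (2 * k)) :: 'a mat set) = q ^ (k * (2 * k + 1))" using nSkew_closed(2)[of k] by simp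
  show ?thesis unfolding Aconst_def A2plus_def e i nSkew_closed(1) S nSym_closed(1) power_add by (simp only: mult_ac)
qed

lemma Aconst_minus: "Aconst TYPE('a) (2 * k + 1) = A2minus (2 * k + 3) q"
proof -
  have e: "(5 * (2 * k + 3)^2 - 4 * (2 * k + 3) - 5) div 4
      = 2 * (2 * k + 1) + k * (2 * k + 1) + (k + 1) * (2 * (k + 1) - 1) + (2 * (2 * k + 1) + 2) + k * (k + 1)"
  proof -
    have "5 * (2 * k + 3)^2 = 4 * (5 * k^2 + 13 * k + 7) + (4 * (2 * k + 3) + 5)"
      by (simp add: power2_eq_square algebra_simps)
    hence "5 * (2 * k + 3)^2 - 4 * (2 * k + 3) - 5 = 4 * (5 * k^2 + 13 * k + 7)" by linarith
    moreover have "2 * (2 * k + 1) + k * (2 * k + 1) + (k + 1) * (2 * (k + 1) - 1) + (2 * (2 * k + 1) + 2) + k * (k + 1) = 5 * k^2 + 13 * k + 7"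
      by (simp add: power2_eq_square algebra_simps)
    ultimately show ?thesis by simp
  qed
  have i: "2 * k + 3 - 1 = Suc (2 * k + 1)" "Suc (2 * k + 1) div 2 = k + 1" by simp_all
  have S: "card (Skew (Suc (2 * k + 1)) :: 'a mat set) = q ^ ((k + 1) * (2 * (k + 1) - 1))" using nSkew_closed(1)[of "k + 1"] by simp
  show ?thesis unfolding Aconst_def A2minus_def e i nSkew_closed(2) S nSym_closed(2) power_add by (simp only: mult_ac)
qed

text \<open>Multiplied out by the symmetric count, so that no division of naturals occurs; this is
  the form in which \<open>B\<close> enters \<open>card_DC2\<close>.\<close>

lemma Bconst_plus: "B2plus (2 * k + 2) q * card (SymGL (2 * k) :: 'a mat set) = card (GL (Suc (2 * k)) :: 'a mat set) * (q + 1)"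
proof -
  have i: "2 * k + 2 - 1 = 2 * k + 1" "(2 * k + 2 - 2) div 2 = k" "(2 * k + 2 - 2)^2 div 4 = k ^ 2"
    by (simp_all add: power_mult_distrib)
  have g: "card (GL (Suc (2 * k)) :: 'a mat set) = card (GL (2 * k + 1) :: 'a mat set)" by simp
  show ?thesis unfolding B2plus_def i g nGL_odd by (simp only: mult_ac)
qed

lemma Bconst_minus: "B2minus (2 * k + 3) q * card (SymGL (2 * k + 1) :: 'a mat set) = card (GL (Suc (2 * k + 1)) :: 'a mat set) * (q + 1)"
proof -
  have "(2 * k + 2)^2 = 4 * (k + 1)^2" by (simp add: power2_eq_square)
  hence i: "2 * k + 3 - 1 = 2 * k + 2" "(2 * k + 2) div 2 = k + 1" "(2 * k + 2)^2 div 4 = (k + 1) ^ 2"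
    by simp_all
  have g: "card (GL (Suc (2 * k + 1)) :: 'a mat set) = card (GL (2 * k + 2) :: 'a mat set)" by simp
  show ?thesis unfolding B2minus_def i g nGL_even by (simp only: mult_ac)
qed

section \<open>Order, character sums and weights of the double coset\<close>

lemma DC2_eq: "DC2 (Suc (Suc r)) \<epsilon> = {x * \<sigma> r * y | x y. x \<in> Qgrp (Suc (Suc r)) \<epsilon> \<and> y \<in> Qgrp (Suc (Suc r)) (\<epsilon>::'a)}"
  by (simp add: DC2_def)

lemma finite_DC2: "finite (DC2 (Suc (Suc r)) (\<epsilon>::'a))"
proof -
  have "DC2 (Suc (Suc r)) \<epsilon> = (\<lambda>(x, y). x * \<sigma> r * y) ` (Qgrp (Suc (Suc r)) \<epsilon> \<times> Qgrp (Suc (Suc r)) \<epsilon>)"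
    unfolding DC2_eq by auto
  thus ?thesis using finite_Qgrp[of "Suc r" \<epsilon>] by simp
qed

text \<open>The index of \<open>Q \<inter> \<sigma> Q \<sigma>\<close> in \<open>Q\<close>.\<close>

definition index_const :: "'a itself \<Rightarrow> nat \<Rightarrow> nat" where
  "index_const T r = qbin1 q (Suc r) * q ^ (2 * r) * card (Skew r :: 'a mat set)"

text \<open>The double coset formula with the fibre size cancelled, as \<open>card Q\<close> is
  \<open>index_const\<close> times that size.\<close>

lemma sum_DC2:
  fixes f :: "'a mat \<Rightarrow> complex"
  assumes eps: "\<epsilon> \<noteq> 0" "\<nexists>b. \<epsilon> = b ^ 2"
    and f: "\<And>x y. x \<in> carrier_mat (Suc r + Suc r + 2) (Suc r + Suc r + 2) \<Longrightarrow>
      y \<in> carrier_mat (Suc r + Suc r + 2) (Suc r + Suc r + 2) \<Longrightarrow> f (x * y) = f (y * x)"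
  shows "(\<Sum>d\<in>DC2 (Suc (Suc r)) \<epsilon>. f d) = of_nat (index_const TYPE('a) r) * (\<Sum>x\<in>Qgrp (Suc (Suc r)) \<epsilon>. f (x * \<sigma> r))"
proof -
  let ?Q = "Qgrp (Suc (Suc r)) \<epsilon>"
  define S where "S = card {w \<in> ?Q. \<sigma> r * w * \<sigma> r \<in> ?Q}"
  have "of_nat S * (\<Sum>d\<in>DC2 (Suc (Suc r)) \<epsilon>. f d) = of_nat (card ?Q) * (\<Sum>x\<in>?Q. f (x * \<sigma> r))"
    unfolding S_def DC2_eq
  proof (rule double_coset_sum)
    show "finite ?Q" by (rule finite_Qgrp)
    show "\<sigma> r \<in> carrier_mat (Suc r + Suc r + 2) (Suc r + Suc r + 2)" by (rule sigma_carrier)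
    show "\<sigma> r * \<sigma> r = (1\<^sub>m (Suc r + Suc r + 2) :: 'a mat)" by (rule sigma_sigma)
    show "\<And>x y. x \<in> carrier_mat (Suc r + Suc r + 2) (Suc r + Suc r + 2) \<Longrightarrow>
      y \<in> carrier_mat (Suc r + Suc r + 2) (Suc r + Suc r + 2) \<Longrightarrow> f (x * y) = f (y * x)" by (rule f)
    show "?Q \<subseteq> GL (Suc r + Suc r + 2)" unfolding Qgrp_eq_Qchar by (rule Qchar_GL[OF eps(1)])
    show "\<And>x y. x \<in> ?Q \<Longrightarrow> y \<in> ?Q \<Longrightarrow> x * y \<in> ?Q" unfolding Qgrp_eq_Qchar by (rule Qchar_mult)
  qed
  moreover have "card ?Q = index_const TYPE('a) r * S"
  proof -
    \<comment> \<open>Multiplying by \<open>q - 1\<close> clears the denominator of the Gaussian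
      binomial.\<close>
    have "(q - 1) * card ?Q = (q - 1) * (index_const TYPE('a) r * S)"
    proof -
      have "(q - 1) * (index_const TYPE('a) r * S) = (qbin1 q (Suc r) * (q - 1)) * q ^ (2 * r) * card (Skew r :: 'a mat set) * S"
        by (simp only: index_const_def mult_ac)
      also have "\<dots> = (q ^ Suc r - 1) * q ^ (2 * r) * card (Skew r :: 'a mat set) * (((q - 1) * q ^ r * card (GL r :: 'a mat set)) * (q + 1) * q ^ 2 * q ^ r)"
        unfolding qbin1_mult S_def card_stab[OF eps] ..
      also have "\<dots> = (q - 1) * (((q ^ Suc r - 1) * q ^ r * card (GL r :: 'a mat set)) * (q + 1) * (q ^ (2 * r) * q ^ 2) * (q ^ r * card (Skew r :: 'a mat set)))"
        by (simp only: mult_ac)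
      also have "q ^ (2 * r) * q ^ 2 = q ^ (2 * Suc r)" unfolding power_add[symmetric] by simp
      finally show ?thesis unfolding card_Qgrp[OF eps] card_Skew_Suc nGL_Suc by (rule sym)
    qed
    thus ?thesis using q_gt_1 by simp
  qed
  moreover have "S \<noteq> 0"
  proof
    assume "S = 0"
    hence "card ?Q = 0" using calculation(2) by simp
    moreover have "card (GL k :: 'a mat set) > 0" for k
    proof -
      have "1\<^sub>m k \<in> (GL k :: 'a mat set)" by (simp add: GL_def)
      thus ?thesis by (auto simp: card_gt_0_iff)
    qed
    moreover have "card (Skew k :: 'a mat set) > 0" for k
    proof -
      have "0\<^sub>m k k \<in> (Skew k :: 'a mat set)" by (auto simp: Skew_def intro!: eq_matI)
      thus ?thesis by (auto simp: card_gt_0_iff)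
    qed
    ultimately show False unfolding card_Qgrp[OF eps] by (metis mult_eq_0_iff less_irrefl add_is_0 one_neq_zero power_not_zero zero_neq_numeral)
  qed
  ultimately show ?thesis by simp
qed

text \<open>The double coset formula for the constant function 1; the symmetric count absorbed into
  \<open>B\<close> is regained in \<open>Aconst\<close>.\<close>

lemma card_DC2:
  fixes \<epsilon> :: 'a
  assumes eps: "\<epsilon> \<noteq> 0" "\<nexists>b. \<epsilon> = b ^ 2" and B: "B * card (SymGL r :: 'a mat set) = card (GL (Suc r) :: 'a mat set) * (q + 1)"
  shows "card (DC2 (Suc (Suc r)) \<epsilon>) = Aconst TYPE('a) r * B"
proof -
  have "of_nat (card (DC2 (Suc (Suc r)) \<epsilon>)) = (of_nat (index_const TYPE('a) r * card (Qgrp (Suc (Suc r)) \<epsilon>)) :: complex)"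
    using sum_DC2[OF eps, of r "\<lambda>_. 1"] by simp
  hence "card (DC2 (Suc (Suc r)) \<epsilon>) = index_const TYPE('a) r * card (Qgrp (Suc (Suc r)) \<epsilon>)" by (simp only: of_nat_eq_iff)
  also have "\<dots> = index_const TYPE('a) r * ((B * card (SymGL r :: 'a mat set)) * q ^ (2 * Suc r) * card (Skew (Suc r) :: 'a mat set))"
    unfolding card_Qgrp[OF eps] B ..
  also have "\<dots> = Aconst TYPE('a) r * B" unfolding Aconst_def index_const_def by (simp add: mult_ac)
  finally show ?thesis .
qed

lemma sum_lam_DC2:
  assumes eps: "\<epsilon> \<noteq> 0" "\<nexists>b. \<epsilon> = b ^ 2" and a: "a \<noteq> 0"
  shows "(\<Sum>g\<in>DC2 (Suc (Suc r)) \<epsilon>. \<chi> (a * mat_tr g)) = - ((-1) ^ r * of_nat (Aconst TYPE('a) r) * kloos s (a ^ 2) ^ 2)"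
proof -
  have "(\<Sum>g\<in>DC2 (Suc (Suc r)) \<epsilon>. \<chi> (a * mat_tr g))
    = of_nat (index_const TYPE('a) r) * (\<Sum>x\<in>Qgrp (Suc (Suc r)) \<epsilon>. \<chi> (a * mat_tr (x * \<sigma> r)))"
    by (rule sum_DC2[OF eps]) (simp only: mat_tr_mult_comm)
  also have "\<dots> = - ((-1) ^ r * of_nat (Aconst TYPE('a) r) * kloos s (a ^ 2) ^ 2)"
    unfolding sum_Qgrp_sigma[OF eps a] Aconst_def index_const_def of_nat_mult
    by (simp only: mult_minus_right mult_ac)
  finally show ?thesis .
qed

text \<open>Expanding the indicator of nonzero trace leaves two thirds of the length, which is
  \<open>A B\<close>, minus a third of the character sums at \<open>a\<close> and
  \<open>2 a\<close>.\<close>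

lemma weight_DC2:
  fixes \<epsilon> :: 'a
  assumes eps: "\<epsilon> \<noteq> 0" "\<nexists>b. \<epsilon> = b ^ 2" and a: "a \<noteq> 0" and B: "B * card (SymGL r :: 'a mat set) = card (GL (Suc r) :: 'a mat set) * (q + 1)"
  shows "of_nat (card {g \<in> DC2 (Suc (Suc r)) \<epsilon>. ftr s (a * mat_tr g) \<noteq> 0})
    = 2 * of_nat (Aconst TYPE('a) r) / 3 * (of_nat B + (-1) ^ r * kloos s (a ^ 2) ^ 2)"
proof -
  let ?D = "DC2 (Suc (Suc r)) \<epsilon>"
  have fD: "finite ?D" by (rule finite_DC2)
  have "(of_nat (card {g \<in> ?D. ftr s (a * mat_tr g) \<noteq> 0}) :: complex)
      = (\<Sum>g\<in>?D. if ftr s (a * mat_tr g) \<noteq> 0 then 1 else 0)"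
    using fD by (simp flip: sum.inter_filter)
  also have "\<dots> = (\<Sum>g\<in>?D. 2 / 3 - (\<chi> (a * mat_tr g) + \<chi> (2 * a * mat_tr g)) / 3)"
  proof (rule sum.cong[OF refl])
    fix g
    show "(if ftr s (a * mat_tr g) \<noteq> 0 then 1 else 0) = 2 / 3 - (\<chi> (a * mat_tr g) + \<chi> (2 * a * mat_tr g)) / 3"
      unfolding indicator_ftr[symmetric] by (simp add: weight3_def mult.assoc diff_divide_distrib add_divide_distrib)
  qed
  also have "\<dots> = 2 / 3 * of_nat (card ?D) - ((\<Sum>g\<in>?D. \<chi> (a * mat_tr g)) + (\<Sum>g\<in>?D. \<chi> (2 * a * mat_tr g))) / 3"
    by (simp add: sum_subtractf sum.distrib flip: sum_divide_distrib)
  also have "\<dots> = 2 * of_nat (Aconst TYPE('a) r) / 3 * (of_nat B + (-1) ^ r * kloos s (a ^ 2) ^ 2)"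
  proof -
    \<comment> \<open>In characteristic 3, \<open>2 a = - a\<close>, so both character sums involve
      the same Kloosterman sum.\<close>
    have "2 * a \<noteq> 0" "(2 * a) ^ 2 = a ^ 2" using a by (simp_all add: two_eq)
    thus ?thesis using sum_lam_DC2[OF eps, of "2 * a" r]
      unfolding card_DC2[OF eps B] sum_lam_DC2[OF eps a] by (simp add: field_simps)
  qed
  finally show ?thesis .
qed

lemma Aconst_pos: "Aconst TYPE('a) r > 0"
proof -
  have "1\<^sub>m r \<in> (SymGL r :: 'a mat set)" by (simp add: SymGL_def GL_def)
  hence "card (SymGL r :: 'a mat set) > 0" by (auto simp: card_gt_0_iff)
  moreover have "card (Skew k :: 'a mat set) > 0" for k
  proof -
    have "0\<^sub>m k k \<in> (Skew k :: 'a mat set)" by (auto simp: Skew_def intro!: eq_matI)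
    thus ?thesis by (auto simp: card_gt_0_iff)
  qed
  moreover have "qbin1 q (Suc r) > 0"
  proof (rule ccontr)
    assume "\<not> ?thesis"
    hence "q ^ Suc r - 1 = 0" using qbin1_mult[of "Suc r"] by simp
    thus False using one_less_power[OF q_gt_1, of "Suc r"] by simp
  qed
  ultimately show ?thesis unfolding Aconst_def using q_gt_1 by simp
qed

text \<open>By the weight formula the moment identity evaluates the sum of
  \<open>(B + \<eta> K\<^sup>2) ^ h\<close> over squares; the binomial theorem turns it into the
  sums \<open>SK\<close>, and the term \<open>l = h\<close> is isolated.\<close>

lemma power_moment_DC2:
  fixes \<epsilon> :: 'a
  assumes eps: "\<epsilon> \<noteq> 0" "\<nexists>b. \<epsilon> = b ^ 2" and B: "B * card (SymGL r :: 'a mat set) = card (GL (Suc r) :: 'a mat set) * (q + 1)" and h: "h \<ge> 1"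
  defines "D \<equiv> DC2 (Suc (Suc r)) \<epsilon>"
  defines "N \<equiv> card D"
  defines "\<eta> \<equiv> (-1) ^ r :: complex"
  shows "\<eta> ^ h * SK TYPE('a) s (2 * h) =
            - (\<Sum>l=0..h-1. \<eta> ^ l * of_nat (h choose l) * of_nat B ^ (h - l) * SK TYPE('a) s (2 * l))
            + of_nat q * inverse (of_nat (Aconst TYPE('a) r) ^ h) *
              (\<Sum>j=0..min N h. (-1) ^ j * of_nat (wdist D j) *
                 (\<Sum>t=j..h. of_nat (fact t) * stirS h t * 3 ^ (h - t) *
                    (2::complex) powi (int t - int h - int j - 1) *
                    (if t \<le> N then of_nat ((N - j) choose (N - t)) else 0)))"
proof -
  let ?A = "of_nat (Aconst TYPE('a) r) :: complex" and ?b = "of_nat B :: complex"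
  let ?K = "\<lambda>c. kloos s (c::'a)"
  let ?w = "\<lambda>a. of_nat (card {g\<in>D. ftr s (a * mat_tr g) \<noteq> 0}) :: complex"
  let ?I = "\<lambda>j t. if t \<le> N then of_nat ((N - j) choose (N - t)) else (0::complex)"
  have A: "?A \<noteq> 0" using Aconst_pos[of r] by simp
  have "(\<Sum>l\<le>h. \<eta> ^ l * of_nat (h choose l) * ?b ^ (h - l) * SK TYPE('a) s (2 * l))
    = (\<Sum>c\<in>nonzero_squares. (?b + \<eta> * ?K c ^ 2) ^ h)"
  proof -
    have "(?b + \<eta> * x ^ 2) ^ h = (\<Sum>l\<le>h. \<eta> ^ l * of_nat (h choose l) * ?b ^ (h - l) * x ^ (2 * l))" for x
      unfolding add.commute[of ?b] binomial_ring
      by (simp only: power_mult_distrib power_mult[of x, symmetric] mult_ac)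
    thus ?thesis unfolding SK_def by (simp only: sum_distrib_left) (rule sum.swap)
  qed
  \<comment> \<open>Every nonzero square has two roots.\<close>
  also have "\<dots> = 1 / 2 * (\<Sum>a\<in>UNIV - {0::'a}. (?b + \<eta> * ?K (a ^ 2) ^ 2) ^ h)"
    using sum_over_squares[of "\<lambda>c. (?b + \<eta> * ?K c ^ 2) ^ h"] by simp
  also have "\<dots> = 1 / 2 * (3 / (2 * ?A)) ^ h * (\<Sum>a\<in>UNIV. ?w a ^ h)"
  proof -
    \<comment> \<open>The word for \<open>a = 0\<close> has weight 0, and \<open>0 ^ h = 0\<close>
      because \<open>h \<ge> 1\<close>.\<close>
    have "(\<Sum>a\<in>UNIV. ?w a ^ h) = (\<Sum>a\<in>UNIV - {0}. ?w a ^ h)"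
      using h by (intro sum.mono_neutral_right) auto
    also have "\<dots> = (\<Sum>a\<in>UNIV - {0}. (2 * ?A / 3) ^ h * (?b + \<eta> * ?K (a ^ 2) ^ 2) ^ h)"
      unfolding D_def \<eta>_def
      by (rule sum.cong[OF refl], subst weight_DC2[OF eps _ B], simp, rule power_mult_distrib)
    also have "\<dots> = (2 * ?A / 3) ^ h * (\<Sum>a\<in>UNIV - {0}. (?b + \<eta> * ?K (a ^ 2) ^ 2) ^ h)"
      by (simp only: sum_distrib_left)
    finally have "(3 / (2 * ?A)) ^ h * (\<Sum>a\<in>UNIV. ?w a ^ h)
      = ((3 / (2 * ?A)) ^ h * (2 * ?A / 3) ^ h) * (\<Sum>a\<in>UNIV - {0}. (?b + \<eta> * ?K (a ^ 2) ^ 2) ^ h)"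
      by (simp only: mult.assoc)
    also have "(3 / (2 * ?A)) ^ h * (2 * ?A / 3) ^ h = 1"
      unfolding power_mult_distrib[symmetric] using A by simp
    finally show ?thesis by (simp only: mult.assoc mult_1_left)
  qed
  also have "(\<Sum>a\<in>UNIV. ?w a ^ h) = of_nat q * (\<Sum>j=0..min N h. (-1) ^ j * of_nat (wdist D j) *
        (\<Sum>t=j..h. of_nat (fact t) * stirS h t * (2 ^ (t - j) / 3 ^ t) * ?I j t))"
    unfolding N_def by (rule moment_identity) (simp add: D_def finite_DC2)
  also have "1 / 2 * (3 / (2 * ?A)) ^ h * (of_nat q * (\<Sum>j=0..min N h. (-1) ^ j * of_nat (wdist D j) *
        (\<Sum>t=j..h. of_nat (fact t) * stirS h t * (2 ^ (t - j) / 3 ^ t) * ?I j t)))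
    = of_nat q * inverse (?A ^ h) * (\<Sum>j=0..min N h. (-1) ^ j * of_nat (wdist D j) *
        (\<Sum>t=j..h. of_nat (fact t) * stirS h t * 3 ^ (h - t) * 2 powi (int t - int h - int j - 1) * ?I j t))"
  proof -
    have p: "1 / 2 * (3 / 2) ^ h * (2 ^ (t - j) / 3 ^ t) = (3 ^ (h - t) * 2 powi (int t - int h - int j - 1) :: complex)"
      if "j \<le> t" "t \<le> h" for j t
    proof -
      have "(3::complex) ^ h = 3 ^ (h - t) * 3 ^ t" using that by (simp flip: power_add)
      \<comment> \<open>The \<open>-1\<close> in the exponent is the factor 1/2 from the two roots;
        \<open>h\<close> and \<open>j\<close> come from \<open>(3 / 2) ^ h\<close> and
        \<open>2 ^ (t - j)\<close>.\<close>
      moreover have "2 powi (int t - int h - int j - 1) = (2 ^ (t - j) / (2 * 2 ^ h) :: complex)"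
      proof -
        have "int t - int h - int j - 1 = int (t - j) - int (Suc h)" using that by simp
        hence "2 powi (int t - int h - int j - 1) = (2 powi (int (t - j) - int (Suc h)) :: complex)"
          by (simp only:)
        also have "\<dots> = 2 powi int (t - j) / 2 powi int (Suc h)" by (rule power_int_diff) simp
        finally show ?thesis by (simp only: power_int_of_nat power_Suc)
      qed
      moreover have "1 / 2 * (3 / 2) ^ h * (2 ^ (t - j) / 3 ^ t) = 3 ^ h / 3 ^ t * (2 ^ (t - j) / (2 * 2 ^ h) :: complex)"
        by (simp add: power_divide)
      ultimately show ?thesis by (simp only:) simp
    qed
    have c: "1 / 2 * (3 / (2 * ?A)) ^ h = inverse (?A ^ h) * (1 / 2 * (3 / 2) ^ h)"
      by (simp add: power_divide power_mult_distrib field_simps)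
    have "(1 / 2 * (3 / 2) ^ h) * (\<Sum>j=0..min N h. (-1) ^ j * of_nat (wdist D j) *
        (\<Sum>t=j..h. of_nat (fact t) * stirS h t * (2 ^ (t - j) / 3 ^ t) * ?I j t))
      = (\<Sum>j=0..min N h. (-1) ^ j * of_nat (wdist D j) *
        (\<Sum>t=j..h. of_nat (fact t) * stirS h t * (1 / 2 * (3 / 2) ^ h * (2 ^ (t - j) / 3 ^ t)) * ?I j t))"
      by (simp only: sum_distrib_left mult_ac)
    also have "\<dots> = (\<Sum>j=0..min N h. (-1) ^ j * of_nat (wdist D j) *
        (\<Sum>t=j..h. of_nat (fact t) * stirS h t * (3 ^ (h - t) * 2 powi (int t - int h - int j - 1)) * ?I j t))"
    proof (rule sum.cong[OF refl])
      fix j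
      have "(\<Sum>t=j..h. of_nat (fact t) * stirS h t * (1 / 2 * (3 / 2) ^ h * (2 ^ (t - j) / 3 ^ t)) * ?I j t)
        = (\<Sum>t=j..h. of_nat (fact t) * stirS h t * (3 ^ (h - t) * 2 powi (int t - int h - int j - 1)) * ?I j t)"
        by (rule sum.cong[OF refl]) (simp only: p atLeastAtMost_iff)
      thus "(-1) ^ j * of_nat (wdist D j) *
          (\<Sum>t=j..h. of_nat (fact t) * stirS h t * (1 / 2 * (3 / 2) ^ h * (2 ^ (t - j) / 3 ^ t)) * ?I j t)
        = (-1) ^ j * of_nat (wdist D j) *
          (\<Sum>t=j..h. of_nat (fact t) * stirS h t * (3 ^ (h - t) * 2 powi (int t - int h - int j - 1)) * ?I j t)"
        by (simp only:)
    qed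
    finally have e: "(1 / 2 * (3 / 2) ^ h) * (\<Sum>j=0..min N h. (-1) ^ j * of_nat (wdist D j) *
        (\<Sum>t=j..h. of_nat (fact t) * stirS h t * (2 ^ (t - j) / 3 ^ t) * ?I j t))
      = (\<Sum>j=0..min N h. (-1) ^ j * of_nat (wdist D j) *
        (\<Sum>t=j..h. of_nat (fact t) * stirS h t * (3 ^ (h - t) * 2 powi (int t - int h - int j - 1)) * ?I j t))" .
    have g: "u * c * (v * x) = v * u * (c * x)" for u c v x :: complex by (simp only: mult_ac)
    show ?thesis unfolding c by (subst g, subst e) (simp only: mult.assoc)
  qed
  finally have "(\<Sum>l\<le>h. \<eta> ^ l * of_nat (h choose l) * ?b ^ (h - l) * SK TYPE('a) s (2 * l))
    = of_nat q * inverse (?A ^ h) * (\<Sum>j=0..min N h. (-1) ^ j * of_nat (wdist D j) *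
        (\<Sum>t=j..h. of_nat (fact t) * stirS h t * 3 ^ (h - t) * 2 powi (int t - int h - int j - 1) * ?I j t))" .
  moreover have "(\<Sum>l\<le>h. \<eta> ^ l * of_nat (h choose l) * ?b ^ (h - l) * SK TYPE('a) s (2 * l))
    = (\<Sum>l=0..h-1. \<eta> ^ l * of_nat (h choose l) * ?b ^ (h - l) * SK TYPE('a) s (2 * l)) + \<eta> ^ h * SK TYPE('a) s (2 * h)"
    using h by (cases h) (simp_all add: atMost_atLeast0)
  ultimately show ?thesis by (simp add: algebra_simps)
qed

end

theorem theorem1:
  fixes \<epsilon> :: "'a::{finite,field}" and s n :: nat and plus :: bool
  assumes card: "card (UNIV :: 'a set) = 3 ^ s"
    and eps_nz: "\<epsilon> \<noteq> 0" and eps_nsq: "\<not> (\<exists>b. \<epsilon> = b ^ 2)"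
    and sign: "(plus \<and> even n \<and> n \<ge> 2) \<or> (\<not> plus \<and> odd n \<and> n \<ge> 3)"
  shows
    "let q = 3 ^ s;
         D = DC2 n \<epsilon>;
         N = card D;
         A = (if plus then A2plus n q else A2minus n q);
         B = (if plus then B2plus n q else B2minus n q);
         \<eta> = (if plus then (1::complex) else -1)
     in N = A * B \<and>
        (\<forall>h::nat. h \<ge> 1 \<longrightarrow>
          \<eta> ^ h * SK TYPE('a) s (2 * h) =
            - (\<Sum>l=0..h-1. \<eta> ^ l * of_nat (h choose l) * of_nat B ^ (h - l) * SK TYPE('a) s (2 * l))
            + of_nat q * inverse (of_nat A ^ h) *
              (\<Sum>j=0..min N h. (-1) ^ j * of_nat (wdist D j) *
                 (\<Sum>t=j..h. of_nat (fact t) * stirS h t * 3 ^ (h - t) *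
                    (2::complex) powi (int t - int h - int j - 1) *
                    (if t \<le> N then of_nat ((N - j) choose (N - t)) else 0))))"
proof -
  interpret ternary s "TYPE('a)" by unfold_locales (rule card)
  \<comment> \<open>\<open>n\<close> and \<open>r\<close> have the same parity, so \<eta> is
    \<open>(-1) ^ r\<close> and the parity-free lemmas cover both cases.\<close>
  define r where "r = n - 2"
  have n: "n = Suc (Suc r)" using sign by (auto simp: r_def)
  define A where "A = (if plus then A2plus n (3 ^ s) else A2minus n (3 ^ s))"
  define B where "B = (if plus then B2plus n (3 ^ s) else B2minus n (3 ^ s))"
  have *: "A = Aconst TYPE('a) r \<and> B * card (SymGL r :: 'a mat set) = card (GL (Suc r) :: 'a mat set) * (3 ^ s + 1)
      \<and> (if plus then (1::complex) else -1) = (-1) ^ r"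
  proof (cases plus)
    case True
    hence "even r" using sign n by simp
    then obtain k where "r = 2 * k" by (elim evenE)
    moreover from this have "n = 2 * k + 2" using n by simp
    ultimately show ?thesis using True Aconst_plus[of k] Bconst_plus[of k] by (simp add: A_def B_def)
  next
    case False
    then obtain k where "r = 2 * k + 1" using sign n by (auto elim!: oddE)
    moreover from this have "n = 2 * k + 3" using n by simp
    ultimately show ?thesis using False Aconst_minus[of k] Bconst_minus[of k] by (simp add: A_def B_def)
  qed
  note A = *[THEN conjunct1] and B = *[THEN conjunct2, THEN conjunct1] and eta = *[THEN conjunct2, THEN conjunct2]
  show ?thesis
    unfolding Let_def A_def[symmetric] B_def[symmetric] eta
    unfolding A n
    using card_DC2[OF eps_nz eps_nsq B] power_moment_DC2[OF eps_nz eps_nsq B] by blast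
qed

end
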